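(* Let $K$ be a field whose operations are computable, let $F$ be a free group of finite rank $r\ge 1$ (with a given basis), and let $K[F]$ be the free group algebra. There exist algorithms which, given $m\in\mathbb{Z}_{\ge 1}$ and an extension $M\le N$ of finitely generated $K[F]$-submodules of $K[F]^m$ (each given by a finite generating set), (i) compute the algebraic closure of the extension $M\le N$ (i.e. output a finite generating set for it); (ii) decide whether the extension $M\le N$ is algebraic; (iii) decide whether $M$ is a free factor of $N$.
   Context: $K[F]$ is the $K$-vector space with basis $F$ and multiplication extending that of $F$ bilinearly. It is a free ideal ring: every submodule of a free $K[F]$-module (left or right) is free, of well-defined rank. "Module" means left or right module. "The operations of $K$ are computable" means that elements of $K$ have finite representations with respect to which the field operations and the equality test are computable. Let $N$ be a free $K[F]$-module and $M\le N$ a submodule. $M$ is a free factor of $N$, written $M\le_* N$, if a basis of $M$ can be extended to a basis of $N$. The extension $M\le N$ is algebraic, written $M\le_{\mathrm{alg}}N$, if there is no free factor $L$ of $N$ with $M\le L\subsetneq N$. If at least one of $M,N$ is of finite rank, the algebraic closure of $M\le N$ is the unique submodule $L$ with $M\le_{\mathrm{alg}}L\le_* N$ (it exists and is unique). *)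

theory Defs
  imports
    "HOL-Library.Poly_Mapping"
    "HOL-Library.Function_Algebras"
    "HOL-Library.Nat_Bijection"
begin

section \<open>Algorithms\<close>

text \<open>
  An algorithm is a partial recursive function in Kleene's sense. All functions are unary; tuples
  and lists are passed through the Cantor pairing \<open>prod_encode\<close> and \<open>list_encode\<close>. The value
  \<open>None\<close> means that the computation diverges.
\<close>

primrec prim_rec :: "(nat \<rightharpoonup> nat) \<Rightarrow> (nat \<rightharpoonup> nat) \<Rightarrow> nat \<Rightarrow> nat \<Rightarrow> nat option" where
  "prim_rec f g a 0 = f a"
| "prim_rec f g a (Suc n) =
     Option.bind (prim_rec f g a n) (\<lambda>y. g (prod_encode (a, prod_encode (n, y))))"

definition minimize :: "(nat \<rightharpoonup> nat) \<Rightarrow> nat \<rightharpoonup> nat" where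
  "minimize f a =
     (if \<exists>n. f (prod_encode (a, n)) = Some 0 \<and> (\<forall>i<n. f (prod_encode (a, i)) \<noteq> None)
      then Some (LEAST n. f (prod_encode (a, n)) = Some 0) else None)"

inductive partial_recursive :: "(nat \<rightharpoonup> nat) \<Rightarrow> bool" where
  zero: "partial_recursive (\<lambda>_. Some 0)"
| succ: "partial_recursive (\<lambda>n. Some (Suc n))"
| first: "partial_recursive (\<lambda>n. Some (fst (prod_decode n)))"
| second: "partial_recursive (\<lambda>n. Some (snd (prod_decode n)))"
| pair: "partial_recursive f \<Longrightarrow> partial_recursive g \<Longrightarrow>
    partial_recursive
      (\<lambda>n. Option.bind (f n) (\<lambda>a. Option.bind (g n) (\<lambda>b. Some (prod_encode (a, b)))))"
| comp: "partial_recursive f \<Longrightarrow> partial_recursive g \<Longrightarrow>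
    partial_recursive (\<lambda>n. Option.bind (g n) f)"
| prec: "partial_recursive f \<Longrightarrow> partial_recursive g \<Longrightarrow>
    partial_recursive (\<lambda>p. prim_rec f g (fst (prod_decode p)) (snd (prod_decode p)))"
| mu: "partial_recursive f \<Longrightarrow> partial_recursive (minimize f)"


section \<open>Fields with computable operations\<close>

text \<open>
  \<open>\<nu> n = Some a\<close> means that \<open>n\<close> is a representation of the field element \<open>a\<close>. Elements may have several
  representations, and it need not be decidable whether a number is a representation at all: the
  algorithms only have to behave correctly on genuine representations.
\<close>

definition computable_field :: "(nat \<Rightarrow> 'k::field option) \<Rightarrow> bool" where
  "computable_field \<nu> \<longleftrightarrow>
     (\<forall>a. \<exists>i. \<nu> i = Some a) \<and>
     (\<exists>p. partial_recursive p \<and>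
        (\<forall>i j a b. \<nu> i = Some a \<and> \<nu> j = Some b \<longrightarrow>
           (\<exists>k. p (prod_encode (i, j)) = Some k \<and> \<nu> k = Some (a + b)))) \<and>
     (\<exists>p. partial_recursive p \<and>
        (\<forall>i j a b. \<nu> i = Some a \<and> \<nu> j = Some b \<longrightarrow>
           (\<exists>k. p (prod_encode (i, j)) = Some k \<and> \<nu> k = Some (a * b)))) \<and>
     (\<exists>p. partial_recursive p \<and>
        (\<forall>i a. \<nu> i = Some a \<longrightarrow> (\<exists>k. p i = Some k \<and> \<nu> k = Some (- a)))) \<and>
     (\<exists>p. partial_recursive p \<and>
        (\<forall>i a. \<nu> i = Some a \<and> a \<noteq> 0 \<longrightarrow> (\<exists>k. p i = Some k \<and> \<nu> k = Some (inverse a)))) \<and>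
     (\<exists>p. partial_recursive p \<and>
        (\<forall>i j a b. \<nu> i = Some a \<and> \<nu> j = Some b \<longrightarrow>
           p (prod_encode (i, j)) = Some (if a = b then 1 else 0)))"


section \<open>Free groups of finite rank\<close>

text \<open>
  The free group \<open>F\<close> is written additively (the class \<^class>\<open>group_add\<close> is not commutative), because the
  convolution product on \<open>'f \<Rightarrow>\<^sub>0 'k\<close> is defined for additive monoids \<open>'f\<close>. With this
  product, \<open>'f \<Rightarrow>\<^sub>0 'k\<close> is the group algebra \<open>K[F]\<close>, and \<open>Poly_Mapping.single g c\<close> is
  the element \<open>c g\<close>.

  The letter \<open>(i, True)\<close> stands for the \<open>i\<close>-th basis element \<open>x i\<close> and \<open>(i, False)\<close> for its inverse.
\<close>

definition letter_val :: "(nat \<Rightarrow> 'f::group_add) \<Rightarrow> nat \<times> bool \<Rightarrow> 'f" where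
  "letter_val x l = (if snd l then x (fst l) else - x (fst l))"

definition word_val :: "(nat \<Rightarrow> 'f::group_add) \<Rightarrow> (nat \<times> bool) list \<Rightarrow> 'f" where
  "word_val x w = sum_list (map (letter_val x) w)"

definition words :: "nat \<Rightarrow> (nat \<times> bool) list set" where
  "words r = lists ({..<r} \<times> UNIV)"

definition reduced :: "(nat \<times> bool) list \<Rightarrow> bool" where
  "reduced = successively (\<lambda>l l'. \<not> (fst l = fst l' \<and> snd l \<noteq> snd l'))"

text \<open>
  \<open>F\<close> is free on \<open>x 0, \<dots>, x (r - 1)\<close>: every element is given by exactly one reduced word.
\<close>

definition free_group_basis :: "nat \<Rightarrow> (nat \<Rightarrow> 'f::group_add) \<Rightarrow> bool" where
  "free_group_basis r x \<longleftrightarrow> bij_betw (word_val x) {w \<in> words r. reduced w} UNIV"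


section \<open>Modules over a noncommutative ring\<close>

text \<open>
  The theory \<open>HOL.Modules\<close> assumes a commutative ring, so the basic notions are restated here for a
  scalar multiplication \<open>s\<close>, in the same explicit form. Elements of \<open>R ^ m\<close> are functions
  \<open>nat \<Rightarrow> R\<close> that vanish from index \<open>m\<close> on.
\<close>

datatype side = Left_Module | Right_Module

fun scale :: "side \<Rightarrow> 'a::ring_1 \<Rightarrow> (nat \<Rightarrow> 'a) \<Rightarrow> (nat \<Rightarrow> 'a)" where
  "scale Left_Module a v = (\<lambda>i. a * v i)"
| "scale Right_Module a v = (\<lambda>i. v i * a)"

definition mod_span :: "('a::ring_1 \<Rightarrow> 'b::ab_group_add \<Rightarrow> 'b) \<Rightarrow> 'b set \<Rightarrow> 'b set" where
  "mod_span s B = {\<Sum>b\<in>T. s (c b) b | T c. finite T \<and> T \<subseteq> B}"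

definition mod_independent :: "('a::ring_1 \<Rightarrow> 'b::ab_group_add \<Rightarrow> 'b) \<Rightarrow> 'b set \<Rightarrow> bool" where
  "mod_independent s B \<longleftrightarrow>
     (\<forall>T c. finite T \<and> T \<subseteq> B \<and> (\<Sum>b\<in>T. s (c b) b) = 0 \<longrightarrow> (\<forall>b\<in>T. c b = 0))"

definition mod_basis :: "('a::ring_1 \<Rightarrow> 'b::ab_group_add \<Rightarrow> 'b) \<Rightarrow> 'b set \<Rightarrow> 'b set \<Rightarrow> bool" where
  "mod_basis s B M \<longleftrightarrow> mod_independent s B \<and> mod_span s B = M"

definition free_factor :: "('a::ring_1 \<Rightarrow> 'b::ab_group_add \<Rightarrow> 'b) \<Rightarrow> 'b set \<Rightarrow> 'b set \<Rightarrow> bool" where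
  "free_factor s M N \<longleftrightarrow> (\<exists>B C. mod_basis s B M \<and> B \<subseteq> C \<and> mod_basis s C N)"

definition algebraic_ext :: "('a::ring_1 \<Rightarrow> 'b::ab_group_add \<Rightarrow> 'b) \<Rightarrow> 'b set \<Rightarrow> 'b set \<Rightarrow> bool" where
  "algebraic_ext s M N \<longleftrightarrow> M \<subseteq> N \<and> \<not> (\<exists>L. free_factor s L N \<and> M \<subseteq> L \<and> L \<subset> N)"

definition is_algebraic_closure ::
  "('a::ring_1 \<Rightarrow> 'b::ab_group_add \<Rightarrow> 'b) \<Rightarrow> 'b set \<Rightarrow> 'b set \<Rightarrow> 'b set \<Rightarrow> bool" where
  "is_algebraic_closure s M N L \<longleftrightarrow> algebraic_ext s M L \<and> free_factor s L N"


section \<open>Finite descriptions of inputs and outputs\<close>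

text \<open>
  A word is given by the list of its letters, the letter \<open>(i, e)\<close> by the pair \<open>(i, 1)\<close> or \<open>(i, 0)\<close>.
  Words need not be reduced.
\<close>

definition letter_encode :: "nat \<times> bool \<Rightarrow> nat" where
  "letter_encode l = prod_encode (fst l, if snd l then 1 else 0)"

definition word_encode :: "(nat \<times> bool) list \<Rightarrow> nat" where
  "word_encode w = list_encode (map letter_encode w)"

text \<open>
  An element of \<open>K[F]\<close> is given by a list of pairs (representation of a coefficient, word) whose
  formal sum it is. Words may be repeated and coefficients may vanish.
\<close>

definition alg_code ::
  "(nat \<Rightarrow> 'k::field option) \<Rightarrow> nat \<Rightarrow> (nat \<Rightarrow> 'f::group_add) \<Rightarrow> nat \<Rightarrow> ('f \<Rightarrow>\<^sub>0 'k) \<Rightarrow> bool" where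
  "alg_code \<nu> r x n a \<longleftrightarrow>
     (\<exists>ts. n = list_encode (map (\<lambda>(i, w). prod_encode (i, word_encode w)) ts) \<and>
        (\<forall>(i, w)\<in>set ts. \<nu> i \<noteq> None \<and> w \<in> words r) \<and>
        a = (\<Sum>(i, w)\<leftarrow>ts. Poly_Mapping.single (word_val x w) (the (\<nu> i))))"

definition vec_code ::
  "(nat \<Rightarrow> 'k::field option) \<Rightarrow> nat \<Rightarrow> (nat \<Rightarrow> 'f::group_add) \<Rightarrow> nat \<Rightarrow>
     nat \<Rightarrow> (nat \<Rightarrow> 'f \<Rightarrow>\<^sub>0 'k) \<Rightarrow> bool" where
  "vec_code \<nu> r x m n v \<longleftrightarrow>
     (\<exists>cs. n = list_encode cs \<and> length cs = m \<and>
        (\<forall>i<m. alg_code \<nu> r x (cs ! i) (v i)) \<and> (\<forall>i\<ge>m. v i = 0))"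

text \<open>\<open>n\<close> describes the submodule \<open>M\<close> of \<open>K[F] ^ m\<close> by a finite list of generators.\<close>

definition submodule_code ::
  "side \<Rightarrow> (nat \<Rightarrow> 'k::field option) \<Rightarrow> nat \<Rightarrow> (nat \<Rightarrow> 'f::group_add) \<Rightarrow> nat \<Rightarrow>
     nat \<Rightarrow> (nat \<Rightarrow> 'f \<Rightarrow>\<^sub>0 'k) set \<Rightarrow> bool" where
  "submodule_code S \<nu> r x m n M \<longleftrightarrow>
     (\<exists>cs vs. n = list_encode cs \<and> list_all2 (vec_code \<nu> r x m) cs vs \<and>
        M = mod_span (scale S) (set vs))"

definition extension_code ::
  "side \<Rightarrow> (nat \<Rightarrow> 'k::field option) \<Rightarrow> nat \<Rightarrow> (nat \<Rightarrow> 'f::group_add) \<Rightarrow> nat \<Rightarrow>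
     nat \<Rightarrow> (nat \<Rightarrow> 'f \<Rightarrow>\<^sub>0 'k) set \<Rightarrow> (nat \<Rightarrow> 'f \<Rightarrow>\<^sub>0 'k) set \<Rightarrow> bool" where
  "extension_code S \<nu> r x m n M N \<longleftrightarrow>
     (\<exists>i j. n = prod_encode (m, prod_encode (i, j)) \<and>
        submodule_code S \<nu> r x m i M \<and> submodule_code S \<nu> r x m j N \<and> M \<subseteq> N)"

end

theory Submission
  imports Defs "HOL-Library.Product_Plus" "HOL-Library.Multiset"
begin

text \<open>
  Write \<open>R = K[F]\<close>. For generators of \<open>M \<le> N\<close> the algebraic closure is the double annihilator
  of \<open>M\<close> in \<open>N\<close>, the common kernel of all functionals \<open>N \<rightarrow> R\<close> that vanish on \<open>M\<close>; it is obtained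
  from kernels of matrices over \<open>R\<close>, and images of matrices over \<open>R\<close> are free. A matrix is first
  made linear, at the price of additional columns. A row combination with scalar coefficients whose
  entries involve only one of the elements \<open>1, x\<^sub>1, \<dots>, x\<^sub>r\<close> is a scalar row times a unit of \<open>R\<close>:
  it is a relation or it can be used to clear a column. When no such combination is left, the
  remaining rows are independent over \<open>R\<close> and no combination of them is a nonzero constant vector,
  since at a group element of maximal length in the coefficients nothing cancels. The second
  property decides whether the rows of a matrix span the whole free module, and hence inclusions
  of submodules. Only zero tests in \<open>K\<close> are needed, so elements of \<open>R\<close> remain formal sums throughout.
\<close>

section \<open>Computability relative to representations\<close>

text \<open>The obstacle is cancellation, since multiplying by a letter may shorten words. Join a
  coefficient g to the r + 1 positions g, g x_1, ..., g x_r that it reaches in a pencil. This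
  bipartite graph on two copies of F is a tree. Rooted at the position 1, every coefficient g has
  exactly one neighbouring position nearer to the root, and its other r positions are shared only
  with longer coefficients. So for a longest g in a combination all directions but one survive, and
  independence after deleting any single direction is the condition to aim for. The double
  annihilator of M is the closure for two reasons. Evaluating generators of the functionals that
  vanish on M maps N onto a finitely generated submodule of a free module; this image is free, so
  the kernel has a free complement in N. Conversely, if a free factor of N contains M, the
  coordinates outside it are functionals vanishing on M, so the double annihilator lies in every
  such factor. Hence M is algebraic in N iff the double annihilator contains N, and a free factor
  iff it is contained in M: both decisions are inclusions.\<close>

type_synonym 'a rep = "nat \<Rightarrow> 'a \<Rightarrow> bool"

text \<open>The algorithm acts on codes and need not respect their equivalence: two codes of
  \<open>a\<close> may yield different codes of \<open>f a\<close>. Outside the codes of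
  \<open>A\<close> nothing is demanded, not even termination, as the codes of field elements may be
  undecidable.\<close>

definition computable :: "'a rep \<Rightarrow> 'b rep \<Rightarrow> ('a \<Rightarrow> 'b) \<Rightarrow> bool" where
  "computable A B f \<longleftrightarrow>
     (\<exists>p. partial_recursive p \<and> (\<forall>n a. A n a \<longrightarrow> (\<exists>k. p n = Some k \<and> B k (f a))))"

definition prod_rep :: "'a rep \<Rightarrow> 'b rep \<Rightarrow> ('a \<times> 'b) rep" where
  "prod_rep A B n z \<longleftrightarrow> A (fst (prod_decode n)) (fst z) \<and> B (snd (prod_decode n)) (snd z)"

definition list_rep :: "'a rep \<Rightarrow> 'a list rep" where
  "list_rep A n xs \<longleftrightarrow> list_all2 A (list_decode n) xs"

definition bool_rep :: "bool rep" where
  "bool_rep n b \<longleftrightarrow> n = of_bool b"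

abbreviation nat_rep :: "nat rep" where
  "nat_rep \<equiv> (=)"

lemma computableI:
  assumes "partial_recursive p" "\<And>n a. A n a \<Longrightarrow> \<exists>k. p n = Some k \<and> B k (f a)"
  shows "computable A B f"
  using assms unfolding computable_def by blast

lemma computableE:
  assumes "computable A B f"
  obtains p where "partial_recursive p" "\<forall>n a. A n a \<longrightarrow> (\<exists>k. p n = Some k \<and> B k (f a))"
  using assms unfolding computable_def by (elim exE conjE)

lemma partial_recursive_id: "partial_recursive Some"
  using partial_recursive.pair[OF partial_recursive.first partial_recursive.second] by simp

lemma partial_recursive_const: "partial_recursive (\<lambda>_. Some k)"
proof (induction k)
  case 0
  show ?case by (rule partial_recursive.zero)
next
  case (Suc k)
  show ?case using partial_recursive.comp[OF partial_recursive.succ Suc] by simp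
qed

lemma computable_id: "computable A A (\<lambda>e. e)"
  by (rule computableI[OF partial_recursive_id]) simp

lemma computable_compose:
  assumes g: "computable B C g" and f: "computable A B f"
  shows "computable A C (\<lambda>e. g (f e))"
proof -
  obtain p where p: "partial_recursive p" "\<forall>n a. A n a \<longrightarrow> (\<exists>k. p n = Some k \<and> B k (f a))"
    using f by (rule computableE)
  obtain q where q: "partial_recursive q" "\<forall>n b. B n b \<longrightarrow> (\<exists>k. q n = Some k \<and> C k (g b))"
    using g by (rule computableE)
  show ?thesis
    by (rule computableI[OF partial_recursive.comp[OF q(1) p(1)]]) (use p(2) q(2) in fastforce)
qed

lemma computable_const: "B k c \<Longrightarrow> computable A B (\<lambda>e. c)"
  by (rule computableI[OF partial_recursive_const[of k]]) simp

lemma computable_nat: "computable A nat_rep (\<lambda>e. c)"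
  by (rule computable_const) simp

lemma computable_True: "computable A bool_rep (\<lambda>e. True)"
  by (rule computable_const[of _ 1]) (simp add: bool_rep_def)

lemma computable_False: "computable A bool_rep (\<lambda>e. False)"
  by (rule computable_const[of _ 0]) (simp add: bool_rep_def)

lemma computable_Nil: "computable A (list_rep B) (\<lambda>e. [])"
  by (rule computable_const[of _ 0]) (simp add: list_rep_def)

lemma computable_Pair:
  assumes f: "computable A B f" and g: "computable A C g"
  shows "computable A (prod_rep B C) (\<lambda>e. (f e, g e))"
proof -
  obtain p where p: "partial_recursive p" "\<forall>n a. A n a \<longrightarrow> (\<exists>k. p n = Some k \<and> B k (f a))"
    using f by (rule computableE)
  obtain q where q: "partial_recursive q" "\<forall>n a. A n a \<longrightarrow> (\<exists>k. q n = Some k \<and> C k (g a))"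
    using g by (rule computableE)
  show ?thesis
    by (rule computableI[OF partial_recursive.pair[OF p(1) q(1)]])
      (use p(2) q(2) in \<open>fastforce simp: prod_rep_def\<close>)
qed

lemma computable_fst:
  assumes "computable A (prod_rep B C) f"
  shows "computable A B (\<lambda>e. fst (f e))"
proof (rule computable_compose[OF _ assms])
  show "computable (prod_rep B C) B fst"
    by (rule computableI[OF partial_recursive.first]) (simp add: prod_rep_def)
qed

lemma computable_snd:
  assumes "computable A (prod_rep B C) f"
  shows "computable A C (\<lambda>e. snd (f e))"
proof (rule computable_compose[OF _ assms])
  show "computable (prod_rep B C) C snd"
    by (rule computableI[OF partial_recursive.second]) (simp add: prod_rep_def)
qed

lemma computable_Suc:
  assumes "computable A nat_rep f"
  shows "computable A nat_rep (\<lambda>e. Suc (f e))"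
proof (rule computable_compose[OF _ assms])
  show "computable nat_rep nat_rep Suc"
    by (rule computableI[OF partial_recursive.succ]) simp
qed

text \<open>The parameter carried by the recursion is the entire input \<open>n\<close>, so the base
  and the step can recompute from it whatever they need.\<close>

lemma partial_recursive_iterate:
  assumes f: "partial_recursive f" and g: "partial_recursive g" and h: "partial_recursive h"
  shows "partial_recursive (\<lambda>n. Option.bind (h n) (prim_rec f g n))"
proof -
  have "partial_recursive (\<lambda>n. Option.bind (Option.bind (h n) (\<lambda>b. Some (prod_encode (n, b))))
      (\<lambda>p. prim_rec f g (fst (prod_decode p)) (snd (prod_decode p))))"
    using partial_recursive.comp[OF partial_recursive.prec[OF f g]
        partial_recursive.pair[OF partial_recursive_id h]] by simp
  moreover have "Option.bind (Option.bind (h n) (\<lambda>b. Some (prod_encode (n, b))))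
      (\<lambda>p. prim_rec f g (fst (prod_decode p)) (snd (prod_decode p))) = Option.bind (h n) (prim_rec f g n)" for n
    by (cases "h n") auto
  ultimately show ?thesis by simp
qed

text \<open>The step sees the environment, the counter and the previous value as a nested pair. The
  rules are stated for bodies in a free environment \<open>e\<close>, so that a compound definition
  is shown computable by unfolding it and resolving along its syntax.\<close>

lemma computable_rec_nat:
  assumes f: "computable A B f" and n: "computable A nat_rep n"
    and g: "computable (prod_rep A (prod_rep nat_rep B)) B (\<lambda>t. g (fst t) (fst (snd t)) (snd (snd t)))"
  shows "computable A B (\<lambda>e. rec_nat (f e) (g e) (n e))"
proof -
  obtain p where p: "partial_recursive p" "\<forall>n a. A n a \<longrightarrow> (\<exists>k. p n = Some k \<and> B k (f a))"
    using f by (rule computableE)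
  obtain h where h: "partial_recursive h" "\<forall>c a. A c a \<longrightarrow> (\<exists>k. h c = Some k \<and> k = n a)"
    using n by (rule computableE)
  obtain q where q: "partial_recursive q"
    "\<forall>n a. prod_rep A (prod_rep nat_rep B) n a \<longrightarrow>
       (\<exists>k. q n = Some k \<and> B k (g (fst a) (fst (snd a)) (snd (snd a))))"
    using g by (rule computableE)
  have iter: "\<exists>k. prim_rec p q c t = Some k \<and> B k (rec_nat (f a) (g a) t)" if "A c a" for c a t
  proof (induction t)
    case 0
    show ?case using p(2) that by simp
  next
    case (Suc t)
    then obtain k where k: "prim_rec p q c t = Some k" "B k (rec_nat (f a) (g a) t)" by blast
    have "prod_rep A (prod_rep nat_rep B) (prod_encode (c, prod_encode (t, k)))
        (a, (t, rec_nat (f a) (g a) t))"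
      using that k(2) by (simp add: prod_rep_def)
    from q(2)[rule_format, OF this] show ?case using k(1) by simp
  qed
  show ?thesis
    by (rule computableI[OF partial_recursive_iterate[OF p(1) q(1) h(1)]]) (use iter h(2) in fastforce)
qed

lemma computable_funpow:
  assumes "computable A B f" "computable A nat_rep n"
    and "computable (prod_rep A B) B (\<lambda>t. g (fst t) (snd t))"
  shows "computable A B (\<lambda>e. (g e ^^ n e) (f e))"
proof -
  have "(g e ^^ k) (f e) = rec_nat (f e) (\<lambda>_. g e) k" for e k
    by (induction k) simp_all
  moreover have "computable (prod_rep A (prod_rep nat_rep B)) B (\<lambda>t. g (fst t) (snd (snd t)))"
    using computable_compose[OF assms(3) computable_Pair[OF computable_fst[OF computable_id]
          computable_snd[OF computable_snd[OF computable_id]]]] by simp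
  ultimately show ?thesis
    using computable_rec_nat[OF assms(1,2), of "\<lambda>e _. g e"] by simp
qed

section \<open>Arithmetic and decisions on natural numbers\<close>

lemma computable_plus_nat:
  assumes "computable A nat_rep f" "computable A nat_rep g"
  shows "computable A nat_rep (\<lambda>e. f e + g e)"
proof -
  have "computable A nat_rep (\<lambda>e. rec_nat (f e) (\<lambda>_ b. Suc b) (g e))"
    by (rule computable_rec_nat computable_Suc computable_snd computable_id assms)+
  moreover have "rec_nat a (\<lambda>_ b. Suc b) n = a + n" for a n :: nat
    by (induction n) auto
  ultimately show ?thesis by simp
qed

lemma computable_pred:
  assumes "computable A nat_rep f"
  shows "computable A nat_rep (\<lambda>e. f e - 1)"
proof -
  have "computable A nat_rep (\<lambda>e. rec_nat 0 (\<lambda>k _. k) (f e))"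
    by (rule computable_rec_nat computable_nat computable_fst computable_snd computable_id assms)+
  moreover have "rec_nat 0 (\<lambda>k _. k) n = n - 1" for n :: nat
    by (cases n) auto
  ultimately show ?thesis by simp
qed

lemma computable_minus_nat:
  assumes "computable A nat_rep f" "computable A nat_rep g"
  shows "computable A nat_rep (\<lambda>e. f e - g e)"
proof -
  have "computable A nat_rep (\<lambda>e. rec_nat (f e) (\<lambda>_ b. b - 1) (g e))"
    by (rule computable_rec_nat computable_pred computable_snd computable_id assms)+
  moreover have "rec_nat a (\<lambda>_ b. b - 1) n = a - n" for a n :: nat
    by (induction n) auto
  ultimately show ?thesis by simp
qed

lemma computable_times_nat:
  assumes "computable A nat_rep f" "computable A nat_rep g"
  shows "computable A nat_rep (\<lambda>e. f e * g e)"
proof -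
  have "computable A nat_rep (\<lambda>e. rec_nat 0 (\<lambda>_ b. f e + b) (g e))"
    by (rule computable_rec_nat computable_plus_nat computable_nat computable_snd computable_id assms
        computable_compose[OF assms(1)] computable_fst)+
  moreover have "rec_nat 0 (\<lambda>_ b. a + b) n = a * n" for a n :: nat
    by (induction n) auto
  ultimately show ?thesis by simp
qed

text \<open>A conditional is a primitive recursion of length 0 or 1. The value \<open>g e\<close> is
  computed in either case, so both branches must be defined on every code;
  \<open>computable_inverse\<close> has to respect this.\<close>

lemma computable_If:
  assumes c: "computable A bool_rep c" and f: "computable A B f" and g: "computable A B g"
  shows "computable A B (\<lambda>e. if c e then f e else g e)"
proof -
  have "computable bool_rep nat_rep (\<lambda>b. of_bool b)"
    by (rule computableI[OF partial_recursive_id]) (simp add: bool_rep_def)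
  from computable_compose[OF this c] have "computable A nat_rep (\<lambda>e. of_bool (c e))" .
  then have "computable A B (\<lambda>e. rec_nat (g e) (\<lambda>_ _. f e) (of_bool (c e)))"
    by - (rule computable_rec_nat g computable_compose[OF f] computable_fst computable_id | assumption)+
  moreover have "rec_nat (g e) (\<lambda>_ _. f e) (of_bool (c e)) = (if c e then f e else g e)" for e
    by simp
  ultimately show ?thesis by simp
qed

lemma computable_eq_0:
  assumes "computable A nat_rep f"
  shows "computable A bool_rep (\<lambda>e. f e = 0)"
proof -
  have "computable nat_rep nat_rep (\<lambda>n. 1 - n)"
    by (rule computable_minus_nat computable_nat computable_id)+
  then have "computable nat_rep bool_rep (\<lambda>n. n = 0)"
    unfolding computable_def bool_rep_def by fastforce
  from computable_compose[OF this assms] show ?thesis .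
qed

lemma computable_not:
  assumes "computable A bool_rep f"
  shows "computable A bool_rep (\<lambda>e. \<not> f e)"
proof -
  have "computable A bool_rep (\<lambda>e. if f e then False else True)"
    by (rule computable_If assms computable_True computable_False)+
  moreover have "(if b then False else True) = (\<not> b)" for b by simp
  ultimately show ?thesis by simp
qed

lemma computable_conj:
  assumes "computable A bool_rep f" "computable A bool_rep g"
  shows "computable A bool_rep (\<lambda>e. f e \<and> g e)"
proof -
  have "computable A bool_rep (\<lambda>e. if f e then g e else False)"
    by (rule computable_If assms computable_False)+
  moreover have "(if a then b else False) = (a \<and> b)" for a b by simp
  ultimately show ?thesis by simp
qed

lemma computable_eq_nat:
  assumes "computable A nat_rep f" "computable A nat_rep g"
  shows "computable A bool_rep (\<lambda>e. f e = g e)"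
proof -
  have "computable A bool_rep (\<lambda>e. (f e - g e) + (g e - f e) = 0)"
    by (rule computable_eq_0 computable_plus_nat computable_minus_nat assms)+
  moreover have "((a - b) + (b - a) = 0) = (a = b)" for a b :: nat by auto
  ultimately show ?thesis by simp
qed

lemma computable_less:
  assumes "computable A nat_rep f" "computable A nat_rep g"
  shows "computable A bool_rep (\<lambda>e. f e < g e)"
proof -
  have "computable A bool_rep (\<lambda>e. \<not> (g e - f e = 0))"
    by (rule computable_eq_0 computable_not computable_minus_nat assms)+
  moreover have "(\<not> (b - a = 0)) = (a < b)" for a b :: nat by auto
  ultimately show ?thesis by simp
qed

lemma computable_mod:
  assumes "computable A nat_rep f" "d > 0"
  shows "computable A nat_rep (\<lambda>e. f e mod d)"
proof -
  have "computable A nat_rep (\<lambda>e. rec_nat 0 (\<lambda>_ b. if Suc b = d then 0 else Suc b) (f e))"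
    by (rule computable_rec_nat computable_If computable_eq_nat computable_Suc computable_nat
        computable_snd computable_id assms)+
  moreover have "rec_nat 0 (\<lambda>_ b. if Suc b = d then 0 else Suc b) n = n mod d" for n
    by (induction n) (simp_all add: mod_Suc)
  ultimately show ?thesis by simp
qed

lemma computable_div:
  assumes "computable A nat_rep f" "d > 0"
  shows "computable A nat_rep (\<lambda>e. f e div d)"
proof -
  have "computable A nat_rep (\<lambda>e. rec_nat 0 (\<lambda>k b. if Suc k mod d = 0 then Suc b else b) (f e))"
    by (rule computable_rec_nat computable_If computable_eq_0 computable_mod computable_Suc computable_nat
        computable_fst computable_snd computable_id assms)+
  moreover have "rec_nat 0 (\<lambda>k b. if Suc k mod d = 0 then Suc b else b) n = n div d" for n
    by (induction n) (simp_all add: div_Suc)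
  ultimately show ?thesis by simp
qed

section \<open>Coded lists and iteration over them\<close>

lemma list_decode_eq:
  "list_decode n = (if n = 0 then [] else
     fst (prod_decode (n - 1)) # list_decode (snd (prod_decode (n - 1))))"
  by (cases n) (simp_all split: prod.split)

lemma list_rep_encode: "list_rep A (list_encode cs) xs \<longleftrightarrow> list_all2 A cs xs"
  by (simp add: list_rep_def)

lemma prod_decode_0: "prod_decode 0 = (0, 0)"
proof -
  have "prod_encode (0, 0) = 0" by (simp add: prod_encode_def)
  then show ?thesis using prod_encode_inverse[of "(0, 0)"] by simp
qed

lemma computable_Cons:
  assumes "computable A B f" "computable A (list_rep B) g"
  shows "computable A (list_rep B) (\<lambda>e. f e # g e)"
proof -
  have *: "computable (prod_rep B (list_rep B)) (list_rep B) (\<lambda>t. fst t # snd t)"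
    by (rule computableI[OF partial_recursive.succ])
      (auto simp: prod_rep_def list_rep_def split: prod.split)
  show ?thesis
    using computable_compose[OF * computable_Pair[OF assms]] by simp
qed

lemma computable_null:
  assumes "computable A (list_rep B) f"
  shows "computable A bool_rep (\<lambda>e. f e = [])"
proof -
  obtain p where p: "partial_recursive p"
      "\<forall>n a. nat_rep n a \<longrightarrow> (\<exists>k. p n = Some k \<and> bool_rep k (a = 0))"
    using computable_eq_0[OF computable_id] by (rule computableE)
  have "computable (list_rep B) bool_rep (\<lambda>xs. xs = [])"
  proof (rule computableI[OF p(1)])
    fix n and xs :: "'b list"
    assume "list_rep B n xs"
    then have "(xs = []) = (n = 0)"
      by (auto simp: list_rep_def list_decode_eq[of n] split: if_splits)
    then show "\<exists>k. p n = Some k \<and> bool_rep k (xs = [])" using p(2) by auto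
  qed
  from computable_compose[OF this assms] show ?thesis .
qed

lemma computable_tl:
  assumes "computable A (list_rep B) f"
  shows "computable A (list_rep B) (\<lambda>e. tl (f e))"
proof -
  obtain p where p: "partial_recursive p" "\<forall>n a. nat_rep n a \<longrightarrow> (\<exists>k. p n = Some k \<and> k = a - 1)"
    using computable_pred[OF computable_id] by (rule computableE)
  have "computable (list_rep B) (list_rep B) tl"
  proof (rule computableI[OF partial_recursive.comp[OF partial_recursive.second p(1)]])
    fix n and xs :: "'b list"
    assume "list_rep B n xs"
    then have "list_rep B (snd (prod_decode (n - 1))) (tl xs)"
      by (cases n) (auto simp: list_rep_def list_all2_Cons1 prod_decode_0 split: prod.splits)
    then show "\<exists>k. Option.bind (p n) (\<lambda>n. Some (snd (prod_decode n))) = Some k \<and> list_rep B k (tl xs)"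
      using p(2) by auto
  qed
  from computable_compose[OF this assms] show ?thesis .
qed

text \<open>Access outside the list must still return a code of a definite value, so every lookup
  carries a default \<open>z\<close> with a known code \<open>k\<close>. It is used exactly at the
  code 0, which is the empty list.\<close>

lemma computable_hd:
  assumes f: "computable A (list_rep B) f" and z: "B k z"
  shows "computable A B (\<lambda>e. nth_default z (f e) 0)"
proof -
  obtain p where p: "partial_recursive p"
      "\<And>n. p n = Some (if n = 0 then k else fst (prod_decode (n - 1)))"
  proof -
    have pr: "computable nat_rep nat_rep (\<lambda>n. fst (prod_decode n))"
      by (rule computableI[OF partial_recursive.first]) simp
    have "computable nat_rep nat_rep (\<lambda>n. if n = 0 then k else fst (prod_decode (n - 1)))"
      by (rule computable_If computable_eq_0 computable_nat computable_id
          computable_compose[OF pr] computable_pred)+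
    then show ?thesis using that by (auto elim!: computableE)
  qed
  have "computable (list_rep B) B (\<lambda>xs. nth_default z xs 0)"
  proof (rule computableI[OF p(1)])
    fix n and xs :: "'b list"
    assume "list_rep B n xs"
    then show "\<exists>k. p n = Some k \<and> B k (nth_default z xs 0)"
      using z by (auto simp: p(2) list_rep_def list_decode_eq[of n] list_all2_Cons1)
  qed
  from computable_compose[OF this f] show ?thesis .
qed

lemma nth_default_funpow_tl: "nth_default z xs i = nth_default z ((tl ^^ i) xs) 0"
proof -
  have "(tl ^^ i) xs = drop i xs"
    by (induction i arbitrary: xs) (simp_all add: funpow_swap1 drop_Suc tl_drop)
  then show ?thesis by (simp add: nth_default_def)
qed

lemma computable_nth_default:
  assumes f: "computable A (list_rep B) f" and i: "computable A nat_rep i" and z: "B k z"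
  shows "computable A B (\<lambda>e. nth_default z (f e) (i e))"
proof -
  have "computable A B (\<lambda>e. nth_default z ((tl ^^ i e) (f e)) 0)"
    by (rule computable_hd computable_funpow f i computable_tl computable_snd computable_id z)+
  then show ?thesis by (simp flip: nth_default_funpow_tl)
qed

lemma length_le_list_encode: "length xs \<le> list_encode xs"
proof (induction xs)
  case (Cons x xs)
  then show ?case using le_prod_encode_2[of "list_encode xs" x] by simp
qed simp

text \<open>A fold needs to know how often to iterate, so the length has to be found without one.
  Heads are removed \<open>n\<close> times, where \<open>n\<close> is the code itself, which
  suffices by \<open>length_le_list_encode\<close>; every nonzero code met on the way counts one
  element.\<close>

lemma computable_list_code_length: "computable nat_rep nat_rep (\<lambda>n. length (list_decode n))"
proof -
  have tl: "computable nat_rep nat_rep (\<lambda>n. snd (prod_decode (n - 1)))"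
    by (rule computable_compose[of nat_rep nat_rep "\<lambda>n. snd (prod_decode n)",
          OF computableI[OF partial_recursive.second]], simp)
      (rule computable_pred computable_id)+
  have "computable nat_rep nat_rep (\<lambda>n. rec_nat 0 (\<lambda>t b.
      if ((\<lambda>n. snd (prod_decode (n - 1))) ^^ t) n = 0 then b else Suc b) n)"
    by (rule computable_rec_nat computable_If computable_eq_0 computable_Suc computable_nat
        computable_funpow computable_compose[OF tl] computable_fst computable_snd computable_id)+
  moreover have "rec_nat 0 (\<lambda>t b.
      if ((\<lambda>n. snd (prod_decode (n - 1))) ^^ t) n = 0 then b else Suc b) n = length (list_decode n)" for n
  proof -
    have drop: "list_decode (((\<lambda>n. snd (prod_decode (n - 1))) ^^ t) n) = drop t (list_decode n)" for t
    proof (induction t)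
      case (Suc t)
      let ?m = "((\<lambda>n. snd (prod_decode (n - 1))) ^^ t) n"
      have "list_decode (snd (prod_decode (?m - 1))) = tl (list_decode ?m)"
        by (cases ?m) (simp_all add: prod_decode_0 split: prod.split)
      then show ?case using Suc by (simp add: drop_Suc tl_drop)
    qed simp
    have zero: "m = 0 \<longleftrightarrow> list_decode m = []" for m
      by (subst list_decode_eq) simp
    have "rec_nat 0 (\<lambda>t b. if ((\<lambda>n. snd (prod_decode (n - 1))) ^^ t) n = 0 then b else Suc b) k
        = min k (length (list_decode n))" for k
      by (induction k) (auto simp: zero drop simp del: One_nat_def)
    moreover have "length (list_decode n) \<le> n"
      by (metis length_le_list_encode list_decode_inverse)
    ultimately show ?thesis by simp
  qed
  ultimately show ?thesis by simp
qed

text \<open>The recursion runs over positions. Its parameter is the code of the environment, so each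
  step computes the code of the list anew and extracts the entry at the current position. The number
  of steps is the length of the code, which is also the length of the list it represents.\<close>

lemma computable_fold:
  assumes xs: "computable A (list_rep B) xs" and s: "computable A S s"
    and f: "computable (prod_rep A (prod_rep B S)) S (\<lambda>t. f (fst t) (fst (snd t)) (snd (snd t)))"
  shows "computable A S (\<lambda>e. fold (f e) (xs e) (s e))"
proof -
  obtain p where p: "partial_recursive p" "\<forall>n a. A n a \<longrightarrow> (\<exists>k. p n = Some k \<and> list_rep B k (xs a))"
    using xs by (rule computableE)
  obtain q where q: "partial_recursive q" "\<forall>n a. A n a \<longrightarrow> (\<exists>k. q n = Some k \<and> S k (s a))"
    using s by (rule computableE)
  obtain g where g: "partial_recursive g"
    "\<forall>n a. prod_rep A (prod_rep B S) n a \<longrightarrow>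
       (\<exists>k. g n = Some k \<and> S k (f (fst a) (fst (snd a)) (snd (snd a))))"
    using f by (rule computableE)
  obtain h where h: "partial_recursive h"
    "\<forall>n a. nat_rep n a \<longrightarrow> (\<exists>k. h n = Some k \<and> k = length (list_decode a))"
    using computable_list_code_length by (rule computableE)
  have "computable nat_rep nat_rep (\<lambda>n. nth_default 0 (list_decode (fst (prod_decode n))) (snd (prod_decode n)))"
  proof -
    have "computable nat_rep (list_rep nat_rep) list_decode"
      by (rule computableI[OF partial_recursive_id]) (simp add: list_rep_def list_all2_eq[symmetric])
    moreover have "computable nat_rep (prod_rep nat_rep nat_rep) prod_decode"
      by (rule computableI[OF partial_recursive_id]) (simp add: prod_rep_def)
    ultimately have "computable nat_rep (list_rep nat_rep) (\<lambda>n. list_decode (fst (prod_decode n)))"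
        "computable nat_rep nat_rep (\<lambda>n. snd (prod_decode n))"
      using computable_compose computable_fst computable_snd by blast+
    then show ?thesis by (rule computable_nth_default) simp
  qed
  then obtain w where w: "partial_recursive w"
    "\<forall>n a. nat_rep n a \<longrightarrow>
       (\<exists>k. w n = Some k \<and> k = nth_default 0 (list_decode (fst (prod_decode a))) (snd (prod_decode a)))"
    by (rule computableE)
  have w': "w (prod_encode (c, t)) = Some (list_decode c ! t)" if "t < length (list_decode c)" for c t
    using w(2) that by (simp add: nth_default_def)
  define len where "len = (\<lambda>n. Option.bind (p n) h)"
  have len: "partial_recursive len"
    unfolding len_def by (rule partial_recursive.comp[OF h(1) p(1)])
  \<comment> \<open>On the code of \<open>(n, (t, k))\<close> this applies \<open>g\<close> to the
    code of \<open>(n, (y, k))\<close>, where \<open>y\<close> is entry \<open>t\<close> of the list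
    code computed from \<open>n\<close>.\<close>
  define step where "step = (\<lambda>z. Option.bind (Option.bind (Some (fst (prod_decode z))) (\<lambda>n.
      Option.bind (Option.bind
        (Option.bind (Option.bind (Some (fst (prod_decode z))) p) (\<lambda>c.
          Option.bind (Option.bind (Some (snd (prod_decode z))) (\<lambda>y. Some (fst (prod_decode y))))
            (\<lambda>t. Some (prod_encode (c, t))))) w) (\<lambda>x.
      Option.bind (Option.bind (Some (snd (prod_decode z))) (\<lambda>y. Some (snd (prod_decode y))))
        (\<lambda>k. Some (prod_encode (n, prod_encode (x, k))))))) g)"
  have "partial_recursive step"
  proof -
    note fst' = partial_recursive.first and snd' = partial_recursive.second
    have 1: "partial_recursive (\<lambda>z. Option.bind (Some (fst (prod_decode z))) p)"
      by (rule partial_recursive.comp[OF p(1) fst'])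
    have 2: "partial_recursive (\<lambda>z. Option.bind (Some (snd (prod_decode z))) (\<lambda>y. Some (fst (prod_decode y))))"
      by (rule partial_recursive.comp[OF fst' snd'])
    have 3: "partial_recursive (\<lambda>z. Option.bind (Some (snd (prod_decode z))) (\<lambda>y. Some (snd (prod_decode y))))"
      by (rule partial_recursive.comp[OF snd' snd'])
    have 4: "partial_recursive (\<lambda>z. Option.bind (Option.bind (Option.bind (Some (fst (prod_decode z))) p) (\<lambda>c.
          Option.bind (Option.bind (Some (snd (prod_decode z))) (\<lambda>y. Some (fst (prod_decode y))))
            (\<lambda>t. Some (prod_encode (c, t))))) w)"
      by (rule partial_recursive.comp[OF w(1) partial_recursive.pair[OF 1 2]])
    have 5: "partial_recursive (\<lambda>z. Option.bind (Some (fst (prod_decode z))) (\<lambda>n.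
      Option.bind (Option.bind
        (Option.bind (Option.bind (Some (fst (prod_decode z))) p) (\<lambda>c.
          Option.bind (Option.bind (Some (snd (prod_decode z))) (\<lambda>y. Some (fst (prod_decode y))))
            (\<lambda>t. Some (prod_encode (c, t))))) w) (\<lambda>x.
      Option.bind (Option.bind (Some (snd (prod_decode z))) (\<lambda>y. Some (snd (prod_decode y))))
        (\<lambda>k. Some (prod_encode (n, prod_encode (x, k)))))))"
      using partial_recursive.pair[OF fst' partial_recursive.pair[OF 4 3]]
      by (simp add: bind_assoc)
    show ?thesis
      unfolding step_def by (rule partial_recursive.comp[OF g(1) 5])
  qed
  show ?thesis
  proof (rule computableI[OF partial_recursive_iterate[OF q(1) \<open>partial_recursive step\<close> len]])
    fix n a
    assume A: "A n a"
    obtain c where c: "p n = Some c" "list_all2 B (list_decode c) (xs a)"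
      using p(2) A by (auto simp: list_rep_def)
    have l: "len n = Some (length (xs a))"
      using h(2) c by (auto simp: len_def list_all2_lengthD)
    have "\<exists>k. prim_rec q step n t = Some k \<and> S k (fold (f a) (take t (xs a)) (s a))"
      if "t \<le> length (xs a)" for t
      using that
    proof (induction t)
      case 0
      then show ?case using q(2) A by simp
    next
      case (Suc t)
      then obtain k where k: "prim_rec q step n t = Some k" "S k (fold (f a) (take t (xs a)) (s a))"
        by auto
      have t: "t < length (list_decode c)"
        using Suc c by (simp add: list_all2_lengthD)
      have B: "B (list_decode c ! t) (xs a ! t)"
        using c(2) t by (rule list_all2_nthD)
      have "step (prod_encode (n, prod_encode (t, k))) =
          g (prod_encode (n, prod_encode (list_decode c ! t, k)))"
        by (simp add: step_def c w' t)
      moreover have "prod_rep A (prod_rep B S) (prod_encode (n, prod_encode (list_decode c ! t, k)))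
          (a, xs a ! t, fold (f a) (take t (xs a)) (s a))"
        using A B k by (simp add: prod_rep_def)
      ultimately obtain k' where
        "step (prod_encode (n, prod_encode (t, k))) = Some k'"
        "S k' (f a (xs a ! t) (fold (f a) (take t (xs a)) (s a)))"
        using g(2) by fastforce
      then show ?case using k(1) Suc.prems by (simp add: take_Suc_conv_app_nth)
    qed
    from this[of "length (xs a)"] l
    show "\<exists>k. Option.bind (len n) (prim_rec q step n) = Some k \<and> S k (fold (f a) (xs a) (s a))"
      by simp
  qed
qed

lemma computable_rev:
  assumes "computable A (list_rep B) f"
  shows "computable A (list_rep B) (\<lambda>e. rev (f e))"
proof -
  have "computable A (list_rep B) (\<lambda>e. fold (\<lambda>x ys. x # ys) (f e) [])"
    by (rule computable_fold computable_Cons computable_Nil assms computable_fst computable_snd computable_id)+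
  moreover have "fold (\<lambda>x ys. x # ys) xs [] = rev xs" for xs :: "'b list"
    by (simp add: fold_Cons_rev[unfolded comp_def])
  ultimately show ?thesis by simp
qed

lemma computable_append:
  assumes "computable A (list_rep B) f" "computable A (list_rep B) g"
  shows "computable A (list_rep B) (\<lambda>e. f e @ g e)"
proof -
  have "computable A (list_rep B) (\<lambda>e. fold (\<lambda>x ys. x # ys) (rev (f e)) (g e))"
    by (rule computable_fold computable_Cons computable_rev assms computable_fst computable_snd computable_id)+
  moreover have "fold (\<lambda>x ys. x # ys) (rev xs) ys = xs @ ys" for xs ys :: "'b list"
    by (simp add: fold_Cons_rev[unfolded comp_def])
  ultimately show ?thesis by simp
qed

lemma computable_map:
  assumes xs: "computable A (list_rep B) xs"
    and f: "computable (prod_rep A B) C (\<lambda>t. f (fst t) (snd t))"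
  shows "computable A (list_rep C) (\<lambda>e. map (f e) (xs e))"
proof -
  have "computable (prod_rep A (prod_rep B (list_rep C))) C (\<lambda>t. f (fst t) (fst (snd t)))"
    using computable_compose[OF f computable_Pair[OF computable_fst[OF computable_id]
          computable_fst[OF computable_snd[OF computable_id]]]] by simp
  then have "computable A (list_rep C) (\<lambda>e. fold (\<lambda>x ys. f e x # ys) (rev (xs e)) [])"
    by - (rule computable_fold computable_Cons computable_rev computable_Nil xs
        computable_snd computable_id | assumption)+
  moreover have "fold (\<lambda>x ys. g x # ys) (rev xs) [] = map g xs" for g :: "'b \<Rightarrow> 'c" and xs
    by (induction xs) simp_all
  ultimately show ?thesis by simp
qed

lemma computable_filter:
  assumes xs: "computable A (list_rep B) xs"
    and f: "computable (prod_rep A B) bool_rep (\<lambda>t. f (fst t) (snd t))"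
  shows "computable A (list_rep B) (\<lambda>e. filter (f e) (xs e))"
proof -
  have "computable (prod_rep A (prod_rep B (list_rep B))) bool_rep (\<lambda>t. f (fst t) (fst (snd t)))"
    using computable_compose[OF f computable_Pair[OF computable_fst[OF computable_id]
          computable_fst[OF computable_snd[OF computable_id]]]] by simp
  then have "computable A (list_rep B)
      (\<lambda>e. fold (\<lambda>x ys. if f e x then x # ys else ys) (rev (xs e)) [])"
    by - (rule computable_fold computable_If computable_Cons computable_rev computable_Nil xs
        computable_fst computable_snd computable_id | assumption)+
  moreover have "fold (\<lambda>x ys. if g x then x # ys else ys) (rev xs) [] = filter g xs"
    for g :: "'b \<Rightarrow> bool" and xs
    by (induction xs) simp_all
  ultimately show ?thesis by simp
qed

lemma computable_concat:
  assumes "computable A (list_rep (list_rep B)) f"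
  shows "computable A (list_rep B) (\<lambda>e. concat (f e))"
proof -
  have "computable A (list_rep B) (\<lambda>e. fold (\<lambda>x ys. x @ ys) (rev (f e)) [])"
    by (rule computable_fold computable_append computable_rev computable_Nil assms
        computable_fst computable_snd computable_id)+
  moreover have "fold (\<lambda>x ys. x @ ys) (rev xs) [] = concat xs" for xs :: "'b list list"
    by (induction xs) simp_all
  ultimately show ?thesis by simp
qed

lemma computable_length:
  assumes "computable A (list_rep B) f"
  shows "computable A nat_rep (\<lambda>e. length (f e))"
proof -
  have "computable A nat_rep (\<lambda>e. fold (\<lambda>_ n. Suc n) (f e) 0)"
    by (rule computable_fold computable_Suc computable_nat assms computable_snd computable_id)+
  moreover have "fold (\<lambda>_ n. Suc n) xs k = k + length xs" for xs :: "'b list" and k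
    by (induction xs arbitrary: k) simp_all
  ultimately show ?thesis by simp
qed

lemma computable_upt:
  assumes "computable A nat_rep f"
  shows "computable A (list_rep nat_rep) (\<lambda>e. [0..<f e])"
proof -
  have "computable A (list_rep nat_rep) (\<lambda>e. rec_nat [] (\<lambda>k xs. xs @ [k]) (f e))"
    by (rule computable_rec_nat computable_append computable_Cons computable_Nil assms
        computable_fst computable_snd computable_id)+
  moreover have "rec_nat [] (\<lambda>k xs. xs @ [k]) n = [0..<n]" for n
    by (induction n) simp_all
  ultimately show ?thesis by simp
qed

text \<open>The length of the code is not a property of the function it represents. Dimensions are
  therefore passed as separate arguments, and definitions of vectors carry an explicit cut-off, to
  be matched by \<open>computable_fun\<close>.\<close>

definition fun_rep :: "'a \<Rightarrow> 'a rep \<Rightarrow> (nat \<Rightarrow> 'a) rep" where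
  "fun_rep z B n v \<longleftrightarrow> (\<exists>xs. list_rep B n xs \<and> v = nth_default z xs)"

lemma computable_apply:
  assumes f: "computable A (fun_rep z B) f" and i: "computable A nat_rep i" and z: "B k z"
  shows "computable A B (\<lambda>e. f e (i e))"
proof -
  obtain p where p: "partial_recursive p"
    "\<forall>n a. prod_rep (list_rep B) nat_rep n a \<longrightarrow>
       (\<exists>k. p n = Some k \<and> B k (nth_default z (fst a) (snd a)))"
    using computable_nth_default[where B = B, OF computable_fst[OF computable_id]
        computable_snd[OF computable_id] z] by (rule computableE)
  have "computable (prod_rep (fun_rep z B) nat_rep) B (\<lambda>t. fst t (snd t))"
    by (rule computableI[OF p(1)]) (use p(2) in \<open>fastforce simp: prod_rep_def fun_rep_def\<close>)
  from computable_compose[OF this computable_Pair[OF f i]] show ?thesis by simp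
qed

lemma computable_nth_default_fun:
  assumes "computable A (list_rep B) f"
  shows "computable A (fun_rep z B) (\<lambda>e. nth_default z (f e))"
proof (rule computable_compose[OF _ assms])
  show "computable (list_rep B) (fun_rep z B) (nth_default z)"
    by (rule computableI[OF partial_recursive_id]) (auto simp: fun_rep_def)
qed

lemma computable_fun:
  assumes d: "computable A nat_rep d"
    and f: "computable (prod_rep A nat_rep) B (\<lambda>t. f (fst t) (snd t))"
  shows "computable A (fun_rep z B) (\<lambda>e i. if i < d e then f e i else z)"
proof -
  have "computable A (fun_rep z B) (\<lambda>e. nth_default z (map (f e) [0..<d e]))"
    by (rule computable_nth_default_fun computable_map computable_upt d f)+
  moreover have "nth_default z (map (f e) [0..<d e]) = (\<lambda>i. if i < d e then f e i else z)" for e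
    by (auto simp: nth_default_def fun_eq_iff)
  ultimately show ?thesis by simp
qed

section \<open>Linear algebra over a noncommutative ring\<close>

text \<open>Lists instead of sets, since rows are rewritten one by one and might coincide; a
  repeated member counts as a dependence (\<open>lindep_distinct\<close>).\<close>

fun lspan :: "('a::ring_1 \<Rightarrow> 'b::ab_group_add \<Rightarrow> 'b) \<Rightarrow> 'b list \<Rightarrow> 'b set" where
  "lspan s [] = {0}"
| "lspan s (x # xs) = {s a x + y | a y. y \<in> lspan s xs}"

fun lindep :: "('a::ring_1 \<Rightarrow> 'b::ab_group_add \<Rightarrow> 'b) \<Rightarrow> 'b list \<Rightarrow> bool" where
  "lindep s [] \<longleftrightarrow> True"
| "lindep s (x # xs) \<longleftrightarrow> lindep s xs \<and> (\<forall>a. s a x \<in> lspan s xs \<longrightarrow> a = 0)"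

definition submod :: "('a::ring_1 \<Rightarrow> 'b::ab_group_add \<Rightarrow> 'b) \<Rightarrow> 'b set \<Rightarrow> bool" where
  "submod s U \<longleftrightarrow> 0 \<in> U \<and> (\<forall>x\<in>U. \<forall>y\<in>U. x + y \<in> U) \<and> (\<forall>a. \<forall>x\<in>U. s a x \<in> U)"

locale lmodule =
  fixes s :: "'a::ring_1 \<Rightarrow> 'b::ab_group_add \<Rightarrow> 'b"
  assumes s_add_right: "s a (x + y) = s a x + s a y"
    and s_add_left: "s (a + b) x = s a x + s b x"
    and s_assoc: "s a (s b x) = s (a * b) x"
    and s_one [simp]: "s 1 x = x"
begin

lemma s_zero_left [simp]: "s 0 x = 0"
  using s_add_left[of 0 0 x] by simp

lemma s_zero_right [simp]: "s a 0 = 0"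
  using s_add_right[of a 0 0] by simp

lemma s_minus_left: "s (- a) x = - s a x"
  using s_add_left[of a "- a" x] by (simp add: eq_neg_iff_add_eq_0 add.commute)

lemma s_minus_right: "s a (- x) = - s a x"
  using s_add_right[of a x "- x"] by (simp add: eq_neg_iff_add_eq_0 add.commute)

lemma s_diff_right: "s a (x - y) = s a x - s a y"
  using s_add_right[of a x "- y"] by (simp add: s_minus_right)

lemma s_sum_right: "s a (sum f T) = (\<Sum>i\<in>T. s a (f i))"
  by (induction T rule: infinite_finite_induct) (simp_all add: s_add_right)

lemma lspan_ConsI: "v = s a x + y \<Longrightarrow> y \<in> lspan s xs \<Longrightarrow> v \<in> lspan s (x # xs)"
  by auto

lemma submod_neg: "submod s U \<Longrightarrow> x \<in> U \<Longrightarrow> - x \<in> U"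
  unfolding submod_def by (metis s_minus_left s_one)

lemma submod_add: "submod s U \<Longrightarrow> x \<in> U \<Longrightarrow> y \<in> U \<Longrightarrow> x + y \<in> U"
  by (auto simp: submod_def)

lemma submod_scale: "submod s U \<Longrightarrow> x \<in> U \<Longrightarrow> s a x \<in> U"
  by (auto simp: submod_def)

lemma submod_zero: "submod s U \<Longrightarrow> 0 \<in> U"
  by (auto simp: submod_def)

lemma submod_diff: "submod s U \<Longrightarrow> x \<in> U \<Longrightarrow> y \<in> U \<Longrightarrow> x - y \<in> U"
  using submod_add submod_neg by fastforce

lemma submod_sum: "submod s U \<Longrightarrow> (\<And>i. i \<in> T \<Longrightarrow> f i \<in> U) \<Longrightarrow> sum f T \<in> U"
  by (induction T rule: infinite_finite_induct) (auto simp: submod_zero submod_add)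

lemma submod_lspan: "submod s (lspan s xs)"
proof (induction xs)
  case Nil
  show ?case by (simp add: submod_def)
next
  case (Cons x xs)
  have "s a x + y + (s b x + z) \<in> lspan s (x # xs)" if "y \<in> lspan s xs" "z \<in> lspan s xs" for a b y z
  proof -
    have "s a x + y + (s b x + z) = s (a + b) x + (y + z)" by (simp add: s_add_left)
    then show ?thesis using submod_add[OF Cons that] by (rule lspan_ConsI)
  qed
  moreover have "s c (s a x + y) \<in> lspan s (x # xs)" if "y \<in> lspan s xs" for a c y
  proof -
    have "s c (s a x + y) = s (c * a) x + s c y" by (simp add: s_add_right s_assoc)
    then show ?thesis using submod_scale[OF Cons that] by (rule lspan_ConsI)
  qed
  moreover have "0 = s 0 x + 0" by simp
  ultimately show ?case using submod_zero[OF Cons] unfolding submod_def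
    by (simp only: lspan.simps) blast
qed

lemma lspan_Cons_subset: "lspan s xs \<subseteq> lspan s (x # xs)"
proof
  fix y
  assume "y \<in> lspan s xs"
  moreover have "y = s 0 x + y" by simp
  ultimately show "y \<in> lspan s (x # xs)" unfolding lspan.simps by blast
qed

lemma lspan_superset: "x \<in> set xs \<Longrightarrow> x \<in> lspan s xs"
proof (induction xs)
  case (Cons y ys)
  have "y = s 1 y + 0" by simp
  then have "y \<in> lspan s (y # ys)" using submod_zero[OF submod_lspan] unfolding lspan.simps by blast
  then show ?case using Cons lspan_Cons_subset by (metis set_ConsD subsetD)
qed simp

lemma lspan_least: "submod s U \<Longrightarrow> set xs \<subseteq> U \<Longrightarrow> lspan s xs \<subseteq> U"
  by (induction xs) (auto simp: submod_zero submod_add submod_scale)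

lemma lspan_subset_iff: "lspan s xs \<subseteq> lspan s ys \<longleftrightarrow> set xs \<subseteq> lspan s ys"
  using lspan_least[OF submod_lspan] lspan_superset by blast

lemma lspan_cong_set: "set xs = set ys \<Longrightarrow> lspan s xs = lspan s ys"
  by (metis equalityI lspan_subset_iff lspan_superset subsetI)

lemma lspan_append: "lspan s (xs @ ys) = {x + y | x y. x \<in> lspan s xs \<and> y \<in> lspan s ys}"
proof (induction xs)
  case (Cons x xs)
  show ?case
  proof (intro equalityI subsetI)
    fix v
    assume "v \<in> lspan s ((x # xs) @ ys)"
    then obtain a y z where "v = s a x + (y + z)" "y \<in> lspan s xs" "z \<in> lspan s ys"
      using Cons by auto
    then have "v = (s a x + y) + z" "s a x + y \<in> lspan s (x # xs)" "z \<in> lspan s ys"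
      by (auto simp: add.assoc)
    then show "v \<in> {u + w | u w. u \<in> lspan s (x # xs) \<and> w \<in> lspan s ys}" by blast
  next
    fix v
    assume "v \<in> {u + w | u w. u \<in> lspan s (x # xs) \<and> w \<in> lspan s ys}"
    then obtain a y z where "v = s a x + (y + z)" "y \<in> lspan s xs" "z \<in> lspan s ys"
      by (auto simp: add.assoc)
    then show "v \<in> lspan s ((x # xs) @ ys)" using Cons by auto
  qed
qed simp

lemma lindep_swap:
  assumes "lindep s (x # y # zs)"
  shows "lindep s (y # x # zs)"
proof -
  have z: "lindep s zs" and y: "\<And>b. s b y \<in> lspan s zs \<Longrightarrow> b = 0"
    and x: "\<And>a. s a x \<in> lspan s (y # zs) \<Longrightarrow> a = 0"
    using assms by auto
  have "b = 0" if b: "s b y \<in> lspan s (x # zs)" for b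
  proof -
    obtain a z where az: "s b y = s a x + z" "z \<in> lspan s zs" using b by auto
    have "s a x = s b y + - z" using az(1) by simp
    then have "s a x \<in> lspan s (y # zs)" using submod_neg[OF submod_lspan az(2)] by (rule lspan_ConsI)
    then have "a = 0" by (rule x)
    then show ?thesis using az y by simp
  qed
  moreover have "a = 0" if "s a x \<in> lspan s zs" for a
    using x that lspan_Cons_subset by blast
  ultimately show ?thesis using z by simp
qed

lemma lindep_move: "lindep s (xs @ x # ys) \<longleftrightarrow> lindep s (x # xs @ ys)"
proof (induction xs)
  case (Cons z xs)
  have "lspan s (xs @ x # ys) = lspan s (x # xs @ ys)"
    by (rule lspan_cong_set) auto
  then have "lindep s ((z # xs) @ x # ys) \<longleftrightarrow> lindep s (z # x # xs @ ys)"
    using Cons by simp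
  then show ?case using lindep_swap[of z x "xs @ ys"] lindep_swap[of x z "xs @ ys"]
    by (metis append_Cons)
qed simp

lemma lindep_cong_mset: "mset xs = mset ys \<Longrightarrow> lindep s xs \<longleftrightarrow> lindep s ys"
proof (induction xs arbitrary: ys)
  case (Cons x xs)
  then have "x \<in> set ys" by (metis list.set_intros(1) mset_eq_setD)
  then obtain as bs where ys: "ys = as @ x # bs" by (meson split_list)
  then have m: "mset xs = mset (as @ bs)" using Cons.prems by simp
  have "lspan s xs = lspan s (as @ bs)"
    by (rule lspan_cong_set) (metis m mset_eq_setD)
  then show ?case using Cons.IH[OF m] by (simp add: ys lindep_move)
qed simp

lemma lindep_appendD2: "lindep s (xs @ ys) \<Longrightarrow> lindep s ys"
  by (induction xs) auto

lemma lindep_appendD1: "lindep s (xs @ ys) \<Longrightarrow> lindep s xs"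
  using lindep_cong_mset[of "xs @ ys" "ys @ xs"] lindep_appendD2 by (metis mset_append union_commute)

text \<open>Adding elements of the span of \<open>xs\<close> to the other members is undone by
  subtracting them. Every elimination or clearing step of the reduction has this form, with the
  pivot row in \<open>xs\<close>.\<close>

lemma lspan_append_shear:
  assumes "list_all2 (\<lambda>y z. z - y \<in> lspan s xs) ys zs"
  shows "lspan s (zs @ xs) = lspan s (ys @ xs)"
  using assms
proof (induction ys zs rule: list_all2_induct)
  case (Cons y ys z zs)
  have xs: "lspan s xs \<subseteq> lspan s (ys @ xs)" "lspan s xs \<subseteq> lspan s (zs @ xs)"
    by (auto simp: lspan_subset_iff intro: lspan_superset)
  have "y \<in> lspan s (z # zs @ xs)"
  proof -
    have "y = s 1 z + - (z - y)" by simp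
    then show ?thesis using xs(2) Cons(1) submod_neg[OF submod_lspan] unfolding lspan.simps by blast
  qed
  moreover have "z \<in> lspan s (y # ys @ xs)"
  proof -
    have "z = s 1 y + (z - y)" by simp
    then show ?thesis using xs(1) Cons(1) unfolding lspan.simps by blast
  qed
  moreover have "set (ys @ xs) \<subseteq> lspan s (z # zs @ xs)" "set (zs @ xs) \<subseteq> lspan s (y # ys @ xs)"
    using Cons(3) lspan_superset lspan_Cons_subset[of "ys @ xs" y] lspan_Cons_subset[of "zs @ xs" z]
    by blast+
  ultimately have "set (y # ys @ xs) \<subseteq> lspan s (z # zs @ xs)" "set (z # zs @ xs) \<subseteq> lspan s (y # ys @ xs)"
    by (simp_all del: lspan.simps)
  then show ?case unfolding append_Cons by (simp only: lspan_subset_iff[symmetric] equalityI)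
qed simp

lemma lindep_append_shear:
  assumes "list_all2 (\<lambda>y z. z - y \<in> lspan s xs) ys zs" "lindep s (ys @ xs)"
  shows "lindep s (zs @ xs)"
  using assms
proof (induction ys zs rule: list_all2_induct)
  case (Cons y ys z zs)
  have sp: "lspan s (zs @ xs) = lspan s (ys @ xs)" by (rule lspan_append_shear) fact
  have zy: "z - y \<in> lspan s (ys @ xs)"
    using Cons(1) lspan_subset_iff[of xs "ys @ xs"] lspan_superset[of _ "ys @ xs"] by auto
  have "a = 0" if "s a z \<in> lspan s (zs @ xs)" for a
  proof -
    have "s a y = s a z - s a (z - y)" by (simp add: s_diff_right)
    then have "s a y \<in> lspan s (ys @ xs)"
      using that zy submod_diff[OF submod_lspan] submod_scale[OF submod_lspan] by (simp add: sp)
    then show ?thesis using Cons.prems by simp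
  qed
  then show ?case using Cons by simp
qed simp

lemma lspan_iff_sum: "y \<in> lspan s xs \<longleftrightarrow> (\<exists>a. y = (\<Sum>i<length xs. s (a i) (xs ! i)))"
proof (induction xs arbitrary: y)
  case (Cons x xs)
  show ?case
  proof
    assume "y \<in> lspan s (x # xs)"
    then obtain c z a where "y = s c x + z" "z = (\<Sum>i<length xs. s (a i) (xs ! i))"
      using Cons by auto
    then have "y = (\<Sum>i<length (x # xs). s (case_nat c a i) ((x # xs) ! i))"
      by (simp add: sum.lessThan_Suc_shift del: sum.lessThan_Suc)
    then show "\<exists>a. y = (\<Sum>i<length (x # xs). s (a i) ((x # xs) ! i))" by blast
  next
    assume "\<exists>a. y = (\<Sum>i<length (x # xs). s (a i) ((x # xs) ! i))"
    then obtain a where "y = s (a 0) x + (\<Sum>i<length xs. s (a (Suc i)) (xs ! i))"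
      by (auto simp: sum.lessThan_Suc_shift simp del: sum.lessThan_Suc)
    moreover have "(\<Sum>i<length xs. s (a (Suc i)) (xs ! i)) \<in> lspan s xs"
      using Cons[of "\<Sum>i<length xs. s (a (Suc i)) (xs ! i)"]
      by (auto intro!: exI[of _ "\<lambda>i. a (Suc i)"])
    ultimately show "y \<in> lspan s (x # xs)" by (rule lspan_ConsI)
  qed
qed simp

lemma lindep_iff_sum:
  "lindep s xs \<longleftrightarrow>
     (\<forall>a. (\<Sum>i<length xs. s (a i) (xs ! i)) = 0 \<longrightarrow> (\<forall>i<length xs. a i = 0))"
proof (induction xs)
  case (Cons x xs)
  show ?case
  proof
    assume L: "lindep s (x # xs)"
    show "\<forall>a. (\<Sum>i<length (x # xs). s (a i) ((x # xs) ! i)) = 0 \<longrightarrow> (\<forall>i<length (x # xs). a i = 0)"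
    proof (intro allI impI)
      fix a i
      assume "(\<Sum>i<length (x # xs). s (a i) ((x # xs) ! i)) = 0" and i: "i < length (x # xs)"
      then have e: "s (a 0) x + (\<Sum>i<length xs. s (a (Suc i)) (xs ! i)) = 0"
        by (simp add: sum.lessThan_Suc_shift del: sum.lessThan_Suc)
      then have "s (a 0) x = - (\<Sum>i<length xs. s (a (Suc i)) (xs ! i))"
        by (simp add: eq_neg_iff_add_eq_0)
      then have "s (a 0) x \<in> lspan s xs"
        using submod_neg[OF submod_lspan] lspan_iff_sum by metis
      then have "a 0 = 0" using L by simp
      moreover from this have "\<forall>i<length xs. a (Suc i) = 0"
        using L e Cons[THEN iffD1, rule_format, of "\<lambda>i. a (Suc i)"] by simp
      ultimately show "a i = 0" using i by (cases i) auto
    qed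
  next
    assume R: "\<forall>a. (\<Sum>i<length (x # xs). s (a i) ((x # xs) ! i)) = 0 \<longrightarrow> (\<forall>i<length (x # xs). a i = 0)"
    have zero: "c = 0 \<and> (\<forall>i<length xs. a i = 0)"
      if "s c x + (\<Sum>i<length xs. s (a i) (xs ! i)) = 0" for c a
    proof -
      have "(\<Sum>i<length (x # xs). s (case_nat c a i) ((x # xs) ! i)) = 0"
        using that by (simp add: sum.lessThan_Suc_shift del: sum.lessThan_Suc)
      then have *: "\<forall>i<length (x # xs). case_nat c a i = 0" using R by blast
      show ?thesis using *[rule_format, of 0] *[rule_format, of "Suc _"] by auto
    qed
    have "lindep s xs" unfolding Cons using zero[of 0] by simp
    moreover have "c = 0" if "s c x \<in> lspan s xs" for c
    proof -
      have "- s c x \<in> lspan s xs" using that submod_neg[OF submod_lspan] by blast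
      then obtain a where "- s c x = (\<Sum>i<length xs. s (a i) (xs ! i))"
        unfolding lspan_iff_sum by blast
      then have "s c x + (\<Sum>i<length xs. s (a i) (xs ! i)) = 0"
        by (metis add.right_inverse)
      then show ?thesis using zero by blast
    qed
    ultimately show "lindep s (x # xs)" by simp
  qed
qed simp

section \<open>From lists of generators to the set-based notions\<close>

lemma submod_mod_span: "submod s (mod_span s B)"
proof -
  have "0 \<in> mod_span s B"
    unfolding mod_span_def by (rule CollectI, rule exI[of _ "{}"]) auto
  moreover have "x + y \<in> mod_span s B" if xy: "x \<in> mod_span s B" "y \<in> mod_span s B" for x y
  proof -
    obtain T c where T: "x = (\<Sum>b\<in>T. s (c b) b)" "finite T" "T \<subseteq> B"
      using xy(1) by (auto simp: mod_span_def)
    obtain T' c' where T': "y = (\<Sum>b\<in>T'. s (c' b) b)" "finite T'" "T' \<subseteq> B"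
      using xy(2) by (auto simp: mod_span_def)
    have "x = (\<Sum>b\<in>T \<union> T'. s (if b \<in> T then c b else 0) b)"
      unfolding T(1) by (rule sum.mono_neutral_cong_left) (use T T' in auto)
    moreover have "y = (\<Sum>b\<in>T \<union> T'. s (if b \<in> T' then c' b else 0) b)"
      unfolding T'(1) by (rule sum.mono_neutral_cong_left) (use T T' in auto)
    ultimately have "x + y = (\<Sum>b\<in>T \<union> T'. s ((if b \<in> T then c b else 0) + (if b \<in> T' then c' b else 0)) b)"
      by (simp add: s_add_left sum.distrib)
    moreover have "finite (T \<union> T')" "T \<union> T' \<subseteq> B" using T T' by auto
    ultimately show ?thesis unfolding mod_span_def
      by (intro CollectI exI[of _ "T \<union> T'"] exI conjI)
  qed
  moreover have "s a x \<in> mod_span s B" if x: "x \<in> mod_span s B" for a x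
  proof -
    obtain T c where T: "x = (\<Sum>b\<in>T. s (c b) b)" "finite T" "T \<subseteq> B"
      using x by (auto simp: mod_span_def)
    then have "s a x = (\<Sum>b\<in>T. s (a * c b) b)" by (simp add: s_sum_right s_assoc)
    then show ?thesis using T(2,3) unfolding mod_span_def
      by (intro CollectI exI[of _ T] exI[of _ "\<lambda>b. a * c b"] conjI)
  qed
  ultimately show ?thesis by (auto simp: submod_def)
qed

lemma mod_span_superset: "B \<subseteq> mod_span s B"
proof
  fix b
  assume "b \<in> B"
  then show "b \<in> mod_span s B"
    unfolding mod_span_def by (intro CollectI exI[of _ "{b}"] exI[of _ "\<lambda>_. 1"]) simp
qed

lemma mod_span_least: "submod s U \<Longrightarrow> B \<subseteq> U \<Longrightarrow> mod_span s B \<subseteq> U"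
  by (auto simp: mod_span_def intro!: submod_sum submod_scale)

lemma mod_span_set: "mod_span s (set xs) = lspan s xs"
  by (intro equalityI mod_span_least lspan_least submod_lspan submod_mod_span mod_span_superset)
    (auto intro: lspan_superset)

lemma lindep_distinct: "lindep s xs \<Longrightarrow> distinct xs"
proof (induction xs)
  case (Cons x xs)
  have "x \<notin> set xs"
  proof
    assume "x \<in> set xs"
    then have "s 1 x \<in> lspan s xs" using lspan_superset by simp
    then show False using Cons.prems by (metis lindep.simps(2) zero_neq_one)
  qed
  then show ?case using Cons by simp
qed simp

text \<open>Coefficients attached to elements become coefficients attached to positions; this is
  unambiguous because an independent list has no repetitions.\<close>

lemma lindep_mod_independent:
  assumes "lindep s xs"
  shows "mod_independent s (set xs)"
  unfolding mod_independent_def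
proof (intro allI impI)
  fix T c
  assume T: "finite T \<and> T \<subseteq> set xs \<and> (\<Sum>b\<in>T. s (c b) b) = 0"
  define a where "a = (\<lambda>i. if xs ! i \<in> T then c (xs ! i) else 0)"
  have "(\<Sum>i<length xs. s (a i) (xs ! i)) = (\<Sum>b\<in>set xs. s (if b \<in> T then c b else 0) b)"
    using sum.reindex_bij_betw[OF bij_betw_nth[OF lindep_distinct[OF assms] refl refl],
        of "\<lambda>b. s (if b \<in> T then c b else 0) b"] by (simp add: a_def)
  also have "\<dots> = (\<Sum>b\<in>T. s (c b) b)"
    by (rule sum.mono_neutral_cong_right) (use T in auto)
  finally have "\<forall>i<length xs. a i = 0" using assms T unfolding lindep_iff_sum by simp
  then show "\<forall>b\<in>T. c b = 0"
    using T unfolding a_def by (metis in_set_conv_nth subsetD)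
qed

lemma lindep_mod_basis: "lindep s xs \<Longrightarrow> mod_basis s (set xs) (lspan s xs)"
  by (simp add: mod_basis_def lindep_mod_independent mod_span_set)

end

section \<open>Linear maps and augmented vectors\<close>

locale linear_map = M: lmodule s + N: lmodule t
  for s :: "'a::ring_1 \<Rightarrow> 'b::ab_group_add \<Rightarrow> 'b" and t :: "'a \<Rightarrow> 'c::ab_group_add \<Rightarrow> 'c" +
  fixes f :: "'b \<Rightarrow> 'c"
  assumes f_add: "f (x + y) = f x + f y"
    and f_scale: "f (s a x) = t a (f x)"
begin

lemma f_zero [simp]: "f 0 = 0"
  using f_add[of 0 0] by simp

lemma f_diff: "f (x - y) = f x - f y"
  using f_add[of "x - y" y] by simp

lemma f_sum: "f (sum g T) = (\<Sum>i\<in>T. f (g i))"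
  by (induction T rule: infinite_finite_induct) (simp_all add: f_add)

lemma lspan_map: "lspan t (map f xs) = f ` lspan s xs"
proof (induction xs)
  case (Cons x xs)
  show ?case
  proof (intro equalityI subsetI)
    fix z
    assume "z \<in> lspan t (map f (x # xs))"
    then obtain a y where "z = t a (f x) + f y" "y \<in> lspan s xs" using Cons by auto
    then have "z = f (s a x + y)" "s a x + y \<in> lspan s (x # xs)" by (auto simp: f_add f_scale)
    then show "z \<in> f ` lspan s (x # xs)" by blast
  next
    fix z
    assume "z \<in> f ` lspan s (x # xs)"
    then obtain a y where "z = t a (f x) + f y" "y \<in> lspan s xs" by (auto simp: f_add f_scale)
    then show "z \<in> lspan t (map f (x # xs))" using Cons by auto
  qed
qed simp

lemma lindep_mapD: "lindep t (map f xs) \<Longrightarrow> lindep s xs"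
proof (induction xs)
  case (Cons x xs)
  have "a = 0" if "s a x \<in> lspan s xs" for a
    using that Cons.prems lspan_map by (metis f_scale image_eqI lindep.simps(2) list.simps(9))
  then show ?case using Cons by simp
qed simp

lemma lindep_mapI:
  assumes "lindep s xs" "\<And>x. x \<in> lspan s xs \<Longrightarrow> f x = 0 \<Longrightarrow> x = 0"
  shows "lindep t (map f xs)"
  using assms
proof (induction xs)
  case (Cons x xs)
  have "a = 0" if "t a (f x) \<in> lspan t (map f xs)" for a
  proof -
    obtain y where y: "y \<in> lspan s xs" "f (s a x) = f y"
      using \<open>t a (f x) \<in> _\<close> by (auto simp: lspan_map f_scale)
    have "f (s a x - y) = 0" using y by (simp add: f_diff)
    moreover have "s a x - y \<in> lspan s (x # xs)"
      using M.submod_neg[OF M.submod_lspan y(1)] by auto (metis add_uminus_conv_diff)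
    ultimately have "s a x = y" using Cons.prems(2) by fastforce
    then show ?thesis using y Cons.prems(1) by simp
  qed
  moreover have "lindep t (map f xs)"
    using Cons M.lspan_Cons_subset by (metis lindep.simps(2) subsetD)
  ultimately show ?case by simp
qed simp

end

type_synonym ('f, 'k) vec = "nat \<Rightarrow> 'f \<Rightarrow>\<^sub>0 'k"

abbreviation lscale :: "'a::ring_1 \<Rightarrow> (nat \<Rightarrow> 'a) \<Rightarrow> nat \<Rightarrow> 'a" where
  "lscale \<equiv> scale Left_Module"

abbreviation "vspan \<equiv> lspan lscale"

abbreviation "vindep \<equiv> lindep lscale"

abbreviation "mod_vspan \<equiv> mod_span lscale"

abbreviation "mod_vindep \<equiv> mod_independent lscale"

lemmas [simp del] = scale.simps

lemma scale_Left_apply [simp]: "lscale a v i = a * v i"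
  by (simp add: scale.simps)

lemma lmodule_scale_Left: "lmodule (lscale)"
  by unfold_locales (auto simp: fun_eq_iff algebra_simps)

text \<open>Augmented rows: the first component records which combination of the original rows has
  produced the second one. A relation is read off from a row whose second component is zero.\<close>

definition pair_scale :: "'a::ring_1 \<Rightarrow> (nat \<Rightarrow> 'a) \<times> (nat \<Rightarrow> 'a) \<Rightarrow> (nat \<Rightarrow> 'a) \<times> (nat \<Rightarrow> 'a)" where
  "pair_scale a z = (lscale a (fst z), lscale a (snd z))"

lemma lmodule_pair_scale: "lmodule pair_scale"
  by unfold_locales (auto simp: pair_scale_def prod_eq_iff fun_eq_iff algebra_simps)

interpretation L: lmodule "lscale"
  by (rule lmodule_scale_Left)

interpretation P: lmodule pair_scale
  by (rule lmodule_pair_scale)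

interpretation fst_map: linear_map pair_scale "lscale" fst
  by unfold_locales (auto simp: pair_scale_def)

interpretation snd_map: linear_map pair_scale "lscale" snd
  by unfold_locales (auto simp: pair_scale_def)

section \<open>Linear pencils over the free group algebra\<close>

lemma sum_fun_apply: "(\<Sum>i\<in>T. f i) c = (\<Sum>i\<in>T. f i c)"
  for f :: "'i \<Rightarrow> 'b \<Rightarrow> 'c::comm_monoid_add"
  by (induction T rule: infinite_finite_induct) simp_all

lemma poly_mapping_single_induct [case_names single add]:
  fixes a :: "'f \<Rightarrow>\<^sub>0 'k::comm_monoid_add"
  assumes single: "\<And>k v. P (Poly_Mapping.single k v)"
    and add: "\<And>a b. P a \<Longrightarrow> P b \<Longrightarrow> P (a + b)"
  shows "P a"
proof -
  have "a = (\<Sum>k\<in>Poly_Mapping.keys a. Poly_Mapping.single k (Poly_Mapping.lookup a k))"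
    by (rule poly_mapping_eqI) (simp add: lookup_sum lookup_single when_def in_keys_iff)
  moreover have "P (\<Sum>k\<in>T. Poly_Mapping.single k (Poly_Mapping.lookup a k))" for T
  proof (induction T rule: infinite_finite_induct)
    case (insert k T)
    then show ?case by (simp add: add single)
  qed (use single[of _ 0] in simp_all)
  ultimately show ?thesis by metis
qed

lemma lookup_times_single:
  fixes a :: "'f::group_add \<Rightarrow>\<^sub>0 'k::field"
  shows "Poly_Mapping.lookup (a * Poly_Mapping.single h c) g = Poly_Mapping.lookup a (g - h) * c"
proof (induction a rule: poly_mapping_single_induct)
  case (single k v)
  have "k + h = g \<longleftrightarrow> k = g - h" by (auto simp: eq_diff_eq)
  then show ?case by (simp add: mult_single lookup_single when_def)
next
  case (add a b)
  then show ?case by (simp add: distrib_right lookup_add)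
qed

section \<open>Reduced words, the Cayley tree and linear pencils\<close>

locale free_group =
  fixes r :: nat and x :: "nat \<Rightarrow> 'f::group_add"
  assumes r: "r \<ge> 1" and basis: "free_group_basis r x"
begin

definition red :: "'f \<Rightarrow> (nat \<times> bool) list" where
  "red = inv_into {w \<in> words r. reduced w} (word_val x)"

abbreviation len :: "'f \<Rightarrow> nat" where
  "len g \<equiv> length (red g)"

lemma red: "red g \<in> words r" "reduced (red g)" "word_val x (red g) = g"
proof -
  have "word_val x ` {w \<in> words r. reduced w} = UNIV"
    using basis by (simp add: free_group_basis_def bij_betw_def)
  then have g: "g \<in> word_val x ` {w \<in> words r. reduced w}" by blast
  show "word_val x (red g) = g" unfolding red_def by (rule f_inv_into_f[OF g])
  show "red g \<in> words r" "reduced (red g)" using inv_into_into[OF g] by (auto simp: red_def)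
qed

lemma red_unique: "w \<in> words r \<Longrightarrow> reduced w \<Longrightarrow> word_val x w = g \<Longrightarrow> red g = w"
  using basis unfolding red_def free_group_basis_def bij_betw_def by (auto intro: inv_into_f_eq)

lemma word_val_append: "word_val x (v @ w) = word_val x v + word_val x w"
  by (simp add: word_val_def)

lemma red_zero: "red 0 = []"
  by (rule red_unique) (auto simp: words_def reduced_def word_val_def)

lemma red_add_letter:
  assumes "fst l < r" "\<And>w. red g \<noteq> w @ [(fst l, \<not> snd l)]"
  shows "red (g + letter_val x l) = red g @ [l]"
proof (rule red_unique)
  show "red g @ [l] \<in> words r" using red(1)[of g] assms(1) by (cases l) (auto simp: words_def)
  show "reduced (red g @ [l])"
  proof (cases "red g" rule: rev_cases)
    case Nil
    then show ?thesis by (simp add: reduced_def)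
  next
    case (snoc w l')
    then have "\<not> (fst l' = fst l \<and> snd l' \<noteq> snd l)"
      using assms(2)[of w] by (cases l') auto
    then show ?thesis using red(2)[of g] by (auto simp: reduced_def snoc successively_append_iff)
  qed
  show "word_val x (red g @ [l]) = g + letter_val x l"
    by (simp add: word_val_append red) (simp add: word_val_def)
qed

text \<open>The unit is listed as coefficient of index 0, so a pencil is a combination of
  \<open>gen 0, \<dots>, gen r\<close>.\<close>

definition gen :: "nat \<Rightarrow> 'f" where
  "gen j = (if j = 0 then 0 else x (j - 1))"

text \<open>The index of the neighbour of \<open>g\<close> that is closer to the root of the Cayley tree, if it
  is reached through a generator (and 0 otherwise).\<close>

definition idx :: "'f \<Rightarrow> nat" where
  "idx g = (if red g \<noteq> [] \<and> \<not> snd (last (red g)) then Suc (fst (last (red g))) else 0)"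

lemma idx_le: "idx g \<le> r"
proof -
  have "last (red g) \<in> {..<r} \<times> UNIV" if "red g \<noteq> []"
    using red(1)[of g] last_in_set[OF that] by (auto simp: words_def)
  then show ?thesis by (auto simp: idx_def mem_Times_iff)
qed

lemma red_diff_gen:
  assumes "0 < j" "j \<le> r" "\<And>w. red g \<noteq> w @ [(j - 1, True)]"
  shows "len (g - gen j) = Suc (len g)"
proof -
  have "red (g + letter_val x (j - 1, False)) = red g @ [(j - 1, False)]"
    by (rule red_add_letter) (use assms in auto)
  then show ?thesis using assms by (simp add: letter_val_def gen_def)
qed

lemma red_add_gen:
  assumes "0 < j" "j \<le> r" "j \<noteq> idx g"
  shows "red (g + gen j) = red g @ [(j - 1, True)]"
proof -
  have "red g \<noteq> w @ [(j - 1, False)]" for w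
    using assms by (auto simp: idx_def)
  then have "red (g + letter_val x (j - 1, True)) = red g @ [(j - 1, True)]"
    by (intro red_add_letter) (use assms in auto)
  then show ?thesis using assms by (simp add: letter_val_def gen_def)
qed

text \<open>For \<open>j \<noteq> idx g\<close> the step from \<open>g\<close> to
  \<open>g + gen j\<close> leads away from the root of the tree. Among the elements that reach the
  same position, \<open>g\<close> is the one on the path to the root, so the others are
  longer.\<close>

lemma len_neighbour:
  assumes "j \<le> r" "j \<noteq> idx g" "j' \<le> r" "j' \<noteq> j"
  shows "len g < len (g + gen j - gen j')"
proof (cases "j = 0")
  case True
  then have "red g \<noteq> w @ [(j' - 1, True)]" for w
    using assms(2) by (auto simp: idx_def)
  then show ?thesis using red_diff_gen[of j' g] assms True by (simp add: gen_def)
next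
  case False
  then have g: "red (g + gen j) = red g @ [(j - 1, True)]"
    using red_add_gen assms by simp
  show ?thesis
  proof (cases "j' = 0")
    case True
    then show ?thesis using g by (simp add: gen_def)
  next
    case j': False
    then have "len (g + gen j - gen j') = Suc (len (g + gen j))"
      by (intro red_diff_gen) (use assms g False in auto)
    then show ?thesis using g by simp
  qed
qed

text \<open>The position 0 is the root, so a coefficient next to it meets it in the distinguished
  direction. For \<open>g = 0\<close> this rests on the default value 0 of
  \<open>idx\<close>.\<close>

lemma idx_inverse:
  assumes "g + gen j = 0" "j \<le> r"
  shows "idx g = j"
proof (cases "j = 0")
  case True
  then show ?thesis using assms red_zero by (simp add: idx_def gen_def)
next
  case False
  then have "g = letter_val x (j - 1, False)"
    using assms by (simp add: gen_def letter_val_def eq_neg_iff_add_eq_0)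
  then have "red g = [(j - 1, False)]"
    by (intro red_unique) (use assms False in \<open>auto simp: words_def reduced_def word_val_def\<close>)
  then show ?thesis using False by (simp add: idx_def)
qed

text \<open>The scalars of a linear row are stored in one sequence: position
  \<open>c * Suc r + j\<close> holds the coefficient of \<open>gen j\<close> in column
  \<open>c\<close>.\<close>

definition pencil :: "(nat \<Rightarrow> 'k::field) \<Rightarrow> nat \<Rightarrow> 'f \<Rightarrow>\<^sub>0 'k" where
  "pencil b c = (\<Sum>j\<le>r. Poly_Mapping.single (gen j) (b (c * Suc r + j)))"

definition trunc :: "nat \<Rightarrow> (nat \<Rightarrow> 'k::field) \<Rightarrow> nat \<Rightarrow> 'k" where
  "trunc i b q = (if q mod Suc r = i then 0 else b q)"

text \<open>The condition fails for \<open>i\<close> iff some nontrivial scalar combination of the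
  rows has all its entries in the line of \<open>gen i\<close>, that is, iff a scalar row times a
  unit, possibly zero, can be split off.\<close>

definition reduced_pencil :: "(nat \<Rightarrow> 'k::field) list \<Rightarrow> bool" where
  "reduced_pencil bs \<longleftrightarrow> (\<forall>i\<le>r. vindep (map (trunc i) bs))"

text \<open>Take \<open>g\<close> of maximal length in the supports of the coefficients. By \<open>len_neighbour\<close> its
  contribution to \<open>g + gen j\<close> cannot cancel against other group elements.\<close>

lemma reduced_pencil_lookup:
  fixes a :: "nat \<Rightarrow> 'f \<Rightarrow>\<^sub>0 'k::field"
  assumes bs: "reduced_pencil bs" and l: "l < length bs" "a l \<noteq> 0"
  obtains g j c where "j \<le> r" "j \<noteq> idx g"
    "Poly_Mapping.lookup (\<Sum>l<length bs. a l * pencil (bs ! l) c) (g + gen j) \<noteq> 0"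
proof -
  define U where "U = (\<Union>l<length bs. Poly_Mapping.keys (a l))"
  have "finite U" by (simp add: U_def)
  moreover have "U \<noteq> {}" using l by (auto simp: U_def)
  ultimately obtain g where g: "g \<in> U" "\<And>h. h \<in> U \<Longrightarrow> len h \<le> len g"
    using Max_in[of "len ` U"] Max_ge[of "len ` U"] by fastforce
  define v where "v = (\<lambda>l. Poly_Mapping.lookup (a l) g)"
  obtain l' where "l' < length bs" "v l' \<noteq> 0"
    using g(1) by (auto simp: U_def v_def in_keys_iff)
  moreover have "vindep (map (trunc (idx g)) bs)"
    using bs idx_le by (simp add: reduced_pencil_def)
  ultimately have "(\<Sum>l<length bs. lscale (v l) (trunc (idx g) (bs ! l))) \<noteq> 0"
    unfolding L.lindep_iff_sum by auto
  then obtain q where q: "(\<Sum>l<length bs. v l * trunc (idx g) (bs ! l) q) \<noteq> 0"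
    by (auto simp: fun_eq_iff sum_fun_apply)
  define j where "j = q mod Suc r"
  define c where "c = q div Suc r"
  have j: "j \<le> r" by (simp add: j_def flip: less_Suc_eq_le)
  have ji: "j \<noteq> idx g" using q by (auto simp: trunc_def j_def)
  have cj: "c * Suc r + j = q" by (simp add: c_def j_def del: mult_Suc_right)
  have "Poly_Mapping.lookup (a l * pencil (bs ! l) c) (g + gen j) = v l * trunc (idx g) (bs ! l) q"
    if l: "l < length bs" for l
  proof -
    have zero: "Poly_Mapping.lookup (a l) (g + gen j - gen j') = 0" if "j' \<le> r" "j' \<noteq> j" for j'
      using g(2)[of "g + gen j - gen j'"] len_neighbour[OF j ji that] l
      by (fastforce simp: U_def in_keys_iff)
    have "Poly_Mapping.lookup (a l * pencil (bs ! l) c) (g + gen j) =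
        (\<Sum>j'\<le>r. Poly_Mapping.lookup (a l) (g + gen j - gen j') * (bs ! l) (c * Suc r + j'))"
      by (simp add: pencil_def sum_distrib_left lookup_sum lookup_times_single)
    also have "\<dots> = (\<Sum>j'\<in>{j}. Poly_Mapping.lookup (a l) (g + gen j - gen j') * (bs ! l) (c * Suc r + j'))"
      by (rule sum.mono_neutral_right) (use j zero in auto)
    also have "\<dots> = v l * trunc (idx g) (bs ! l) q"
      using cj ji by (simp add: v_def trunc_def j_def del: mult_Suc_right)
    finally show ?thesis .
  qed
  then have "Poly_Mapping.lookup (\<Sum>l<length bs. a l * pencil (bs ! l) c) (g + gen j) \<noteq> 0"
    using q by (simp add: lookup_sum)
  with j ji show ?thesis by (rule that)
qed

lemma lindep_reduced_pencil:
  fixes bs :: "(nat \<Rightarrow> 'k::field) list"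
  assumes "reduced_pencil bs"
  shows "vindep (map pencil bs)"
  unfolding L.lindep_iff_sum
proof (intro allI impI, rule ccontr)
  fix a :: "nat \<Rightarrow> 'f \<Rightarrow>\<^sub>0 'k" and l
  assume z: "(\<Sum>i<length (map pencil bs). lscale (a i) (map pencil bs ! i)) = 0"
    and l: "l < length (map pencil bs)" "a l \<noteq> 0"
  obtain g j c where "Poly_Mapping.lookup (\<Sum>l<length bs. a l * pencil (bs ! l) c) (g + gen j) \<noteq> 0"
    by (rule reduced_pencil_lookup[of bs l a, OF assms]) (use l in auto)
  moreover have "(\<Sum>l<length bs. a l * pencil (bs ! l) c) = 0"
    using fun_cong[OF z, of c] by (simp add: sum_fun_apply)
  ultimately show False by simp
qed

text \<open>The coefficient found by \<open>reduced_pencil_lookup\<close> lies at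
  \<open>g + gen j\<close> with \<open>j \<noteq> idx g\<close>. By \<open>idx_inverse\<close> that
  is never the position 0, the only one where a constant vector can be nonzero.\<close>

lemma reduced_pencil_constant:
  fixes bs :: "(nat \<Rightarrow> 'k::field) list"
  assumes "reduced_pencil bs" "y \<in> vspan (map pencil bs)"
    and const: "\<And>c h. Poly_Mapping.lookup (y c) h \<noteq> 0 \<Longrightarrow> h = 0"
  shows "y = 0"
proof (rule ccontr)
  assume "y \<noteq> 0"
  obtain a where y: "y = (\<Sum>i<length bs. lscale (a i) (pencil (bs ! i)))"
    using assms(2) by (auto simp: L.lspan_iff_sum)
  have "\<exists>l<length bs. a l \<noteq> 0"
  proof (rule ccontr)
    assume "\<not> (\<exists>l<length bs. a l \<noteq> 0)"
    then have "y = 0" unfolding y by (intro sum.neutral) (simp add: L.s_zero_left)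
    then show False using \<open>y \<noteq> 0\<close> by simp
  qed
  then obtain l where l: "l < length bs" "a l \<noteq> 0" by blast
  obtain g j c where g: "j \<le> r" "j \<noteq> idx g"
    "Poly_Mapping.lookup (\<Sum>l<length bs. a l * pencil (bs ! l) c) (g + gen j) \<noteq> 0"
    by (rule reduced_pencil_lookup[of bs l a, OF assms(1) l])
  have "y c = (\<Sum>l<length bs. a l * pencil (bs ! l) c)" by (simp add: y sum_fun_apply)
  then have "g + gen j = 0" using const[of c "g + gen j"] g(3) by simp
  then show False using idx_inverse[of g j] g by simp
qed

end

section \<open>Reduction of a pencil\<close>

text \<open>Restriction to the columns in \<open>Q\<close> maps the span bijectively onto all
  functions on \<open>Q\<close>. The notion serves twice: over K for the truncated rows of the
  current index, and over the group algebra for the rows that have cleared a column.\<close>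

definition echelon :: "nat set \<Rightarrow> (nat \<Rightarrow> 'a::ring_1) list \<Rightarrow> bool" where
  "echelon Q ys \<longleftrightarrow> vindep ys \<and>
     (\<forall>y\<in>vspan ys. (\<forall>q\<in>Q. y q = 0) \<longrightarrow> y = 0) \<and>
     (\<forall>z. \<exists>y\<in>vspan ys. \<forall>q\<in>Q. y q = z q)"

lemma echelon_Nil: "echelon {} []"
  by (simp add: echelon_def)

lemma echelon_Cons:
  fixes v :: "nat \<Rightarrow> 'a::ring_1"
  assumes e: "echelon Q ys" and v: "\<And>q. q \<in> Q \<Longrightarrow> v q = 0"
    and u: "u * v p = 1" "v p * u = 1"
  shows "echelon (insert p Q) (v # ys)"
proof -
  have cancel: "a = 0" if "a * v p = 0" for a
  proof -
    have "a = a * v p * u" using u by (simp add: mult.assoc)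
    then show ?thesis using that by simp
  qed
  have dep: "a = 0 \<and> y = 0"
    if y: "y \<in> vspan ys" and z: "\<And>q. q \<in> insert p Q \<Longrightarrow> a * v q + y q = 0" for a y
  proof -
    have "y q = 0" if "q \<in> Q" for q using z[of q] v that by simp
    then have "y = 0" using e y by (simp add: echelon_def)
    then show ?thesis using z[of p] cancel by simp
  qed
  have "vindep (v # ys)"
  proof -
    have "a = 0" if a: "lscale a v \<in> vspan ys" for a
    proof -
      have "- lscale a v \<in> vspan ys"
        using L.submod_neg[OF L.submod_lspan a] .
      then show ?thesis using dep[of "- lscale a v" a] by simp
    qed
    then show ?thesis using e unfolding echelon_def lindep.simps by blast
  qed
  moreover have "y = 0" if "y \<in> vspan (v # ys)" "\<forall>q\<in>insert p Q. y q = 0" for y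
  proof -
    obtain a z where y: "y = lscale a v + z" "z \<in> vspan ys"
      using \<open>y \<in> _\<close> by auto
    have "a = 0 \<and> z = 0" by (rule dep[OF y(2)]) (use that(2) y(1) in auto)
    then show ?thesis using y by (simp add: fun_eq_iff)
  qed
  moreover have "\<exists>y\<in>vspan (v # ys). \<forall>q\<in>insert p Q. y q = z q" for z
  proof -
    obtain y where y: "y \<in> vspan ys" "\<forall>q\<in>Q. y q = z q"
      using e unfolding echelon_def by blast
    \<comment> \<open>The multiple of \<open>v\<close> that corrects the value at \<open>p\<close>;
      it leaves the columns in \<open>Q\<close> untouched, because \<open>v\<close> vanishes
      there.\<close>
    define a where "a = (z p - y p) * u"
    have "lscale a v + y \<in> vspan (v # ys)" using y(1) by auto
    moreover have "(lscale a v + y) q = z q" if "q \<in> insert p Q" "p \<notin> Q" for q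
      using that y(2) v u by (auto simp: a_def mult.assoc)
    moreover have "p \<notin> Q"
    proof
      assume "p \<in> Q"
      then show False using v u by simp
    qed
    ultimately show ?thesis by blast
  qed
  ultimately show ?thesis unfolding echelon_def by blast
qed

text \<open>In a relation the members of \<open>as\<close> contribute nothing in the columns
  \<open>Q\<close>. The part coming from \<open>ys\<close> thus vanishes on \<open>Q\<close>, and it
  is determined by its values there.\<close>

lemma lindep_append_echelon:
  assumes "vindep as" "echelon Q ys" "\<And>v q. v \<in> set as \<Longrightarrow> q \<in> Q \<Longrightarrow> v q = 0"
  shows "vindep (as @ ys)"
  using assms
proof (induction as)
  case Nil
  then show ?case unfolding echelon_def append_Nil by blast
next
  case (Cons v as)
  have van: "u q = 0" if "u \<in> vspan (v # as)" "q \<in> Q" for u q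
  proof -
    have "vspan (v # as) \<subseteq> {u. u q = 0}"
      by (rule L.lspan_least) (use Cons.prems(3) that in \<open>auto simp: submod_def\<close>)
    then show ?thesis using that by blast
  qed
  have "a = 0" if a: "lscale a v \<in> vspan (as @ ys)" for a
  proof -
    obtain u w where uw: "lscale a v = u + w" "u \<in> vspan as"
        "w \<in> vspan ys"
      using a unfolding L.lspan_append by blast
    have u: "u \<in> vspan (v # as)"
      using uw(2) L.lspan_Cons_subset by blast
    have av: "lscale a v \<in> vspan (v # as)"
      by (rule L.submod_scale[OF L.submod_lspan L.lspan_superset]) simp
    have "w q = 0" if "q \<in> Q" for q
      using van[OF u that] van[OF av that] fun_cong[OF uw(1), of q] by simp
    then have "w = 0" using Cons.prems(2) uw(3) unfolding echelon_def by blast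
    then have "lscale a v \<in> vspan as" using uw(1,2) by simp
    then show ?thesis using Cons.prems(1) unfolding lindep.simps by blast
  qed
  moreover have "vindep (as @ ys)"
    using Cons.IH Cons.prems(1,2) Cons.prems(3)[OF list.set_intros(2)] unfolding lindep.simps by blast
  ultimately show ?case unfolding append_Cons lindep.simps by blast
qed

lemma (in linear_map) lindep_map_kernel:
  assumes "lindep t (map f xs)" "y \<in> lspan s xs" "f y = 0"
  shows "y = 0"
  using assms
proof (induction xs arbitrary: y)
  case (Cons x xs)
  obtain a z where y: "y = s a x + z" "z \<in> lspan s xs" using Cons.prems(2) by auto
  have "t a (f x) = - f z"
    using Cons.prems(3) y(1) by (simp add: f_add f_scale eq_neg_iff_add_eq_0)
  then have "t a (f x) = f (- z)" using f_diff[of 0 z] by simp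
  moreover have "- z \<in> lspan s xs" using M.submod_neg[OF M.submod_lspan y(2)] .
  ultimately have "a = 0" using Cons.prems(1) by (simp add: lspan_map)
  then have "y = z" using y by simp
  then show ?case using Cons y by simp
qed simp

type_synonym 'k formal = "('k \<times> (nat \<times> bool) list) list"
type_synonym 'k fvec = "nat \<Rightarrow> ('k \<times> (nat \<times> bool) list) list"
text \<open>The label consists of formal sums, which are multiplied and added but never tested for
  zero. All decisions of the reduction look at the scalars in the second component.\<close>

type_synonym 'k row = "'k fvec \<times> (nat \<Rightarrow> 'k)"
type_synonym 'k state = "nat \<times> 'k row list \<times> 'k row list \<times> 'k fvec list \<times> ('k row \<times> nat) list"

definition formal_mult :: "'k::field formal \<Rightarrow> 'k formal \<Rightarrow> 'k formal" where
  "formal_mult a b = concat (map (\<lambda>t. map (\<lambda>u. (fst t * fst u, snd t @ snd u)) b) a)"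

definition add_multiple ::
  "nat \<Rightarrow> 'k::field formal \<Rightarrow> 'k fvec \<Rightarrow> 'k fvec \<Rightarrow> 'k fvec" where
  "add_multiple n a p' p = (\<lambda>i. if i < n then p i @ formal_mult a (p' i) else [])"

definition eliminate :: "nat \<Rightarrow> nat \<Rightarrow> nat \<Rightarrow> 'k::field row \<Rightarrow> 'k row \<Rightarrow> 'k row" where
  "eliminate n d q \<rho>' \<rho> =
     (add_multiple n [(- (snd \<rho> q * inverse (snd \<rho>' q)), [])] (fst \<rho>') (fst \<rho>),
      \<lambda>t. if t < d then snd \<rho> t - snd \<rho> q * inverse (snd \<rho>' q) * snd \<rho>' t else 0)"

definition zero_row :: "'k::zero row" where
  "zero_row = (\<lambda>_. [], \<lambda>_. 0)"

section \<open>Row operations on formal rows and their values\<close>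

context free_group
begin

definition formal_val :: "'k::field formal \<Rightarrow> 'f \<Rightarrow>\<^sub>0 'k" where
  "formal_val ts = (\<Sum>(a, w)\<leftarrow>ts. Poly_Mapping.single (word_val x w) a)"

lemma formal_val_Nil [simp]: "formal_val [] = 0"
  by (simp add: formal_val_def)

lemma formal_val_Cons [simp]: "formal_val (t # ts) = Poly_Mapping.single (word_val x (snd t)) (fst t) + formal_val ts"
  by (simp add: formal_val_def case_prod_unfold)

lemma formal_val_append [simp]: "formal_val (a @ b) = formal_val a + formal_val b"
  by (simp add: formal_val_def)

lemma formal_val_mult [simp]: "formal_val (formal_mult a b) = formal_val a * formal_val b"
proof -
  have 1: "formal_val (map (\<lambda>u. (fst t * fst u, snd t @ snd u)) b) =
      Poly_Mapping.single (word_val x (snd t)) (fst t) * formal_val b" for t :: "'a \<times> (nat \<times> bool) list"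
    by (induction b) (simp_all add: word_val_append mult_single distrib_left)
  show ?thesis
    by (induction a) (simp_all add: formal_mult_def 1 distrib_right)
qed

abbreviation val_vec :: "'k::field fvec \<Rightarrow> nat \<Rightarrow> 'f \<Rightarrow>\<^sub>0 'k" where
  "val_vec p \<equiv> (\<lambda>i. formal_val (p i))"

definition row_val :: "'k::field row \<Rightarrow> (nat \<Rightarrow> 'f \<Rightarrow>\<^sub>0 'k) \<times> (nat \<Rightarrow> 'f \<Rightarrow>\<^sub>0 'k)" where
  "row_val \<rho> = (val_vec (fst \<rho>), pencil (snd \<rho>))"

text \<open>For \<open>j \<le> r\<close> the remainder \<open>mod r\<close> changes nothing. It
  makes the word a legal one for every \<open>j\<close>, so that \<open>computable_gen_word\<close>
  needs no side condition.\<close>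

definition gen_word :: "bool \<Rightarrow> nat \<Rightarrow> (nat \<times> bool) list" where
  "gen_word e j = (if j = 0 then [] else [((j - 1) mod r, e)])"

lemma word_val_gen_word:
  "j \<le> r \<Longrightarrow> word_val x (gen_word True j) = gen j" "j \<le> r \<Longrightarrow> word_val x (gen_word False j) = - gen j"
  by (auto simp: gen_word_def gen_def word_val_def letter_val_def)

text \<open>Intended for a row \<open>\<rho>'\<close> whose entries all lie in the direction
  \<open>i = q mod Suc r\<close>, so that it is a scalar row times the unit \<open>gen i\<close>,
  with a nonzero scalar p at \<open>q\<close>. Let the entry of \<open>\<rho>\<close> in the column
  of \<open>q\<close> be the sum of b_j \<open>gen j\<close>. It is cancelled by subtracting
  \<open>\<rho>'\<close> multiplied on the left by the sum of (b_j / p) \<open>gen j - gen i\<close>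
  (additive notation in F). The inverse of \<open>gen i\<close> cancels against every entry of
  \<open>\<rho>'\<close>, so the result is again a linear pencil although the multiplier is not a
  scalar.\<close>

definition clear :: "nat \<Rightarrow> nat \<Rightarrow> nat \<Rightarrow> 'k::field row \<Rightarrow> 'k row \<Rightarrow> 'k row" where
  "clear n d q \<rho>' \<rho> =
     (add_multiple n
        (map (\<lambda>j. (- (snd \<rho> (q div Suc r * Suc r + j) * inverse (snd \<rho>' q)),
           gen_word True j @ gen_word False (q mod Suc r))) [0..<Suc r]) (fst \<rho>') (fst \<rho>),
      \<lambda>t. if t < d then snd \<rho> t - snd \<rho> (q div Suc r * Suc r + t mod Suc r) * inverse (snd \<rho>' q) *
            snd \<rho>' (t div Suc r * Suc r + q mod Suc r) else 0)"

text \<open>On rows of this kind the cut-offs inside the row operations have no effect, and the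
  operations become identities between values.\<close>

definition row_ok :: "nat \<Rightarrow> nat \<Rightarrow> 'k::field row \<Rightarrow> bool" where
  "row_ok n d \<rho> \<longleftrightarrow> (\<forall>i\<ge>n. fst \<rho> i = []) \<and> (\<forall>t\<ge>d. snd \<rho> t = 0)"

lemma row_ok_eliminate: "row_ok n d (eliminate n d q \<rho>' \<rho>)"
  by (simp add: row_ok_def eliminate_def add_multiple_def)

lemma row_ok_clear: "row_ok n d (clear n d q \<rho>' \<rho>)"
  by (simp add: row_ok_def clear_def add_multiple_def)

lemma val_add_multiple:
  assumes "\<forall>i\<ge>n. p i = []" "\<forall>i\<ge>n. p' i = []"
  shows "val_vec (add_multiple n a p' p) = val_vec p + lscale (formal_val a) (val_vec p')"
  using assms by (auto simp: add_multiple_def fun_eq_iff)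

lemma row_val_eliminate:
  fixes \<rho> \<rho>' :: "'k::field row"
  assumes "row_ok n d \<rho>" "row_ok n d \<rho>'"
  shows "row_val (eliminate n d q \<rho>' \<rho>) =
    row_val \<rho> - pair_scale (Poly_Mapping.single 0 (snd \<rho> q * inverse (snd \<rho>' q))) (row_val \<rho>')"
proof -
  let ?a = "snd \<rho> q * inverse (snd \<rho>' q)"
  have b: "snd (eliminate n d q \<rho>' \<rho>) = (\<lambda>t. snd \<rho> t - ?a * snd \<rho>' t)"
    using assms by (auto simp: eliminate_def row_ok_def fun_eq_iff)
  have "pencil (snd (eliminate n d q \<rho>' \<rho>)) = pencil (snd \<rho>) - lscale (Poly_Mapping.single 0 ?a) (pencil (snd \<rho>'))"
    unfolding b by (auto simp: fun_eq_iff pencil_def single_diff sum_subtractf sum_distrib_left mult_single)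
  moreover have "val_vec (fst (eliminate n d q \<rho>' \<rho>)) =
      val_vec (fst \<rho>) - lscale (Poly_Mapping.single 0 ?a) (val_vec (fst \<rho>'))"
    using assms unfolding eliminate_def
    by (simp add: val_add_multiple row_ok_def word_val_def single_uminus fun_eq_iff)
  ultimately show ?thesis by (simp add: row_val_def pair_scale_def prod_eq_iff)
qed

lemma pencil_single:
  assumes i: "i \<le> r" and b: "\<And>t. t mod Suc r \<noteq> i \<Longrightarrow> b t = 0"
  shows "pencil b c = Poly_Mapping.single (gen i) (b (c * Suc r + i))"
proof -
  have "pencil b c = (\<Sum>j\<in>{i}. Poly_Mapping.single (gen j) (b (c * Suc r + j)))"
    unfolding pencil_def
  proof (rule sum.mono_neutral_right)
    show "\<forall>j\<in>{..r} - {i}. Poly_Mapping.single (gen j) (b (c * Suc r + j)) = 0"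
    proof
      fix j
      assume "j \<in> {..r} - {i}"
      then have "(c * Suc r + j) mod Suc r \<noteq> i" by (simp del: mult_Suc_right)
      then show "Poly_Mapping.single (gen j) (b (c * Suc r + j)) = 0" using b by simp
    qed
  qed (use i in auto)
  then show ?thesis by simp
qed

lemma row_val_clear:
  fixes \<rho> \<rho>' :: "'k::field row"
  assumes ok: "row_ok n (k * Suc r) \<rho>" "row_ok n (k * Suc r) \<rho>'"
    and single: "\<And>t. t mod Suc r \<noteq> q mod Suc r \<Longrightarrow> snd \<rho>' t = 0"
  shows "\<exists>a. row_val (clear n (k * Suc r) q \<rho>' \<rho>) = row_val \<rho> - pair_scale a (row_val \<rho>')"
proof
  let ?i = "q mod Suc r" and ?c = "q div Suc r"
  let ?\<kappa> = "\<lambda>j. snd \<rho> (?c * Suc r + j) * inverse (snd \<rho>' q)"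
  let ?a = "\<Sum>j\<le>r. Poly_Mapping.single (gen j - gen ?i) (?\<kappa> j)"
  have i: "?i \<le> r" by (simp flip: less_Suc_eq_le)
  have b: "snd (clear n (k * Suc r) q \<rho>' \<rho>) =
      (\<lambda>t. snd \<rho> t - ?\<kappa> (t mod Suc r) * snd \<rho>' (t div Suc r * Suc r + ?i))"
  proof
    fix t
    \<comment> \<open>The bound is a multiple of \<open>Suc r\<close>: a cut-off inside a column
      could separate \<open>t\<close> from the position of direction \<open>?i\<close> in the same
      column.\<close>
    have "t div Suc r * Suc r + ?i \<ge> k * Suc r" if "t \<ge> k * Suc r"
    proof -
      have "k \<le> t div Suc r" using that by (simp add: less_eq_div_iff_mult_less_eq)
      then have "k * Suc r \<le> t div Suc r * Suc r" by (rule mult_le_mono1)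
      then show ?thesis by simp
    qed
    then show "snd (clear n (k * Suc r) q \<rho>' \<rho>) t =
        snd \<rho> t - ?\<kappa> (t mod Suc r) * snd \<rho>' (t div Suc r * Suc r + ?i)"
      using ok by (auto simp: clear_def row_ok_def simp del: mult_Suc_right)
  qed
  have pen: "pencil (snd \<rho>') c = Poly_Mapping.single (gen ?i) (snd \<rho>' (c * Suc r + ?i))" for c
    by (rule pencil_single[OF i]) (rule single)
  have "pencil (snd (clear n (k * Suc r) q \<rho>' \<rho>)) c = pencil (snd \<rho>) c - ?a * pencil (snd \<rho>') c" for c
  proof -
    have "?a * pencil (snd \<rho>') c =
        (\<Sum>j\<le>r. Poly_Mapping.single (gen j) (?\<kappa> j * snd \<rho>' (c * Suc r + ?i)))"
      unfolding pen sum_distrib_right by (simp add: mult_single)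
    then show ?thesis unfolding b pencil_def sum_subtractf[symmetric] single_diff[symmetric]
      by (simp add: sum_subtractf[symmetric] single_diff[symmetric] del: mult_Suc_right)
  qed
  moreover have "formal_val (map (\<lambda>j. (- ?\<kappa> j, gen_word True j @ gen_word False ?i)) [0..<Suc r]) = - ?a"
  proof -
    have "formal_val (map (\<lambda>j. (- ?\<kappa> j, gen_word True j @ gen_word False ?i)) [0..<m]) =
        - (\<Sum>j<m. Poly_Mapping.single (gen j - gen ?i) (?\<kappa> j))" if "m \<le> Suc r" for m
      using that
    proof (induction m)
      case (Suc m)
      then show ?case using i
        by (simp add: word_val_append word_val_gen_word single_uminus del: mult_Suc_right)
    qed simp
    from this[of "Suc r"] show ?thesis by (simp add: lessThan_Suc_atMost del: upt_Suc)
  qed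
  then have "val_vec (fst (clear n (k * Suc r) q \<rho>' \<rho>)) =
      val_vec (fst \<rho>) - lscale ?a (val_vec (fst \<rho>'))"
    using ok unfolding clear_def fst_conv
    by (subst val_add_multiple) (auto simp: row_ok_def fun_eq_iff simp del: upt_Suc mult_Suc_right)
  ultimately show "row_val (clear n (k * Suc r) q \<rho>' \<rho>) = row_val \<rho> - pair_scale ?a (row_val \<rho>')"
    by (simp add: row_val_def pair_scale_def prod_eq_iff fun_eq_iff)
qed

end

context lmodule
begin

lemma lspan_mono: "set xs \<subseteq> set ys \<Longrightarrow> lspan s xs \<subseteq> lspan s ys"
  unfolding lspan_subset_iff using lspan_superset by blast

lemma lspan_map_shear:
  assumes "\<And>t. t \<in> set ts \<Longrightarrow> \<exists>a. g t = f t - s a v" "v \<in> set X"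
  shows "lspan s (map g ts @ X) = lspan s (map f ts @ X)"
    and "lindep s (map f ts @ X) \<Longrightarrow> lindep s (map g ts @ X)"
proof -
  have *: "list_all2 (\<lambda>y z. z - y \<in> lspan s X) (map f ts) (map g ts)"
    unfolding list_all2_map1 list_all2_map2
  proof (rule list.rel_refl_strong)
    fix t
    assume "t \<in> set ts"
    then obtain a where "g t = f t - s a v" using assms(1) by blast
    then have "g t - f t = s (- a) v" by (simp add: s_minus_left)
    then show "g t - f t \<in> lspan s X"
      using submod_scale[OF submod_lspan lspan_superset[OF assms(2)]] by simp
  qed
  show "lspan s (map g ts @ X) = lspan s (map f ts @ X)" by (rule lspan_append_shear[OF *])
  show "lindep s (map g ts @ X)" if "lindep s (map f ts @ X)" by (rule lindep_append_shear[OF * that])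
qed

end

section \<open>The reduction loop, its invariant and its termination\<close>

context free_group
begin

text \<open>For a row that vanishes from \<open>d\<close> on, the list is empty iff the row is a
  scalar row times \<open>gen i\<close>. Otherwise its head serves as pivot position for the
  elimination at index \<open>i\<close>.\<close>

definition outside :: "nat \<Rightarrow> nat \<Rightarrow> 'k::field row \<Rightarrow> nat list" where
  "outside i d \<rho> = filter (\<lambda>q. q mod Suc r \<noteq> i \<and> snd \<rho> q \<noteq> 0) [0..<d]"

definition support :: "nat \<Rightarrow> 'k::field row \<Rightarrow> nat list" where
  "support d \<rho> = filter (\<lambda>q. snd \<rho> q \<noteq> 0) [0..<d]"

text \<open>In a state \<open>(i, todo, acc, ker, don)\<close>, the rows in \<open>todo @ acc\<close> are active, and those in
  \<open>acc\<close> are in echelon form when the components of index \<open>i\<close> are disregarded. The restart at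
  index 0 is necessary because clearing a column destroys the independence for smaller indices.\<close>

definition reduce_step :: "nat \<Rightarrow> nat \<Rightarrow> 'k::field state \<Rightarrow> 'k state" where
  "reduce_step n d = (\<lambda>(i, todo, acc, ker, don).
     if r < i then (i, todo, acc, ker, don)
     else if todo = [] then (Suc i, acc, [], ker, don)
     else if outside i d (nth_default zero_row todo 0) \<noteq> [] then
       (i, map (eliminate n d (nth_default 0 (outside i d (nth_default zero_row todo 0)) 0)
                 (nth_default zero_row todo 0)) (tl todo),
        nth_default zero_row todo 0 # acc, ker, don)
     else if support d (nth_default zero_row todo 0) = [] then
       (0, tl todo @ acc, [], fst (nth_default zero_row todo 0) # ker, don)
     else
       (0, map (clear n d (nth_default 0 (support d (nth_default zero_row todo 0)) 0)
                 (nth_default zero_row todo 0)) (tl todo @ acc), [], ker,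
        (nth_default zero_row todo 0, nth_default 0 (support d (nth_default zero_row todo 0)) 0) # don))"

text \<open>Finished states, with index above \<open>r\<close>, are fixed points, so a loop can be
  replaced by a fixed number of iterations. The number is a bound for \<open>reduce_measure\<close>
  of the initial state.\<close>

definition reduce :: "nat \<Rightarrow> nat \<Rightarrow> 'k::field row list \<Rightarrow> 'k state" where
  "reduce n d rows = (reduce_step n d ^^ (Suc (length rows) * (r + 2) * Suc (length rows))) (0, rows, [], [], [])"

lemma reduce_step_simps:
  "r < i \<Longrightarrow> reduce_step n d (i, todo, acc, ker, don) = (i, todo, acc, ker, don)"
  "i \<le> r \<Longrightarrow> reduce_step n d (i, [], acc, ker, don) = (Suc i, acc, [], ker, don)"
  "i \<le> r \<Longrightarrow> outside i d \<rho> = q # qs \<Longrightarrow> reduce_step n d (i, \<rho> # ts, acc, ker, don) =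
     (i, map (eliminate n d q \<rho>) ts, \<rho> # acc, ker, don)"
  "i \<le> r \<Longrightarrow> outside i d \<rho> = [] \<Longrightarrow> support d \<rho> = [] \<Longrightarrow>
     reduce_step n d (i, \<rho> # ts, acc, ker, don) = (0, ts @ acc, [], fst \<rho> # ker, don)"
  "i \<le> r \<Longrightarrow> outside i d \<rho> = [] \<Longrightarrow> support d \<rho> = q # qs \<Longrightarrow>
     reduce_step n d (i, \<rho> # ts, acc, ker, don) =
     (0, map (clear n d q \<rho>) (ts @ acc), [], ker, (\<rho>, q) # don)"
  by (simp_all add: reduce_step_def)

definition state_vals where
  "state_vals act ker don =
     map row_val act @ map (\<lambda>p. (val_vec p, 0)) ker @ map (\<lambda>z. row_val (fst z)) don"

definition pivot_cols :: "('k row \<times> nat) list \<Rightarrow> nat set" where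
  "pivot_cols don = (\<lambda>z. snd z div Suc r) ` set don"

definition reduce_inv where
  "reduce_inv n k G i todo acc ker don \<longleftrightarrow>
     (\<forall>\<rho>\<in>set todo \<union> set acc \<union> fst ` set don. row_ok n (k * Suc r) \<rho>) \<and>
     (\<forall>p\<in>set ker. \<forall>i\<ge>n. p i = []) \<and>
     (\<forall>c\<in>pivot_cols don. c < k) \<and>
     lspan pair_scale (state_vals (todo @ acc) ker don) = G \<and>
     lindep pair_scale (state_vals (todo @ acc) ker don) \<and>
     echelon (pivot_cols don) (map (\<lambda>z. pencil (snd (fst z))) don) \<and>
     (\<forall>\<rho>\<in>set todo \<union> set acc. \<forall>c\<in>pivot_cols don. \<forall>j\<le>r. snd \<rho> (c * Suc r + j) = 0) \<and>
     (\<forall>j<i. vindep (map (\<lambda>\<rho>. trunc j (snd \<rho>)) (todo @ acc))) \<and>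
     (\<exists>Q. echelon Q (map (\<lambda>\<rho>. trunc i (snd \<rho>)) acc) \<and>
        (\<forall>\<rho>\<in>set todo. \<forall>q\<in>Q. trunc i (snd \<rho>) q = 0))"

lemma reduce_inv_next:
  assumes "reduce_inv n k G i [] acc ker don"
  shows "reduce_inv n k G (Suc i) acc [] ker don"
  using assms unfolding reduce_inv_def
  by (auto simp: echelon_Nil less_Suc_eq intro!: exI[of _ "{}"]) (auto simp: echelon_def)

lemma trunc_eliminate:
  assumes "row_ok n d \<rho>" "row_ok n d \<rho>'"
  shows "trunc j (snd (eliminate n d q \<rho>' \<rho>)) =
    trunc j (snd \<rho>) - lscale (snd \<rho> q * inverse (snd \<rho>' q)) (trunc j (snd \<rho>'))"
  using assms by (auto simp: trunc_def eliminate_def row_ok_def fun_eq_iff)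

lemma state_vals_cong_mset:
  "mset act = mset act' \<Longrightarrow> lspan pair_scale (state_vals act ker don) = lspan pair_scale (state_vals act' ker don)"
  "mset act = mset act' \<Longrightarrow> lindep pair_scale (state_vals act ker don) = lindep pair_scale (state_vals act' ker don)"
proof -
  assume m: "mset act = mset act'"
  then have "set act = set act'" by (rule mset_eq_setD)
  then show "lspan pair_scale (state_vals act ker don) = lspan pair_scale (state_vals act' ker don)"
    by (intro P.lspan_cong_set) (simp add: state_vals_def)
  show "lindep pair_scale (state_vals act ker don) = lindep pair_scale (state_vals act' ker don)"
    using m by (intro P.lindep_cong_mset) (simp add: state_vals_def)
qed

lemma reduce_inv_eliminate:
  assumes inv: "reduce_inv n k G i (\<rho> # ts) acc ker don"
    and q: "outside i (k * Suc r) \<rho> = q # qs"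
  shows "reduce_inv n k G i (map (eliminate n (k * Suc r) q \<rho>) ts) (\<rho> # acc) ker don"
proof -
  let ?e = "eliminate n (k * Suc r) q \<rho>" and ?C = "pivot_cols don"
  have "q \<in> set (outside i (k * Suc r) \<rho>)" unfolding q by simp
  then have qi: "q mod Suc r \<noteq> i" "snd \<rho> q \<noteq> 0" by (auto simp: outside_def)
  have ok: "row_ok n (k * Suc r) \<rho>" "\<And>t. t \<in> set ts \<Longrightarrow> row_ok n (k * Suc r) t"
    using inv by (auto simp: reduce_inv_def)
  have tail: "state_vals (map ?e ts @ \<rho> # acc) ker don = map (\<lambda>t. row_val (?e t)) ts @ state_vals (\<rho> # acc) ker don"
      "state_vals (ts @ \<rho> # acc) ker don = map row_val ts @ state_vals (\<rho> # acc) ker don"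
    by (simp_all add: state_vals_def)
  have shear: "\<exists>a. row_val (?e t) = row_val t - pair_scale a (row_val \<rho>)" if "t \<in> set ts" for t
    using row_val_eliminate ok that by blast
  have in_tail: "row_val \<rho> \<in> set (state_vals (\<rho> # acc) ker don)" by (simp add: state_vals_def)
  have perm: "mset ((\<rho> # ts) @ acc) = mset (ts @ \<rho> # acc)" by simp
  have old: "lspan pair_scale (state_vals ((\<rho> # ts) @ acc) ker don) = G"
      "lindep pair_scale (state_vals ((\<rho> # ts) @ acc) ker don)"
    using inv unfolding reduce_inv_def by blast+
  have "lspan pair_scale (map (\<lambda>t. row_val (?e t)) ts @ state_vals (\<rho> # acc) ker don) =
      lspan pair_scale (map row_val ts @ state_vals (\<rho> # acc) ker don)"
    by (rule P.lspan_map_shear(1)[OF _ in_tail]) (rule shear)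
  then have "lspan pair_scale (state_vals (map ?e ts @ \<rho> # acc) ker don) = G"
    using old(1) unfolding tail(1) state_vals_cong_mset(1)[OF perm] tail(2) by (rule trans)
  moreover have "lindep pair_scale (state_vals (map ?e ts @ \<rho> # acc) ker don)"
    unfolding tail(1)
  proof (rule P.lspan_map_shear(2)[OF _ in_tail])
    show "lindep pair_scale (map row_val ts @ state_vals (\<rho> # acc) ker don)"
      using old(2) unfolding tail(2)[symmetric] state_vals_cong_mset(2)[OF perm, symmetric] .
  qed (rule shear)
  moreover have "vindep (map (\<lambda>\<rho>. trunc j (snd \<rho>)) (map ?e ts @ \<rho> # acc))" if "j < i" for j
  proof -
    have "vindep (map (\<lambda>\<rho>. trunc j (snd \<rho>)) ((\<rho> # ts) @ acc))"
      using inv that by (simp add: reduce_inv_def)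
    also have "vindep (map (\<lambda>\<rho>. trunc j (snd \<rho>)) ((\<rho> # ts) @ acc)) =
        vindep (map (\<lambda>\<rho>. trunc j (snd \<rho>)) ts @ map (\<lambda>\<rho>. trunc j (snd \<rho>)) (\<rho> # acc))"
      by (rule L.lindep_cong_mset) simp
    finally have "vindep
        (map (\<lambda>t. trunc j (snd (?e t))) ts @ map (\<lambda>\<rho>. trunc j (snd \<rho>)) (\<rho> # acc))"
      by (rule L.lspan_map_shear(2)[rotated 2, where v = "trunc j (snd \<rho>)"])
        (use trunc_eliminate ok in blast, simp)
    then show ?thesis by (simp add: o_def)
  qed
  moreover have "snd \<rho>' (c * Suc r + j) = 0"
    if \<rho>': "\<rho>' \<in> set (map ?e ts) \<union> set (\<rho> # acc)" and "c \<in> ?C" "j \<le> r" for \<rho>' c j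
  proof -
    have "snd t (c * Suc r + j) = 0" if "t \<in> set (\<rho> # ts) \<union> set acc" for t
      using inv that \<open>c \<in> ?C\<close> \<open>j \<le> r\<close> unfolding reduce_inv_def by blast
    note z = this
    consider "\<rho>' \<in> set (\<rho> # ts) \<union> set acc" | t where "t \<in> set ts" "\<rho>' = ?e t" using \<rho>' by auto
    then show ?thesis
    proof cases
      case 1
      then show ?thesis by (rule z)
    next
      case 2
      then show ?thesis using z[of t] z[of \<rho>] by (simp add: eliminate_def del: mult_Suc_right)
    qed
  qed
  moreover have "\<exists>Q. echelon Q (map (\<lambda>\<rho>. trunc i (snd \<rho>)) (\<rho> # acc)) \<and>
        (\<forall>\<rho>'\<in>set (map ?e ts). \<forall>q\<in>Q. trunc i (snd \<rho>') q = 0)"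
  proof -
    obtain Q where Q: "echelon Q (map (\<lambda>\<rho>. trunc i (snd \<rho>)) acc)"
        "\<forall>\<rho>'\<in>set (\<rho> # ts). \<forall>q\<in>Q. trunc i (snd \<rho>') q = 0"
      using inv unfolding reduce_inv_def by blast
    have "echelon (insert q Q) (trunc i (snd \<rho>) # map (\<lambda>\<rho>. trunc i (snd \<rho>)) acc)"
      by (rule echelon_Cons[OF Q(1), where u = "inverse (snd \<rho> q)"]) (use Q(2) qi in \<open>auto simp: trunc_def\<close>)
    moreover have "trunc i (snd (?e t)) p = 0" if "t \<in> set ts" "p \<in> insert q Q" for t p
    proof -
      have "trunc i (snd (?e t)) p = trunc i (snd t) p - snd t q * inverse (snd \<rho> q) * trunc i (snd \<rho>) p"
        using fun_cong[OF trunc_eliminate[OF ok(2)[OF that(1)] ok(1)], of i q p] by simp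
      moreover have "trunc i (snd \<rho>) p = 0 \<and> trunc i (snd t) p = 0" if "p \<in> Q"
        using Q(2) that \<open>t \<in> set ts\<close> by simp
      ultimately show ?thesis using that(2) qi by (auto simp: trunc_def[of i _ q])
    qed
    ultimately show ?thesis by auto
  qed
  moreover have "\<forall>\<rho>'\<in>set (map ?e ts) \<union> set (\<rho> # acc) \<union> fst ` set don. row_ok n (k * Suc r) \<rho>'"
  proof -
    have "row_ok n (k * Suc r) \<rho>'" if "\<rho>' \<in> set (\<rho> # acc) \<union> fst ` set don" for \<rho>'
      using inv that unfolding reduce_inv_def list.set(2) by blast
    moreover have "row_ok n (k * Suc r) \<rho>'" if "\<rho>' \<in> set (map ?e ts)" for \<rho>'
      using that row_ok_eliminate unfolding set_map by blast
    ultimately show ?thesis by blast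
  qed
  ultimately show ?thesis using inv unfolding reduce_inv_def by blast
qed

lemma reduce_inv_kernel:
  assumes inv: "reduce_inv n k G i (\<rho> # ts) acc ker don"
    and q: "support (k * Suc r) \<rho> = []"
  shows "reduce_inv n k G 0 (ts @ acc) [] (fst \<rho> # ker) don"
proof -
  have ok: "row_ok n (k * Suc r) \<rho>" using inv by (auto simp: reduce_inv_def)
  have "snd \<rho> t = 0" for t
    using q ok by (cases "t < k * Suc r")
      (auto simp: support_def filter_empty_conv row_ok_def simp del: mult_Suc_right)
  then have "row_val \<rho> = (val_vec (fst \<rho>), 0)"
    by (simp add: row_val_def pencil_def fun_eq_iff)
  then have m: "mset (state_vals (ts @ acc) (fst \<rho> # ker) don) = mset (state_vals ((\<rho> # ts) @ acc) ker don)"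
    by (simp add: state_vals_def)
  have "lspan pair_scale (state_vals (ts @ acc) (fst \<rho> # ker) don) = G"
    using P.lspan_cong_set[OF mset_eq_setD[OF m]] inv by (simp add: reduce_inv_def)
  moreover have "lindep pair_scale (state_vals (ts @ acc) (fst \<rho> # ker) don)"
    using P.lindep_cong_mset[OF m] inv by (simp add: reduce_inv_def)
  ultimately show ?thesis
    using inv ok unfolding reduce_inv_def
    by (auto simp: echelon_Nil row_ok_def intro!: exI[of _ "{}"])
qed

text \<open>The pivot entry is a nonzero scalar times \<open>gen i\<close>, hence a unit. The active
  rows become zero in the new column and stay zero in the old pivot columns, because the pivot row
  is zero there. Rows already finished are left alone: they may be nonzero in the new column, which
  the triangular shape in \<open>echelon_Cons\<close> allows.\<close>

lemma reduce_inv_clear: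
  assumes inv: "reduce_inv n k G i (\<rho> # ts) acc ker don"
    and i: "outside i (k * Suc r) \<rho> = []" and q: "support (k * Suc r) \<rho> = q # qs"
  shows "reduce_inv n k G 0 (map (clear n (k * Suc r) q \<rho>) (ts @ acc)) [] ker ((\<rho>, q) # don)"
proof -
  let ?e = "clear n (k * Suc r) q \<rho>" and ?C = "pivot_cols don" and ?c = "q div Suc r"
  have "q \<in> set (support (k * Suc r) \<rho>)" unfolding q by simp
  then have q0: "snd \<rho> q \<noteq> 0" and qd: "q < k * Suc r" by (auto simp: support_def)
  have ok: "row_ok n (k * Suc r) \<rho>" "\<And>t. t \<in> set (ts @ acc) \<Longrightarrow> row_ok n (k * Suc r) t"
    using inv by (auto simp: reduce_inv_def)
  have single: "snd \<rho> t = 0" if "t mod Suc r \<noteq> i" for t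
    using i ok(1) that by (cases "t < k * Suc r")
      (auto simp: outside_def filter_empty_conv row_ok_def simp del: mult_Suc_right)
  have qi: "q mod Suc r = i" using single q0 by blast
  have ir: "i \<le> r" unfolding qi[symmetric] by (simp flip: less_Suc_eq_le)
  have qc: "?c * Suc r + i = q" by (simp add: qi[symmetric] del: mult_Suc_right)
  have ck: "?c < k" using qd by (simp add: less_mult_imp_div_less del: mult_Suc_right)
  have zero: "snd t (c * Suc r + j) = 0" if "t \<in> set (\<rho> # ts @ acc)" "c \<in> ?C" "j \<le> r" for t c j
    using inv that unfolding reduce_inv_def by auto
  have shear: "\<exists>a. row_val (?e t) = row_val t - pair_scale a (row_val \<rho>)" if "t \<in> set (ts @ acc)" for t
    by (rule row_val_clear[OF ok(2)[OF that] ok(1)]) (use single qi in blast)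
  let ?X = "row_val \<rho> # state_vals [] ker don"
  have in_tail: "row_val \<rho> \<in> set ?X" by simp
  have m: "mset (state_vals (map ?e (ts @ acc) @ []) ker ((\<rho>, q) # don)) = mset (map (\<lambda>t. row_val (?e t)) (ts @ acc) @ ?X)"
      "mset (state_vals ((\<rho> # ts) @ acc) ker don) = mset (map row_val (ts @ acc) @ ?X)"
    by (simp_all add: state_vals_def o_def)
  have old: "lspan pair_scale (state_vals ((\<rho> # ts) @ acc) ker don) = G"
      "lindep pair_scale (state_vals ((\<rho> # ts) @ acc) ker don)"
    using inv unfolding reduce_inv_def by blast+
  have "lspan pair_scale (map (\<lambda>t. row_val (?e t)) (ts @ acc) @ ?X) =
      lspan pair_scale (map row_val (ts @ acc) @ ?X)"
    by (rule P.lspan_map_shear(1)[OF _ in_tail]) (rule shear)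
  then have "lspan pair_scale (state_vals (map ?e (ts @ acc) @ []) ker ((\<rho>, q) # don)) = G"
    unfolding P.lspan_cong_set[OF mset_eq_setD[OF m(1)]]
    by (simp only: P.lspan_cong_set[OF mset_eq_setD[OF m(2)], symmetric] old)
  moreover have "lindep pair_scale (state_vals (map ?e (ts @ acc) @ []) ker ((\<rho>, q) # don))"
    unfolding P.lindep_cong_mset[OF m(1)]
  proof (rule P.lspan_map_shear(2)[OF _ in_tail])
    show "lindep pair_scale (map row_val (ts @ acc) @ ?X)"
      using old(2) unfolding P.lindep_cong_mset[OF m(2)] .
  qed (rule shear)
  moreover have "echelon (pivot_cols ((\<rho>, q) # don)) (map (\<lambda>z. pencil (snd (fst z))) ((\<rho>, q) # don))"
  proof -
    have e: "echelon ?C (map (\<lambda>z. pencil (snd (fst z))) don)"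
      using inv by (simp add: reduce_inv_def)
    have p: "pencil (snd \<rho>) c = Poly_Mapping.single (gen i) (snd \<rho> (c * Suc r + i))" for c
      by (rule pencil_single[OF ir single])
    have "echelon (insert ?c ?C) (pencil (snd \<rho>) # map (\<lambda>z. pencil (snd (fst z))) don)"
    proof (rule echelon_Cons[OF e, where u = "Poly_Mapping.single (- gen i) (inverse (snd \<rho> q))"])
      show "pencil (snd \<rho>) c = 0" if "c \<in> ?C" for c
        unfolding p using zero[OF _ that ir, of \<rho>] by simp
    qed (use q0 qc in \<open>simp_all add: p mult_single del: mult_Suc_right\<close>)
    then show ?thesis by (simp add: pivot_cols_def)
  qed
  moreover have "snd \<rho>' (c * Suc r + j) = 0"
    if t: "\<rho>' \<in> set (map ?e (ts @ acc)) \<union> set []" and c: "c \<in> pivot_cols ((\<rho>, q) # don)" and j: "j \<le> r" for \<rho>' c j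
  proof -
    obtain t where t: "t \<in> set (ts @ acc)" "\<rho>' = ?e t" using t by auto
    have cj: "(c * Suc r + j) div Suc r = c" "(c * Suc r + j) mod Suc r = j"
      using j by (simp_all add: div_add1_eq del: mult_Suc_right)
    consider "c = ?c" | "c \<in> ?C" using c by (auto simp: pivot_cols_def)
    then show ?thesis
    proof cases
      case 1
      then show ?thesis using q0 qc cj qi by (simp add: t(2) clear_def del: mult_Suc_right)
    next
      case 2
      then show ?thesis using zero[OF _ 2, of t j] zero[OF _ 2, of \<rho> i] t j ir cj qi
        by (simp add: clear_def del: mult_Suc_right)
    qed
  qed
  moreover have "\<forall>\<rho>'\<in>set (map ?e (ts @ acc)) \<union> set [] \<union> fst ` set ((\<rho>, q) # don). row_ok n (k * Suc r) \<rho>'"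
  proof -
    have "row_ok n (k * Suc r) \<rho>'" if "\<rho>' \<in> fst ` set don" for \<rho>'
      using inv that unfolding reduce_inv_def by blast
    moreover have "row_ok n (k * Suc r) \<rho>'" if "\<rho>' \<in> set (map ?e (ts @ acc))" for \<rho>'
      using that row_ok_clear unfolding set_map by blast
    moreover have "fst ` set ((\<rho>, q) # don) = insert \<rho> (fst ` set don)" by simp
    ultimately show ?thesis using ok(1) by (metis UnE empty_iff insertE list.set(1))
  qed
  moreover have "\<forall>c\<in>pivot_cols ((\<rho>, q) # don). c < k"
    using inv ck by (auto simp: reduce_inv_def pivot_cols_def)
  moreover have "\<exists>Q. echelon Q (map (\<lambda>\<rho>. trunc 0 (snd \<rho>)) []) \<and>
        (\<forall>\<rho>'\<in>set (map ?e (ts @ acc)). \<forall>q\<in>Q. trunc 0 (snd \<rho>') q = 0)"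
    by (intro exI[of _ "{}"]) (simp add: echelon_Nil)
  ultimately show ?thesis using inv unfolding reduce_inv_def by blast
qed

definition reduce_measure :: "nat \<Rightarrow> 'k state \<Rightarrow> nat" where
  "reduce_measure N = (\<lambda>(i, todo, acc, ker, don).
     (length todo + length acc) * ((r + 2) * Suc N) + (Suc r - i) * Suc N + length todo)"

definition reduce_inv' where
  "reduce_inv' n k G N = (\<lambda>(i, todo, acc, ker, don).
     reduce_inv n k G i todo acc ker don \<and> length todo + length acc \<le> N)"

lemma reduce_step_inv:
  assumes "reduce_inv' n k G N st"
  shows "reduce_inv' n k G N (reduce_step n (k * Suc r) st)"
    and "fst st \<le> r \<Longrightarrow> reduce_measure N (reduce_step n (k * Suc r) st) < reduce_measure N st"
proof -
  obtain i todo acc ker don where st: "st = (i, todo, acc, ker, don)" by (cases st) auto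
  have inv: "reduce_inv n k G i todo acc ker don" and N: "length todo + length acc \<le> N"
    using assms by (auto simp: st reduce_inv'_def)
  have "reduce_inv' n k G N (reduce_step n (k * Suc r) st) \<and>
    (i \<le> r \<longrightarrow> reduce_measure N (reduce_step n (k * Suc r) st) < reduce_measure N st)"
  proof (cases "i \<le> r")
    case False
    then show ?thesis using assms by (simp add: st reduce_step_simps)
  next
    case i: True
    have restart: "A * ((r + 2) * Suc N) + Suc r * Suc N + A <
        (Suc A) * ((r + 2) * Suc N) + (Suc r - i) * Suc N + t" if "A \<le> N" for A t
    proof -
      have "Suc r * Suc N + A < (r + 2) * Suc N" using that by (simp add: algebra_simps)
      then show ?thesis by simp
    qed
    show ?thesis
    proof (cases todo)
      case Nil
      have "(Suc r - i) * Suc N = (Suc r - Suc i) * Suc N + Suc N"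
        using i by (simp add: Suc_diff_le)
      then show ?thesis using reduce_inv_next[OF inv[unfolded Nil]] N
        by (simp add: st Nil reduce_step_simps(2)[OF i] reduce_inv'_def reduce_measure_def
            del: mult_Suc_right mult_Suc)
    next
      case todo: (Cons \<rho> ts)
      show ?thesis
      proof (cases "outside i (k * Suc r) \<rho>")
        case (Cons q qs)
        from reduce_inv_eliminate[OF inv[unfolded todo] this] show ?thesis using N i
          by (simp add: st todo reduce_step_simps(3)[OF i Cons] reduce_inv'_def reduce_measure_def
              del: mult_Suc_right mult_Suc)
      next
        case out: Nil
        show ?thesis
        proof (cases "support (k * Suc r) \<rho>")
          case Nil
          from reduce_inv_kernel[OF inv[unfolded todo] this] show ?thesis
            using N restart[of "length ts + length acc" "Suc (length ts)"]
            by (simp add: st todo reduce_step_simps(4)[OF i out Nil] reduce_inv'_def reduce_measure_def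
                del: mult_Suc_right mult_Suc)
        next
          case (Cons q qs)
          from reduce_inv_clear[OF inv[unfolded todo] out this] show ?thesis
            using N restart[of "length ts + length acc" "Suc (length ts)"]
            by (simp add: st todo reduce_step_simps(5)[OF i out Cons] reduce_inv'_def reduce_measure_def
                del: mult_Suc_right mult_Suc)
        qed
      qed
    qed
  qed
  then show "reduce_inv' n k G N (reduce_step n (k * Suc r) st)"
    and "fst st \<le> r \<Longrightarrow> reduce_measure N (reduce_step n (k * Suc r) st) < reduce_measure N st"
    by (simp_all add: st)
qed

lemma reduce_iterate:
  assumes "reduce_inv' n k G N st"
  shows "reduce_inv' n k G N ((reduce_step n (k * Suc r) ^^ t) st) \<and>
    (fst ((reduce_step n (k * Suc r) ^^ t) st) \<le> r \<longrightarrow>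
     reduce_measure N ((reduce_step n (k * Suc r) ^^ t) st) + t \<le> reduce_measure N st)"
proof (induction t)
  case 0
  then show ?case using assms by simp
next
  case (Suc t)
  let ?s = "(reduce_step n (k * Suc r) ^^ t) st"
  have "fst ?s \<le> r" if "fst (reduce_step n (k * Suc r) ?s) \<le> r"
  proof (rule ccontr)
    assume "\<not> fst ?s \<le> r"
    then have "reduce_step n (k * Suc r) ?s = ?s" by (cases ?s) (simp add: reduce_step_simps)
    then show False using that \<open>\<not> fst ?s \<le> r\<close> by simp
  qed
  then show ?case using Suc reduce_step_inv[of n k G N ?s] by (simp del: mult_Suc_right) linarith
qed

lemma reduce_inv_reduce:
  assumes ok: "\<forall>\<rho>\<in>set rows. row_ok n (k * Suc r) \<rho>" and dep: "lindep pair_scale (map row_val rows)"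
    and red: "reduce n (k * Suc r) rows = (i, todo, acc, ker, don)"
  shows "reduce_inv n k (lspan pair_scale (map row_val rows)) i todo acc ker don" "r < i"
proof -
  let ?G = "lspan pair_scale (map row_val rows)" and ?N = "length rows"
  let ?T = "Suc (length rows) * (r + 2) * Suc (length rows)"
  have "reduce_inv n k ?G 0 rows [] [] []"
    using ok dep unfolding reduce_inv_def
    by (auto simp: state_vals_def pivot_cols_def echelon_Nil intro!: exI[of _ "{}"])
  then have "reduce_inv' n k ?G ?N (0, rows, [], [], [])" by (simp add: reduce_inv'_def)
  note it = reduce_iterate[OF this, of ?T, folded reduce_def, unfolded red]
  show "reduce_inv n k ?G i todo acc ker don" using it by (simp add: reduce_inv'_def)
  show "r < i"
  proof (rule ccontr)
    assume "\<not> r < i"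
    then have "?T \<le> reduce_measure ?N (0, rows, [], [], [] :: ('a row \<times> nat) list)"
      using it by simp
    also have "\<dots> < ?T" by (simp add: reduce_measure_def algebra_simps)
    finally show False by simp
  qed
qed

text \<open>At the end the active rows form a reduced pencil and vanish in the pivot columns, so
  together with the finished rows they have independent second components. Elements of
  \<open>G\<close> with second component zero therefore come from \<open>ker\<close> alone, and the
  second components are a basis of the image.\<close>

theorem reduce_correct:
  fixes rows :: "'k::field row list"
  assumes ok: "\<forall>\<rho>\<in>set rows. row_ok n (k * Suc r) \<rho>" and dep: "lindep pair_scale (map row_val rows)"
    and red: "reduce n (k * Suc r) rows = (i, todo, acc, ker, don)"
  defines "G \<equiv> lspan pair_scale (map row_val rows)"
  shows "\<forall>p\<in>set ker. \<forall>i\<ge>n. p i = []"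
    and "vindep (map val_vec ker)"
    and "vspan (map val_vec ker) = {p. (p, 0) \<in> G}"
    and "\<exists>ys. vindep ys \<and> vspan ys = snd ` G"
    and "(\<forall>c<k. c \<in> pivot_cols don) \<longleftrightarrow> {y. \<forall>c\<ge>k. y c = 0} \<subseteq> snd ` G"
proof -
  define act where "act = todo @ acc"
  let ?C = "pivot_cols don" and ?kers = "map (\<lambda>p. (val_vec p, 0)) ker :: ((nat \<Rightarrow> 'f \<Rightarrow>\<^sub>0 'k) \<times> (nat \<Rightarrow> 'f \<Rightarrow>\<^sub>0 'k)) list"
  let ?rest = "map row_val act @ map (\<lambda>z. row_val (fst z)) don"
  let ?A = "map pencil (map snd act)" and ?D = "map (\<lambda>z. pencil (snd (fst z))) don"
  have inv: "reduce_inv n k G i todo acc ker don" and i: "r < i"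
    using reduce_inv_reduce[OF ok dep red] by (simp_all add: G_def)
  have okr: "row_ok n (k * Suc r) \<rho>" if "\<rho> \<in> set act \<union> fst ` set don" for \<rho>
    using inv that unfolding reduce_inv_def act_def by auto
  have perm: "mset (state_vals act ker don) = mset (?kers @ ?rest)" by (simp add: state_vals_def)
  have G: "G = lspan pair_scale (?kers @ ?rest)"
    using inv P.lspan_cong_set[OF mset_eq_setD[OF perm]] by (simp add: reduce_inv_def act_def)
  have depG: "lindep pair_scale (?kers @ ?rest)"
    using inv P.lindep_cong_mset[OF perm] by (simp add: reduce_inv_def act_def)
  have rp: "reduced_pencil (map snd act)"
    using inv i unfolding reduced_pencil_def reduce_inv_def act_def by (simp add: o_def)
  have ech: "echelon ?C ?D" using inv by (simp add: reduce_inv_def)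
  have van: "v c = 0" if v: "v \<in> set ?A" and "c \<in> ?C" for v c
  proof -
    obtain \<rho> where \<rho>: "\<rho> \<in> set todo \<union> set acc" "v = pencil (snd \<rho>)"
      using v by (auto simp: act_def)
    have "snd \<rho> (c * Suc r + j) = 0" if "j \<le> r" for j
      using inv \<rho>(1) \<open>c \<in> ?C\<close> that unfolding reduce_inv_def by blast
    then show ?thesis by (simp add: \<rho>(2) pencil_def del: mult_Suc_right)
  qed
  have depY: "vindep (?A @ ?D)"
    by (rule lindep_append_echelon[OF lindep_reduced_pencil[OF rp] ech]) (rule van)
  have snd_rest: "map snd ?rest = ?A @ ?D" by (simp add: row_val_def o_def)
  have snd_kers: "snd z = 0" if "z \<in> lspan pair_scale ?kers" for z
  proof -
    have "lspan pair_scale ?kers \<subseteq> {z. snd z = 0}"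
      by (rule P.lspan_least) (auto simp: submod_def pair_scale_def L.s_zero_right)
    then show ?thesis using that by blast
  qed
  have sndG: "snd ` G = vspan (?A @ ?D)"
  proof -
    have "snd ` G = snd ` lspan pair_scale ?rest"
    proof (intro equalityI subsetI)
      fix y
      assume "y \<in> snd ` G"
      then obtain u w where "u \<in> lspan pair_scale ?kers" "w \<in> lspan pair_scale ?rest" "y = snd (u + w)"
        unfolding G P.lspan_append by blast
      then show "y \<in> snd ` lspan pair_scale ?rest" using snd_kers[of u] by auto
    next
      fix y
      assume "y \<in> snd ` lspan pair_scale ?rest"
      then obtain w where w: "w \<in> lspan pair_scale ?rest" "y = snd w" by blast
      have "w \<in> G"
        unfolding G by (rule subsetD[OF P.lspan_mono w(1)]) simp
      then show "y \<in> snd ` G" using w(2) by blast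
    qed
    then show ?thesis by (simp only: snd_map.lspan_map[symmetric] snd_rest)
  qed
  show "\<forall>p\<in>set ker. \<forall>i\<ge>n. p i = []" using inv by (simp add: reduce_inv_def)
  have "lindep pair_scale ?kers" by (rule P.lindep_appendD1[OF depG])
  then have "vindep (map fst ?kers)"
    by (rule fst_map.lindep_mapI) (use snd_kers in \<open>simp add: prod_eq_iff\<close>)
  then show "vindep (map val_vec ker)" by (simp add: o_def)
  have fst_kers: "vspan (map val_vec ker) = fst ` lspan pair_scale ?kers"
    using fst_map.lspan_map[of ?kers] by (simp add: o_def)
  show "vspan (map val_vec ker) = {p. (p, 0) \<in> G}"
  proof (intro equalityI subsetI)
    fix p
    assume "p \<in> vspan (map val_vec ker)"
    then obtain z where z: "z \<in> lspan pair_scale ?kers" "p = fst z" using fst_kers by blast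
    then have "(p, 0) = z" using snd_kers[of z] by (simp add: prod_eq_iff)
    moreover have "z \<in> G"
      unfolding G by (rule subsetD[OF P.lspan_mono z(1)]) simp
    ultimately have "(p, 0) \<in> G" by simp
    then show "p \<in> {p. (p, 0) \<in> G}" by simp
  next
    fix p
    assume "p \<in> {p. (p, 0) \<in> G}"
    then obtain u w where uw: "u \<in> lspan pair_scale ?kers" "w \<in> lspan pair_scale ?rest" "(p, 0) = u + w"
      unfolding G P.lspan_append by blast
    have "snd w = 0" using snd_kers[OF uw(1)] arg_cong[OF uw(3), of snd] by simp
    then have "w = 0"
      using snd_map.lindep_map_kernel[of ?rest w] uw(2) depY by (simp only: snd_rest)
    then have "p = fst u" using arg_cong[OF uw(3), of fst] by simp
    then show "p \<in> vspan (map val_vec ker)" using uw(1) fst_kers by blast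
  qed
  show "\<exists>ys. vindep ys \<and> vspan ys = snd ` G"
    using depY sndG by blast
  show "(\<forall>c<k. c \<in> ?C) \<longleftrightarrow> {y. \<forall>c\<ge>k. y c = 0} \<subseteq> snd ` G"
  proof
    assume C: "\<forall>c<k. c \<in> ?C"
    show "{y. \<forall>c\<ge>k. y c = 0} \<subseteq> snd ` G"
    proof
      fix z :: "nat \<Rightarrow> 'f \<Rightarrow>\<^sub>0 'k"
      assume "z \<in> {y. \<forall>c\<ge>k. y c = 0}"
      then have z: "z c = 0" if "c \<ge> k" for c using that by simp
      obtain y where y: "y \<in> vspan ?D" "\<forall>q\<in>?C. y q = z q"
        using ech unfolding echelon_def by blast
      have "y c = 0" if c: "c \<ge> k" for c
      proof -
        have van_ge: "v c = 0" if v: "v \<in> set ?D" for v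
        proof -
          obtain \<rho> where \<rho>: "\<rho> \<in> fst ` set don" and v_eq: "v = pencil (snd \<rho>)"
            using v unfolding set_map by blast
          have "k * Suc r \<le> c * Suc r" using c by (rule mult_le_mono1)
          then have "snd \<rho> (c * Suc r + j) = 0" for j
            using okr[of \<rho>] \<rho> unfolding row_ok_def by simp
          then show ?thesis by (simp add: v_eq pencil_def)
        qed
        have "vspan ?D \<subseteq> {y. y c = 0}"
        proof (rule L.lspan_least)
          show "set ?D \<subseteq> {y. y c = 0}" using van_ge by blast
        qed (simp add: submod_def)
        then show ?thesis using y(1) by blast
      qed
      then have "y c = z c" for c
        using y(2) z[of c] C by (cases "c < k") auto
      then have "y = z" by (rule ext)
      then have "z \<in> vspan (?A @ ?D)"
        using subsetD[OF L.lspan_mono y(1), of "?A @ ?D"] by simp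
      then show "z \<in> snd ` G" using sndG by blast
    qed
  next
    assume sub: "{y. \<forall>c\<ge>k. y c = 0} \<subseteq> snd ` G"
    show "\<forall>c<k. c \<in> ?C"
    proof (intro allI impI, rule ccontr)
      fix c
      assume c: "c < k" "c \<notin> ?C"
      \<comment> \<open>The unit vector of a missing column refutes surjectivity. It vanishes in the
        pivot columns, which forces the contribution of the finished rows to be zero; it would then
        be a nonzero constant in the span of a reduced pencil.\<close>
      define e :: "nat \<Rightarrow> 'f \<Rightarrow>\<^sub>0 'k" where "e = (\<lambda>t. if t = c then 1 else 0)"
      have "e \<in> snd ` G" by (rule subsetD[OF sub]) (use c in \<open>auto simp: e_def\<close>)
      then obtain u w where uw: "u \<in> vspan ?A" "w \<in> vspan ?D" "e = u + w"
        unfolding sndG L.lspan_append by blast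
      have "u q = 0" if "q \<in> ?C" for q
      proof -
        have "vspan ?A \<subseteq> {u. u q = 0}"
          by (rule L.lspan_least) (use van that in \<open>auto simp: submod_def\<close>)
        then show ?thesis using uw(1) by blast
      qed
      then have "w q = 0" if "q \<in> ?C" for q
        using fun_cong[OF uw(3), of q] that c(2) by (auto simp: e_def split: if_splits)
      then have "w = 0" using ech uw(2) unfolding echelon_def by blast
      then have "e \<in> vspan ?A" using uw by simp
      then have "e = 0"
        by (rule reduced_pencil_constant[OF rp]) (auto simp: e_def lookup_one when_def split: if_splits)
      then have "e c = 0" by simp
      then show False by (simp add: e_def)
    qed
  qed
qed

end

section \<open>Kernels of matrices over the free group algebra\<close>

definition unit_vec :: "nat \<Rightarrow> nat \<Rightarrow> 'a::ring_1" where
  "unit_vec t = (\<lambda>i. if i = t then 1 else 0)"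

lemma sum_unit_vec:
  fixes a :: "nat \<Rightarrow> 'a::ring_1"
  shows "(\<Sum>t<n. lscale (a t) (unit_vec t)) = (\<lambda>i. if i < n then a i else 0)"
proof
  fix i
  have "(\<Sum>t<n. lscale (a t) (unit_vec t)) i = (\<Sum>t<n. if t = i then a t else 0)"
    unfolding sum_fun_apply by (rule sum.cong) (auto simp: unit_vec_def)
  then show "(\<Sum>t<n. lscale (a t) (unit_vec t)) i = (if i < n then a i else 0)"
    by simp
qed

lemma lindep_unit_vec: "vindep (map unit_vec [0..<n])"
  unfolding L.lindep_iff_sum by (auto simp: sum_unit_vec fun_eq_iff)

section \<open>Linearization of a matrix by additional columns\<close>

type_synonym instr = "nat \<times> nat \<times> nat \<times> bool"

text \<open>An instruction \<open>(t, t', l)\<close> introduces a new column \<open>t\<close> that stands for the letter \<open>l\<close>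
  times column \<open>t'\<close>. The matrix is made linear by giving every suffix of every word its own
  column. An entry \<open>(l, t, a)\<close> of a linear matrix is the scalar \<open>a\<close> in row \<open>l\<close> and column \<open>t\<close>.\<close>

definition add_letter :: "nat \<Rightarrow> nat \<times> bool \<Rightarrow> instr list \<times> nat \<Rightarrow> instr list \<times> nat" where
  "add_letter m l z = ((m + length (fst z), snd z, l) # fst z, m + length (fst z))"

text \<open>Letters are taken from the right: prefixing a letter is a left multiplication, so the
  intermediate columns stand for suffixes.\<close>

definition add_word :: "nat \<Rightarrow> (nat \<times> bool) list \<Rightarrow> instr list \<times> nat \<Rightarrow> instr list \<times> nat" where
  "add_word m w z = fold (add_letter m) (rev w) z"

definition add_term ::
  "nat \<Rightarrow> nat \<times> nat \<times> 'k \<times> (nat \<times> bool) list \<Rightarrow> instr list \<times> (nat \<times> nat \<times> 'k) list \<Rightarrow>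
     instr list \<times> (nat \<times> nat \<times> 'k) list" where
  "add_term m u z =
     (fst (add_word m (snd (snd (snd u))) (fst z, fst (snd u))),
      (fst u, snd (add_word m (snd (snd (snd u))) (fst z, fst (snd u))), fst (snd (snd u))) # snd z)"

definition matrix_terms ::
  "nat \<Rightarrow> 'k fvec list \<Rightarrow> (nat \<times> nat \<times> 'k \<times> (nat \<times> bool) list) list" where
  "matrix_terms m Es = concat (map (\<lambda>l. concat (map (\<lambda>c.
     map (\<lambda>t. (l, c, t)) (nth_default (\<lambda>_. []) Es l c)) [0..<m])) [0..<length Es])"

definition linearize :: "nat \<Rightarrow> 'k fvec list \<Rightarrow> instr list \<times> (nat \<times> nat \<times> 'k) list" where
  "linearize m Es = fold (add_term m) (matrix_terms m Es) ([], [])"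

context free_group
begin

text \<open>After linearization the words are hidden in the columns, so the row has scalar entries
  only and just the positions with remainder 0 are filled. The label marks row \<open>l\<close> of
  the original matrix.\<close>

definition entry_row :: "nat \<Rightarrow> nat \<Rightarrow> (nat \<times> nat \<times> 'k::field) list \<Rightarrow> nat \<Rightarrow> 'k row" where
  "entry_row n d tms l =
     (\<lambda>i. if i < n then if i = l then [(1, [])] else [] else [],
      \<lambda>q. if q < d then
        if q mod Suc r = 0
        then fold (\<lambda>u s. (if fst u = l \<and> fst (snd u) = q div Suc r then snd (snd u) else 0) + s) tms 0
        else 0
      else 0)"

text \<open>The defining equation of a new column \<open>t\<close> as a row with zero label. For a
  letter x_i it reads t - x_i t'. For an inverse letter the equation is multiplied by x_i and reads
  x_i t - t', because a pencil has no inverse generators.\<close>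

definition instr_row :: "nat \<Rightarrow> instr \<Rightarrow> 'k::field row" where
  "instr_row d u =
     (\<lambda>_. [],
      \<lambda>q. if q < d then
        (if q = fst u * Suc r + (if snd (snd (snd u)) then 0 else Suc (fst (snd (snd u)))) then 1 else 0) -
        (if q = fst (snd u) * Suc r + (if snd (snd (snd u)) then Suc (fst (snd (snd u))) else 0) then 1 else 0)
      else 0)"

definition num_cols :: "nat \<Rightarrow> 'k fvec list \<Rightarrow> nat" where
  "num_cols m Es = m + length (fst (linearize m Es))"

definition linear_rows :: "nat \<Rightarrow> 'k::field fvec list \<Rightarrow> 'k row list" where
  "linear_rows m Es =
     map (entry_row (length Es) (num_cols m Es * Suc r) (snd (linearize m Es))) [0..<length Es] @
     map (instr_row (num_cols m Es * Suc r)) (fst (linearize m Es))"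

definition reduced_state :: "nat \<Rightarrow> 'k::field fvec list \<Rightarrow> 'k state" where
  "reduced_state m Es = reduce (length Es) (num_cols m Es * Suc r) (linear_rows m Es)"

definition kernel :: "nat \<Rightarrow> 'k::field fvec list \<Rightarrow> 'k fvec list" where
  "kernel m Es = fst (snd (snd (snd (reduced_state m Es))))"

definition spanning :: "nat \<Rightarrow> 'k::field fvec list \<Rightarrow> bool" where
  "spanning m Es \<longleftrightarrow> (\<forall>c<num_cols m Es. c \<in> pivot_cols (snd (snd (snd (snd (reduced_state m Es))))))"

text \<open>The newest instruction comes first, and new columns are numbered consecutively from
  \<open>m\<close>, so the length of the list gives the next free number.\<close>

primrec wf_instrs :: "nat \<Rightarrow> instr list \<Rightarrow> bool" where
  "wf_instrs m [] \<longleftrightarrow> True"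
| "wf_instrs m (u # us) \<longleftrightarrow>
     wf_instrs m us \<and> fst u = m + length us \<and> fst (snd u) < m + length us \<and> fst (snd (snd u)) < r"

text \<open>The vector over the original columns that column \<open>t\<close> stands for.\<close>

primrec col_val :: "instr list \<Rightarrow> nat \<Rightarrow> nat \<Rightarrow> 'f \<Rightarrow>\<^sub>0 'k::field" where
  "col_val [] = unit_vec"
| "col_val (u # us) = (col_val us)(fst u :=
     lscale (Poly_Mapping.single (letter_val x (snd (snd u))) 1) (col_val us (fst (snd u))))"

lemma add_word_correct:
  assumes "wf_instrs m us" "t < m + length us" "w \<in> words r"
  shows "wf_instrs m (fst (add_word m w (us, t))) \<and>
    length us \<le> length (fst (add_word m w (us, t))) \<and>
    snd (add_word m w (us, t)) < m + length (fst (add_word m w (us, t))) \<and>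
    (\<forall>t'<m + length us. col_val (fst (add_word m w (us, t))) t' = (col_val us t' :: nat \<Rightarrow> 'f \<Rightarrow>\<^sub>0 'k::field)) \<and>
    col_val (fst (add_word m w (us, t))) (snd (add_word m w (us, t))) =
      lscale (Poly_Mapping.single (word_val x w) 1) (col_val us t :: nat \<Rightarrow> 'f \<Rightarrow>\<^sub>0 'k)"
  using assms(3)
proof (induction w)
  case Nil
  have "Poly_Mapping.single (word_val x []) (1 :: 'k) = 1" by (simp add: word_val_def)
  then show ?case using assms by (simp add: add_word_def)
next
  case (Cons l w)
  have w: "w \<in> words r" "fst l < r" using Cons.prems by (auto simp: words_def)
  have "add_word m (l # w) (us, t) = add_letter m l (add_word m w (us, t))"
    by (simp add: add_word_def)
  moreover have "lscale (Poly_Mapping.single (letter_val x l) 1)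
      (lscale (Poly_Mapping.single (word_val x w) 1) (col_val us t :: nat \<Rightarrow> 'f \<Rightarrow>\<^sub>0 'k)) =
      lscale (Poly_Mapping.single (word_val x (l # w)) 1) (col_val us t)"
    by (simp add: L.s_assoc mult_single word_val_def)
  ultimately show ?case using Cons.IH[OF w(1)] w(2) by (auto simp: add_letter_def simp del: scale_Left_apply)
qed

definition entry_sum :: "instr list \<Rightarrow> (nat \<times> nat \<times> 'k) list \<Rightarrow> nat \<Rightarrow> nat \<Rightarrow> 'f \<Rightarrow>\<^sub>0 'k::field" where
  "entry_sum us tms l = (\<Sum>u\<leftarrow>tms. if fst u = l
     then lscale (Poly_Mapping.single 0 (snd (snd u))) (col_val us (fst (snd u))) else 0)"

definition term_sum :: "(nat \<times> nat \<times> 'k \<times> (nat \<times> bool) list) list \<Rightarrow> nat \<Rightarrow> nat \<Rightarrow> 'f \<Rightarrow>\<^sub>0 'k::field" where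
  "term_sum ts l = (\<Sum>u\<leftarrow>ts. if fst u = l
     then lscale (Poly_Mapping.single (word_val x (snd (snd (snd u)))) (fst (snd (snd u))))
       (unit_vec (fst (snd u))) else 0)"

lemma col_val_base: "wf_instrs m us \<Longrightarrow> t < m \<Longrightarrow> col_val us t = unit_vec t"
  by (induction us) auto

lemma fold_add_term_correct:
  fixes ts :: "(nat \<times> nat \<times> 'k::field \<times> (nat \<times> bool) list) list"
  assumes "wf_instrs m us" "\<forall>u\<in>set tms. fst (snd u) < m + length us"
    and "\<forall>u\<in>set ts. fst (snd u) < m \<and> snd (snd (snd u)) \<in> words r"
    and "fold (add_term m) ts (us, tms) = (us', tms')"
  shows "wf_instrs m us' \<and> (\<forall>u\<in>set tms'. fst (snd u) < m + length us') \<and>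
    entry_sum us' tms' l = entry_sum us tms l + term_sum ts l"
  using assms
proof (induction ts arbitrary: us tms)
  case Nil
  then show ?case by (simp add: term_sum_def)
next
  case (Cons u ts)
  let ?z = "add_word m (snd (snd (snd u))) (us, fst (snd u))"
  have u: "fst (snd u) < m" "snd (snd (snd u)) \<in> words r" using Cons.prems(3) by auto
  then have "fst (snd u) < m + length us" by simp
  note aw = add_word_correct[where 'k = 'k, OF Cons.prems(1) this u(2)]
  let ?tms = "(fst u, snd ?z, fst (snd (snd u))) # tms"
  have old: "entry_sum (fst ?z) tms l = entry_sum us tms l"
    unfolding entry_sum_def
    by (rule arg_cong[where f = sum_list], rule map_cong[OF refl]) (use aw Cons.prems(2) in auto)
  have E1: "entry_sum (fst ?z) ?tms l = entry_sum us tms l + term_sum [u] l"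
    using aw col_val_base[where 'a = 'k, OF Cons.prems(1) u(1)]
    by (simp add: entry_sum_def term_sum_def L.s_assoc mult_single old[unfolded entry_sum_def])
  have E2: "wf_instrs m us' \<and> (\<forall>u\<in>set tms'. fst (snd u) < m + length us') \<and>
      entry_sum us' tms' l = entry_sum (fst ?z) ?tms l + term_sum ts l"
  proof (rule Cons.IH)
    show "wf_instrs m (fst ?z)" using aw by blast
    show "\<forall>u\<in>set ?tms. fst (snd u) < m + length (fst ?z)" using aw Cons.prems(2) by fastforce
    show "fold (add_term m) ts (fst ?z, ?tms) = (us', tms')"
    proof -
      have "add_term m u (us, tms) = (fst ?z, ?tms)" by (simp add: add_term_def)
      then show ?thesis using Cons.prems(4) by simp
    qed
  qed (use Cons.prems(3) in simp)
  have E3: "term_sum (u # ts) l = (term_sum [u] l + term_sum ts l :: nat \<Rightarrow> 'f \<Rightarrow>\<^sub>0 'k)"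
    by (simp only: term_sum_def list.map sum_list.Cons sum_list.Nil add_0_right)
  have "entry_sum us' tms' l = entry_sum us tms l + term_sum (u # ts) l"
    using E2 unfolding E1 E3 add.assoc by (elim conjE)
  then show ?case using E2 by blast
qed

definition vec_val :: "nat \<Rightarrow> 'k::field fvec \<Rightarrow> nat \<Rightarrow> 'f \<Rightarrow>\<^sub>0 'k" where
  "vec_val m E = (\<lambda>c. if c < m then formal_val (E c) else 0)"

definition good_vec :: "'k fvec \<Rightarrow> bool" where
  "good_vec E \<longleftrightarrow> (\<forall>c. \<forall>t\<in>set (E c). snd t \<in> words r)"

lemma sum_list_concat_map: "sum_list (map f (concat xss)) = (\<Sum>xs\<leftarrow>xss. sum_list (map f xs))"
  by (induction xss) simp_all

lemma linearize_correct:
  fixes Es :: "'k::field fvec list"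
  assumes "\<forall>E\<in>set Es. good_vec E" "linearize m Es = (us, tms)"
  shows "wf_instrs m us" "\<forall>u\<in>set tms. fst (snd u) < m + length us"
    and "l < length Es \<Longrightarrow> entry_sum us tms l = vec_val m (Es ! l)"
proof -
  have ts: "\<forall>u\<in>set (matrix_terms m Es). fst (snd u) < m \<and> snd (snd (snd u)) \<in> words r"
    using assms(1) nth_mem unfolding matrix_terms_def good_vec_def
    by (fastforce simp: nth_default_def)
  note * = fold_add_term_correct[where us = "[]" and tms = "[]", OF _ _ ts assms(2)[unfolded linearize_def]]
  show "wf_instrs m us" "\<forall>u\<in>set tms. fst (snd u) < m + length us" using * by simp_all
  assume l: "l < length Es"
  have "term_sum (matrix_terms m Es) l = vec_val m (Es ! l)"
  proof -
    let ?f = "\<lambda>u. if fst u = l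
     then lscale (Poly_Mapping.single (word_val x (snd (snd (snd u)))) (fst (snd (snd u))))
       (unit_vec (fst (snd u)) :: nat \<Rightarrow> 'f \<Rightarrow>\<^sub>0 'k) else 0"
    have 1: "sum_list (map ?f (map (\<lambda>t. (l', c, t)) ts)) =
        (if l' = l then lscale (formal_val ts) (unit_vec c) else 0)" for l' c and ts :: "'k formal"
      by (induction ts) (auto simp: L.s_add_left)
    have 2: "sum_list (map ?f (concat (map (\<lambda>c. map (\<lambda>t. (l', c, t)) (E c)) [0..<m]))) =
        (if l' = l then vec_val m E else 0)" for l' and E :: "'k fvec"
    proof (cases "l' = l")
      case True
      have "sum_list (map ?f (concat (map (\<lambda>c. map (\<lambda>t. (l', c, t)) (E c)) [0..<m]))) =
          (\<Sum>c<m. lscale (formal_val (E c)) (unit_vec c))"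
        unfolding sum_list_concat_map map_map o_def 1[unfolded map_map o_def]
        by (simp add: True interv_sum_list_conv_sum_set_nat atLeast0LessThan)
      then show ?thesis using True by (simp add: sum_unit_vec vec_val_def)
    next
      case False
      then show ?thesis
        unfolding sum_list_concat_map map_map o_def 1[unfolded map_map o_def] by simp
    qed
    have "term_sum (matrix_terms m Es) l =
        (\<Sum>l'<length Es. if l' = l then vec_val m (nth_default (\<lambda>_. []) Es l') else 0)"
      unfolding term_sum_def matrix_terms_def
      unfolding sum_list_concat_map[of _ "map _ [0..<length Es]"] map_map o_def 2
      by (simp add: interv_sum_list_conv_sum_set_nat atLeast0LessThan)
    then show ?thesis using l by (simp add: sum.delta nth_default_def)
  qed
  then show "entry_sum us tms l = vec_val m (Es ! l)"
    using * by (simp add: entry_sum_def)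
qed

section \<open>Eliminating the additional columns by substitution\<close>

definition instr_val :: "instr \<Rightarrow> nat \<Rightarrow> 'f \<Rightarrow>\<^sub>0 'k::field" where
  "instr_val u = (\<lambda>c.
     (if c = fst u then Poly_Mapping.single (gen (if snd (snd (snd u)) then 0 else Suc (fst (snd (snd u))))) 1 else 0) -
     (if c = fst (snd u) then Poly_Mapping.single (gen (if snd (snd (snd u)) then Suc (fst (snd (snd u))) else 0)) 1 else 0))"

text \<open>Replaces each column by what it stands for. On vectors supported in the available
  columns its kernel is exactly the span of the instruction rows
  (\<open>eval_cols_instr_val\<close>, \<open>diff_eval_cols\<close>), and this makes linearization
  faithful.\<close>

definition eval_cols :: "nat \<Rightarrow> instr list \<Rightarrow> (nat \<Rightarrow> 'f \<Rightarrow>\<^sub>0 'k::field) \<Rightarrow> nat \<Rightarrow> 'f \<Rightarrow>\<^sub>0 'k" where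
  "eval_cols m us y = (\<Sum>t<m + length us. lscale (y t) (col_val us t))"

lemma linear_map_eval_cols: "linear_map (lscale) (lscale) (eval_cols m us)"
  by unfold_locales
    (simp_all add: eval_cols_def L.s_add_left sum.distrib L.s_sum_right L.s_assoc)

lemma pencil_monomial:
  assumes "j \<le> r"
  shows "pencil (\<lambda>q. if q = t * Suc r + j then a else 0) c = (if c = t then Poly_Mapping.single (gen j) a else 0)"
proof -
  have "c * Suc r + j' = t * Suc r + j \<longleftrightarrow> c = t \<and> j' = j" if "j' \<le> r" for j'
  proof
    assume e: "c * Suc r + j' = t * Suc r + j"
    have "c = (c * Suc r + j') div Suc r" "j' = (c * Suc r + j') mod Suc r"
      using that by (simp_all add: div_add1_eq del: mult_Suc_right)
    moreover have "t = (t * Suc r + j) div Suc r" "j = (t * Suc r + j) mod Suc r"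
      using assms by (simp_all add: div_add1_eq del: mult_Suc_right)
    ultimately show "c = t \<and> j' = j" using e by metis
  qed simp
  then have "pencil (\<lambda>q. if q = t * Suc r + j then a else 0) c =
      (\<Sum>j'\<le>r. if j' = j then (if c = t then Poly_Mapping.single (gen j) a else 0) else 0)"
    unfolding pencil_def by (intro sum.cong refl) (simp del: mult_Suc_right)
  then show ?thesis using assms by simp
qed

lemma pencil_diff: "pencil (\<lambda>q. f q - g q) c = pencil f c - pencil g c"
  by (simp add: pencil_def single_diff sum_subtractf del: mult_Suc_right)

lemma col_index_less:
  assumes "t < k" "j \<le> r"
  shows "t * Suc r + j < k * Suc r"
proof -
  have "t * Suc r + j < Suc t * Suc r" using assms by simp
  also have "\<dots> \<le> k * Suc r" using assms by (intro mult_le_mono1) simp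
  finally show ?thesis .
qed

lemma row_val_instr_row:
  assumes "fst u < k" "fst (snd u) < k" "fst (snd (snd u)) < r"
  shows "row_val (instr_row (k * Suc r) u) = (0, instr_val u)"
proof -
  let ?j = "if snd (snd (snd u)) then 0 else Suc (fst (snd (snd u)))"
  let ?j' = "if snd (snd (snd u)) then Suc (fst (snd (snd u))) else 0"
  have j: "?j \<le> r" "?j' \<le> r" using assms by auto
  have b: "snd (instr_row (k * Suc r) u) = (\<lambda>q. (if q = fst u * Suc r + ?j then 1 else 0) -
      (if q = fst (snd u) * Suc r + ?j' then 1 else 0))"
    using col_index_less[OF assms(1) j(1)] col_index_less[OF assms(2) j(2)]
    unfolding instr_row_def snd_conv by (intro ext) (auto simp del: mult_Suc_right)
  have "pencil (snd (instr_row (k * Suc r) u)) = instr_val u"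
    unfolding b by (intro ext) (simp only: pencil_diff pencil_monomial[OF j(1)] pencil_monomial[OF j(2)] instr_val_def)
  then show ?thesis by (simp add: row_val_def instr_row_def zero_fun_def)
qed

lemma wf_instrs_less:
  "wf_instrs m us \<Longrightarrow> u \<in> set us \<Longrightarrow> fst u < m + length us \<and> fst (snd u) < m + length us \<and> fst (snd (snd u)) < r"
  by (induction us) fastforce+

lemma eval_cols_Cons:
  assumes "wf_instrs m (u # us)"
  shows "eval_cols m (u # us) y =
    eval_cols m us y + lscale (y (m + length us)) (col_val (u # us) (m + length us))"
  using assms by (simp add: eval_cols_def)

lemma instr_val_alt:
  "instr_val u = lscale (Poly_Mapping.single (gen (if snd (snd (snd u)) then 0 else Suc (fst (snd (snd u))))) 1) (unit_vec (fst u))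
     - lscale (Poly_Mapping.single (gen (if snd (snd (snd u)) then Suc (fst (snd (snd u))) else 0)) 1) (unit_vec (fst (snd u)))"
  by (auto simp: instr_val_def unit_vec_def fun_eq_iff)

lemma eval_cols_unit_vec:
  "t < m + length us \<Longrightarrow> eval_cols m us (unit_vec t) = col_val us t"
proof -
  assume "t < m + length us"
  moreover have "eval_cols m us (unit_vec t) = (\<Sum>t'<m + length us. if t' = t then col_val us t else 0)"
    unfolding eval_cols_def by (rule sum.cong) (auto simp: unit_vec_def)
  ultimately show ?thesis by simp
qed

lemma eval_cols_instr_val:
  assumes "wf_instrs m us" "u \<in> set us"
  shows "eval_cols m us (instr_val u) = (0 :: nat \<Rightarrow> 'f \<Rightarrow>\<^sub>0 'k::field)"
proof -
  interpret E: linear_map "lscale" "lscale" "eval_cols m us :: (nat \<Rightarrow> 'f \<Rightarrow>\<^sub>0 'k) \<Rightarrow> _"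
    by (rule linear_map_eval_cols)
  have col: "col_val us (fst u) =
      lscale (Poly_Mapping.single (letter_val x (snd (snd u))) 1) (col_val us (fst (snd u)) :: nat \<Rightarrow> 'f \<Rightarrow>\<^sub>0 'k)"
    using assms
  proof (induction us)
    case (Cons v us)
    show ?case
    proof (cases "u \<in> set us")
      case True
      then have "fst u < m + length us" "fst (snd u) < m + length us" "fst v = m + length us"
        using wf_instrs_less[of m us u] Cons.prems by simp_all
      then show ?thesis using Cons True by simp
    next
      case False
      then have "u = v" using Cons.prems by simp
      then show ?thesis using Cons.prems by simp
    qed
  qed simp
  let ?a = "Poly_Mapping.single (gen (if snd (snd (snd u)) then 0 else Suc (fst (snd (snd u))))) (1 :: 'k)"
  let ?b = "Poly_Mapping.single (gen (if snd (snd (snd u)) then Suc (fst (snd (snd u))) else 0)) (1 :: 'k)"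
  have "?a * Poly_Mapping.single (letter_val x (snd (snd u))) 1 = ?b"
    by (simp add: mult_single gen_def letter_val_def)
  then show ?thesis
    using wf_instrs_less[OF assms]
    by (simp add: instr_val_alt E.f_diff E.f_scale eval_cols_unit_vec col L.s_assoc del: scale_Left_apply)
qed

text \<open>Triangularity: the newest instruction has a unit in its own column, where all older ones
  are zero.\<close>

lemma lindep_instr_vals:
  "wf_instrs m us \<Longrightarrow> vindep (map instr_val us :: (nat \<Rightarrow> 'f \<Rightarrow>\<^sub>0 'k::field) list)"
proof (induction us)
  case (Cons u us)
  have van: "instr_val v (fst u) = (0 :: 'f \<Rightarrow>\<^sub>0 'k)" if "v \<in> set us" for v
    using wf_instrs_less[of m us v] Cons.prems that by (simp add: instr_val_def)
  have "a = 0" if "lscale a (instr_val u) \<in> vspan (map instr_val us)"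
    for a :: "'f \<Rightarrow>\<^sub>0 'k"
  proof -
    have "vspan (map instr_val us) \<subseteq> {y. y (fst u) = (0 :: 'f \<Rightarrow>\<^sub>0 'k)}"
      by (rule L.lspan_least) (use van in \<open>auto simp: submod_def\<close>)
    then have 0: "a * instr_val u (fst u) = 0" using that by auto
    let ?g = "gen (if snd (snd (snd u)) then 0 else Suc (fst (snd (snd u))))"
    have "instr_val u (fst u) = Poly_Mapping.single ?g (1 :: 'k)"
      using Cons.prems by (simp add: instr_val_def)
    then have "a * instr_val u (fst u) * Poly_Mapping.single (- ?g) 1 = a"
      by (simp add: mult.assoc mult_single)
    then show ?thesis using 0 by simp
  qed
  moreover have "vindep (map instr_val us :: (nat \<Rightarrow> 'f \<Rightarrow>\<^sub>0 'k) list)"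
    using Cons by (simp del: scale_Left_apply)
  ultimately show ?case unfolding list.map lindep.simps by blast
qed simp

lemma diff_eval_cols:
  fixes y :: "nat \<Rightarrow> 'f \<Rightarrow>\<^sub>0 'k::field"
  assumes "wf_instrs m us" "\<And>t. t \<ge> m + length us \<Longrightarrow> y t = 0"
  shows "y - eval_cols m us y \<in> vspan (map instr_val us) \<and>
    (\<forall>t\<ge>m. eval_cols m us y t = 0)"
  using assms
proof (induction us arbitrary: y)
  case Nil
  have "eval_cols m [] y = y"
    using Nil.prems by (auto simp: eval_cols_def sum_unit_vec fun_eq_iff)
  then show ?case using Nil.prems by (simp add: zero_fun_def)
next
  case (Cons u us)
  interpret E: linear_map "lscale" "lscale" "eval_cols m (u # us) :: (nat \<Rightarrow> 'f \<Rightarrow>\<^sub>0 'k) \<Rightarrow> _"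
    by (rule linear_map_eval_cols)
  let ?T = "m + length us"
  let ?g = "gen (if snd (snd (snd u)) then 0 else Suc (fst (snd (snd u))))"
  \<comment> \<open>Chosen so that subtracting \<open>a\<close> times the newest instruction row
    clears the newest column. Its entry there is the unit at \<open>?g\<close>, inverted by
    \<open>- ?g\<close>.\<close>
  define a where "a = y ?T * Poly_Mapping.single (- ?g) 1"
  define y' where "y' = y - lscale a (instr_val u)"
  have u: "fst u = ?T" "fst (snd u) < ?T" and us: "wf_instrs m us" using Cons.prems(1) by simp_all
  have "a * instr_val u ?T = y ?T"
    using u by (simp add: a_def instr_val_def mult.assoc mult_single)
  then have y': "y' t = 0" if "t \<ge> ?T" for t
    using that u Cons.prems(2)[of t] by (cases "t = ?T") (auto simp: y'_def instr_val_def)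
  have e: "eval_cols m (u # us) y = eval_cols m us y'"
  proof -
    have "eval_cols m (u # us) y = eval_cols m (u # us) y'"
    proof -
      have "eval_cols m (u # us) (instr_val u) = (0 :: nat \<Rightarrow> 'f \<Rightarrow>\<^sub>0 'k)"
        by (rule eval_cols_instr_val[OF Cons.prems(1)]) simp
      then show ?thesis by (simp only: y'_def E.f_diff E.f_scale L.s_zero_right diff_0_right)
    qed
    also have "\<dots> = eval_cols m us y'"
      by (simp only: eval_cols_Cons[OF Cons.prems(1)] y'[OF order_refl] L.s_zero_left add_0_right)
    finally show ?thesis .
  qed
  have "y - eval_cols m (u # us) y = lscale a (instr_val u) + (y' - eval_cols m us y')"
    by (simp add: e y'_def)
  moreover have IH: "y' - eval_cols m us y' \<in> vspan (map instr_val us) \<and>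
      (\<forall>t\<ge>m. eval_cols m us y' t = 0)"
    by (rule Cons.IH[OF us y'])
  ultimately have "y - eval_cols m (u # us) y \<in> vspan (map instr_val (u # us))"
    unfolding list.map by (blast intro: L.lspan_ConsI)
  then show ?case using IH unfolding e by blast
qed

definition entry_vec :: "(nat \<times> nat \<times> 'k) list \<Rightarrow> nat \<Rightarrow> nat \<Rightarrow> 'f \<Rightarrow>\<^sub>0 'k::field" where
  "entry_vec tms l = (\<lambda>c. Poly_Mapping.single 0
     (\<Sum>u\<leftarrow>tms. if fst u = l \<and> fst (snd u) = c then snd (snd u) else 0))"

lemma fold_plus_sum_list: "fold (\<lambda>u s. f u + s) xs s = (\<Sum>u\<leftarrow>xs. f u) + (s :: 'a::comm_monoid_add)"
  by (induction xs arbitrary: s) (simp_all add: ac_simps)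

lemma row_val_entry_row:
  fixes tms :: "(nat \<times> nat \<times> 'k::field) list"
  assumes "l < n" "\<forall>u\<in>set tms. fst (snd u) < k"
  shows "row_val (entry_row n (k * Suc r) tms l) = (unit_vec l, entry_vec tms l)"
proof -
  let ?b = "snd (entry_row n (k * Suc r) tms l)"
  have "pencil ?b c = entry_vec tms l c" for c
  proof -
    have "pencil ?b c = Poly_Mapping.single (gen 0) (?b (c * Suc r + 0))"
      by (rule pencil_single) (simp_all add: entry_row_def)
    moreover have "?b (c * Suc r) = (\<Sum>u\<leftarrow>tms. if fst u = l \<and> fst (snd u) = c then snd (snd u) else 0)"
    proof (cases "c < k")
      case True
      then have "c * Suc r < k * Suc r" by (intro mult_strict_right_mono) simp_all
      then show ?thesis
        by (simp add: entry_row_def fold_plus_sum_list del: mult_Suc_right)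
    next
      case False
      then have "k * Suc r \<le> c * Suc r" by (intro mult_le_mono1) simp
      moreover have "(\<Sum>u\<leftarrow>tms. if fst u = l \<and> fst (snd u) = c then snd (snd u) else 0) = (\<Sum>u\<leftarrow>tms. 0)"
        using assms(2) False by (intro arg_cong[where f = sum_list] map_cong) auto
      ultimately show ?thesis by (simp add: entry_row_def del: mult_Suc_right)
    qed
    ultimately show ?thesis by (simp add: entry_vec_def gen_def)
  qed
  moreover have "val_vec (fst (entry_row n (k * Suc r) tms l)) = unit_vec l"
    using assms(1) by (auto simp: entry_row_def unit_vec_def fun_eq_iff word_val_def)
  ultimately show ?thesis by (simp add: row_val_def fun_eq_iff)
qed

lemma eval_cols_entry_vec:
  fixes tms :: "(nat \<times> nat \<times> 'k::field) list"
  assumes "\<forall>u\<in>set tms. fst (snd u) < m + length us"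
  shows "eval_cols m us (entry_vec tms l) = entry_sum us tms l"
  using assms
proof (induction tms)
  case Nil
  show ?case by (simp add: entry_vec_def entry_sum_def eval_cols_def fun_eq_iff sum_fun_apply)
next
  case (Cons u tms)
  interpret E: linear_map "lscale" "lscale" "eval_cols m us :: (nat \<Rightarrow> 'f \<Rightarrow>\<^sub>0 'k) \<Rightarrow> _"
    by (rule linear_map_eval_cols)
  have "entry_vec (u # tms) l =
      (if fst u = l then lscale (Poly_Mapping.single 0 (snd (snd u))) (unit_vec (fst (snd u))) else 0) +
      entry_vec tms l"
    by (auto simp: entry_vec_def unit_vec_def fun_eq_iff single_add)
  then have "eval_cols m us (entry_vec (u # tms) l) =
      (if fst u = l then lscale (Poly_Mapping.single 0 (snd (snd u))) (col_val us (fst (snd u))) else 0) +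
      eval_cols m us (entry_vec tms l)"
    using Cons.prems by (simp add: E.f_add E.f_scale eval_cols_unit_vec del: scale_Left_apply)
  then show ?case using Cons by (simp add: entry_sum_def)
qed

text \<open>Modulo the instruction rows a linearized row equals the row it comes from, since they
  generate the kernel of \<open>eval_cols\<close> and \<open>eval_cols\<close> fixes vectors on the
  first \<open>m\<close> columns. Relations, the part of the image inside the first \<open>m\<close>
  coordinates and surjectivity all transfer in this way.\<close>

lemma linear_rows_correct:
  fixes Es :: "'k::field fvec list" and m :: nat
  assumes good: "\<forall>E\<in>set Es. good_vec E"
  defines "n \<equiv> length Es" and "k \<equiv> num_cols m Es"
    and "G \<equiv> lspan pair_scale (map row_val (linear_rows m Es))"
  shows "\<forall>\<rho>\<in>set (linear_rows m Es). row_ok n (k * Suc r) \<rho>"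
    and "lindep pair_scale (map row_val (linear_rows m Es))"
    and "{p. (p, 0) \<in> G} = {p. (\<forall>i\<ge>n. p i = 0) \<and> (\<Sum>l<n. lscale (p l) (vec_val m (Es ! l))) = 0}"
    and "vspan (map (vec_val m) Es) = {y \<in> snd ` G. \<forall>t\<ge>m. y t = 0}"
    and "y \<in> snd ` G \<Longrightarrow> t \<ge> k \<Longrightarrow> y t = 0"
    and "{y. \<forall>c\<ge>k. y c = 0} \<subseteq> snd ` G \<longleftrightarrow>
      {y. \<forall>c\<ge>m. y c = 0} \<subseteq> vspan (map (vec_val m) Es)"
proof -
  obtain us tms where lin: "linearize m Es = (us, tms)" by (cases "linearize m Es")
  have k: "k = m + length us" by (simp add: k_def num_cols_def lin)
  have wf: "wf_instrs m us" and tms: "\<forall>u\<in>set tms. fst (snd u) < m + length us"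
    and es: "\<And>l. l < n \<Longrightarrow> entry_sum us tms l = vec_val m (Es ! l)"
    using linearize_correct[OF good lin] by (simp_all add: n_def)
  interpret E: linear_map "lscale" "lscale" "eval_cols m us :: (nat \<Rightarrow> 'f \<Rightarrow>\<^sub>0 'k) \<Rightarrow> _"
    by (rule linear_map_eval_cols)
  let ?V = "map instr_val us :: (nat \<Rightarrow> 'f \<Rightarrow>\<^sub>0 'k) list"
  let ?gs = "map (\<lambda>l. (unit_vec l, entry_vec tms l)) [0..<n] :: ((nat \<Rightarrow> 'f \<Rightarrow>\<^sub>0 'k) \<times> (nat \<Rightarrow> 'f \<Rightarrow>\<^sub>0 'k)) list"
  let ?is = "map (\<lambda>u. (0, instr_val u)) us :: ((nat \<Rightarrow> 'f \<Rightarrow>\<^sub>0 'k) \<times> (nat \<Rightarrow> 'f \<Rightarrow>\<^sub>0 'k)) list"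
  \<comment> \<open>\<open>rc\<close> combines the linearized rows and \<open>comb\<close> the
    original ones; \<open>eval_cols\<close> takes the former to the latter
    (\<open>eval_rc\<close>).\<close>
  define rc where "rc = (\<lambda>a :: nat \<Rightarrow> 'f \<Rightarrow>\<^sub>0 'k. \<Sum>l<n. lscale (a l) (entry_vec tms l))"
  define comb where "comb = (\<lambda>a :: nat \<Rightarrow> 'f \<Rightarrow>\<^sub>0 'k. \<Sum>l<n. lscale (a l) (vec_val m (Es ! l)))"
  have rows: "linear_rows m Es = map (entry_row n (k * Suc r) tms) [0..<n] @ map (instr_row (k * Suc r)) us"
    by (simp add: linear_rows_def lin n_def k_def num_cols_def del: mult_Suc_right)
  show "\<forall>\<rho>\<in>set (linear_rows m Es). row_ok n (k * Suc r) \<rho>"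
    unfolding rows by (auto simp: row_ok_def entry_row_def instr_row_def simp del: mult_Suc_right)
  have vals: "map row_val (linear_rows m Es) = ?gs @ ?is"
  proof -
    have "row_val (entry_row n (k * Suc r) tms l) = (unit_vec l, entry_vec tms l)" if "l \<in> set [0..<n]" for l
      using that tms by (intro row_val_entry_row) (simp_all add: k)
    moreover have "row_val (instr_row (k * Suc r) u :: 'k row) = (0, instr_val u)" if "u \<in> set us" for u
      using wf_instrs_less[OF wf that] by (intro row_val_instr_row) (simp_all add: k)
    ultimately show ?thesis unfolding rows map_append map_map by (simp add: o_def cong: map_cong)
  qed
  have is_iff: "z \<in> lspan pair_scale ?is \<longleftrightarrow> fst z = 0 \<and> snd z \<in> vspan ?V" for z
  proof -
    have V: "snd ` lspan pair_scale ?is = vspan ?V"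
      using snd_map.lspan_map[of ?is] by (simp add: o_def)
    have "lspan pair_scale ?is \<subseteq> {z. fst z = 0}"
      by (rule P.lspan_least) (auto simp: submod_def pair_scale_def L.s_zero_right)
    then have f: "fst z = 0" if "z \<in> lspan pair_scale ?is" for z using that by blast
    show ?thesis
    proof
      assume "z \<in> lspan pair_scale ?is"
      then show "fst z = 0 \<and> snd z \<in> vspan ?V" using f V by blast
    next
      assume z: "fst z = 0 \<and> snd z \<in> vspan ?V"
      then obtain w where w: "w \<in> lspan pair_scale ?is" "snd z = snd w" using V by blast
      then have "z = w" using f[OF w(1)] z by (simp add: prod_eq_iff)
      then show "z \<in> lspan pair_scale ?is" using w by simp
    qed
  qed
  have gs_iff: "z \<in> lspan pair_scale ?gs \<longleftrightarrow> (\<exists>a. z = (\<lambda>i. if i < n then a i else 0, rc a))" for z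
  proof -
    have "(\<Sum>i<length ?gs. pair_scale (a i) (?gs ! i)) = (\<lambda>i. if i < n then a i else 0, rc a)" for a
    proof -
      have "(\<Sum>i<length ?gs. pair_scale (a i) (?gs ! i)) = (\<Sum>i<n. pair_scale (a i) (unit_vec i, entry_vec tms i))"
        by (rule sum.cong) simp_all
      then show ?thesis
        by (simp only: prod_eq_iff fst_map.f_sum snd_map.f_sum pair_scale_def fst_conv snd_conv sum_unit_vec rc_def)
    qed
    then show ?thesis unfolding P.lspan_iff_sum by simp
  qed
  have G_iff: "z \<in> G \<longleftrightarrow> (\<exists>a s. s \<in> vspan ?V \<and> z = (\<lambda>i. if i < n then a i else 0, rc a + s))" for z
  proof
    assume "z \<in> G"
    then obtain u w where uw: "z = u + w" "u \<in> lspan pair_scale ?gs" "w \<in> lspan pair_scale ?is"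
      unfolding G_def vals P.lspan_append by blast
    obtain a where "u = (\<lambda>i. if i < n then a i else 0, rc a)" using uw(2) gs_iff by blast
    then have "z = (\<lambda>i. if i < n then a i else 0, rc a + snd w)" "snd w \<in> vspan ?V"
      using uw(1,3) is_iff[of w] by (auto simp: prod_eq_iff)
    then show "\<exists>a s. s \<in> vspan ?V \<and> z = (\<lambda>i. if i < n then a i else 0, rc a + s)"
      by blast
  next
    assume "\<exists>a s. s \<in> vspan ?V \<and> z = (\<lambda>i. if i < n then a i else 0, rc a + s)"
    then obtain a s where s: "s \<in> vspan ?V"
      and z: "z = (\<lambda>i. if i < n then a i else 0, rc a + s)" by blast
    have "z = (\<lambda>i. if i < n then a i else 0, rc a) + (0, s)" by (simp add: z)
    moreover have "(\<lambda>i. if i < n then a i else 0, rc a) \<in> lspan pair_scale ?gs" using gs_iff by blast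
    moreover have "(0, s) \<in> lspan pair_scale ?is" using is_iff[of "(0, s)"] s by simp
    ultimately show "z \<in> G" unfolding G_def vals P.lspan_append by blast
  qed
  have eval_V: "eval_cols m us s = 0" if "s \<in> vspan ?V" for s
  proof -
    have "vspan ?V \<subseteq> {s. eval_cols m us s = 0}"
    proof (rule L.lspan_least)
      show "submod (lscale) {s. eval_cols m us s = (0 :: nat \<Rightarrow> 'f \<Rightarrow>\<^sub>0 'k)}"
        by (simp add: submod_def E.f_add E.f_scale L.s_zero_right del: scale_Left_apply)
      show "set ?V \<subseteq> {s. eval_cols m us s = 0}"
        using eval_cols_instr_val[OF wf] by auto
    qed
    then show ?thesis using that by blast
  qed
  have eval_rc: "eval_cols m us (rc a) = comb a" for a
    unfolding rc_def comb_def E.f_sum E.f_scale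
    by (rule sum.cong) (simp_all add: eval_cols_entry_vec[OF tms] es)
  have rc_van: "rc a t = 0" if "t \<ge> k" for a t
  proof -
    have "entry_vec tms l t = (0 :: 'f \<Rightarrow>\<^sub>0 'k)" for l
    proof -
      have "(\<Sum>u\<leftarrow>tms. if fst u = l \<and> fst (snd u) = t then snd (snd u) else 0) = (\<Sum>u\<leftarrow>tms. 0)"
        using tms that by (intro arg_cong[where f = sum_list] map_cong) (auto simp: k)
      then show ?thesis by (simp add: entry_vec_def)
    qed
    then show ?thesis by (simp add: rc_def sum_fun_apply)
  qed
  have V_van: "s t = 0" if "s \<in> vspan ?V" "t \<ge> k" for s t
  proof -
    have "vspan ?V \<subseteq> {s. s t = 0}"
    proof (rule L.lspan_least)
      show "set ?V \<subseteq> {s. s t = 0}"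
        using wf_instrs_less[OF wf] that(2) by (fastforce simp: k instr_val_def)
    qed (simp add: submod_def)
    then show ?thesis using that(1) by blast
  qed
  have in_V: "y - eval_cols m us y \<in> vspan ?V" and eval_van: "t \<ge> m \<Longrightarrow> eval_cols m us y t = 0"
    if "\<And>t. t \<ge> k \<Longrightarrow> y t = 0" for y :: "nat \<Rightarrow> 'f \<Rightarrow>\<^sub>0 'k" and t
    using diff_eval_cols[OF wf, of y] that by (simp_all add: k)
  have dep_gs: "vindep (map unit_vec [0..<n] :: (nat \<Rightarrow> 'f \<Rightarrow>\<^sub>0 'k) list)"
    by (rule lindep_unit_vec)
  have dep_is: "lindep pair_scale ?is"
    by (rule snd_map.lindep_mapD) (use lindep_instr_vals[OF wf] in \<open>simp add: o_def\<close>)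
  show "lindep pair_scale (map row_val (linear_rows m Es))"
    unfolding vals P.lindep_iff_sum
  proof (rule ccontr)
    assume "\<not> (\<forall>a. (\<Sum>i<length (?gs @ ?is). pair_scale (a i) ((?gs @ ?is) ! i)) = 0 \<longrightarrow> (\<forall>i<length (?gs @ ?is). a i = 0))"
    then have nd: "\<not> lindep pair_scale (?gs @ ?is)" unfolding P.lindep_iff_sum .
    have "lindep pair_scale (map (\<lambda>l. (unit_vec l, entry_vec tms l)) ls @ ?is)"
      if "vindep (map unit_vec ls :: (nat \<Rightarrow> 'f \<Rightarrow>\<^sub>0 'k) list)" for ls
      using that
    proof (induction ls)
      case Nil
      show ?case using dep_is by (simp only: list.map append_Nil)
    next
      case (Cons l ls)
      let ?gl = "map (\<lambda>l. (unit_vec l, entry_vec tms l)) ls :: ((nat \<Rightarrow> 'f \<Rightarrow>\<^sub>0 'k) \<times> (nat \<Rightarrow> 'f \<Rightarrow>\<^sub>0 'k)) list"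
      have "a = 0" if a: "pair_scale a (unit_vec l, entry_vec tms l) \<in> lspan pair_scale (?gl @ ?is)" for a
      proof -
        obtain u w where uw: "pair_scale a (unit_vec l, entry_vec tms l) = u + w"
            "u \<in> lspan pair_scale ?gl" "w \<in> lspan pair_scale ?is"
          using a unfolding P.lspan_append by blast
        have "lscale a (unit_vec l) = fst u"
          using arg_cong[OF uw(1), of fst] is_iff[of w] uw(3) by (simp add: pair_scale_def)
        moreover have "fst u \<in> vspan (map unit_vec ls)"
          using fst_map.lspan_map[of ?gl] uw(2) by (simp add: o_def)
        ultimately show ?thesis using Cons.prems unfolding list.map lindep.simps by simp
      qed
      moreover have "vindep (map unit_vec ls :: (nat \<Rightarrow> 'f \<Rightarrow>\<^sub>0 'k) list)"
        using Cons.prems unfolding list.map lindep.simps by blast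
      ultimately show ?case using Cons.IH unfolding list.map append_Cons lindep.simps by blast
    qed
    then show False using nd dep_gs by blast
  qed
  show "{p. (p, 0) \<in> G} = {p. (\<forall>i\<ge>n. p i = 0) \<and> (\<Sum>l<n. lscale (p l) (vec_val m (Es ! l))) = 0}"
  proof (intro equalityI subsetI)
    fix p
    assume "p \<in> {p. (p, 0) \<in> G}"
    then have "(p, 0) \<in> G" by simp
    then obtain a s where s: "s \<in> vspan ?V"
      and z: "(p, 0) = (\<lambda>i. if i < n then a i else 0, rc a + s)"
      unfolding G_iff by blast
    have p: "p = (\<lambda>i. if i < n then a i else 0)" and "rc a + s = 0" using z by simp_all
    then have "eval_cols m us (rc a + s) = 0" by simp
    then have "comb a = 0" by (simp add: E.f_add eval_rc eval_V[OF s])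
    moreover have "comb p = comb a" unfolding comb_def by (rule sum.cong) (simp_all add: p)
    ultimately show "p \<in> {p. (\<forall>i\<ge>n. p i = 0) \<and> (\<Sum>l<n. lscale (p l) (vec_val m (Es ! l))) = 0}"
      using p by (simp add: comb_def)
  next
    fix p
    assume "p \<in> {p. (\<forall>i\<ge>n. p i = 0) \<and> (\<Sum>l<n. lscale (p l) (vec_val m (Es ! l))) = 0}"
    then have p: "\<And>i. i \<ge> n \<Longrightarrow> p i = 0" and "comb p = 0" by (simp_all add: comb_def)
    have "rc p - eval_cols m us (rc p) \<in> vspan ?V"
      by (rule in_V) (rule rc_van)
    then have "rc p \<in> vspan ?V" by (simp add: eval_rc \<open>comb p = 0\<close>)
    then have "- rc p \<in> vspan ?V" by (rule L.submod_neg[OF L.submod_lspan])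
    moreover have "(p, 0) = (\<lambda>i. if i < n then p i else 0, rc p + - rc p)" using p by (auto simp: fun_eq_iff)
    ultimately have "(p, 0) \<in> G" unfolding G_iff by blast
    then show "p \<in> {p. (p, 0) \<in> G}" by simp
  qed
  have M_iff: "v \<in> vspan (map (vec_val m) Es) \<longleftrightarrow> (\<exists>a. v = comb a)" for v
  proof -
    have "(\<Sum>i<length (map (vec_val m) Es). lscale (a i) (map (vec_val m) Es ! i)) = comb a" for a
      unfolding comb_def n_def by (rule sum.cong) simp_all
    then show ?thesis unfolding L.lspan_iff_sum by simp
  qed
  have Y_iff: "y \<in> snd ` G \<longleftrightarrow> (\<exists>a s. s \<in> vspan ?V \<and> y = rc a + s)" for y
  proof
    assume "y \<in> snd ` G"
    then obtain z where z: "z \<in> G" "y = snd z" by blast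
    from z(1) obtain a s where "s \<in> vspan ?V" "z = (\<lambda>i. if i < n then a i else 0, rc a + s)"
      unfolding G_iff by (elim exE conjE)
    then show "\<exists>a s. s \<in> vspan ?V \<and> y = rc a + s" using z(2) by auto
  next
    assume "\<exists>a s. s \<in> vspan ?V \<and> y = rc a + s"
    then obtain a s where s: "s \<in> vspan ?V" "y = rc a + s" by (elim exE conjE)
    then have "(\<lambda>i. if i < n then a i else 0, rc a + s) \<in> G" unfolding G_iff by blast
    then show "y \<in> snd ` G" by (rule image_eqI[rotated]) (simp add: s(2))
  qed
  show Y_van: "y t = 0" if y: "y \<in> snd ` G" and t: "t \<ge> k" for y t
  proof -
    obtain a s where "s \<in> vspan ?V" "y = rc a + s" using y Y_iff by blast
    then show ?thesis using rc_van[OF t] V_van[OF _ t] by simp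
  qed
  show M_eq: "vspan (map (vec_val m) Es) = {y \<in> snd ` G. \<forall>t\<ge>m. y t = 0}"
  proof (intro equalityI subsetI)
    fix v
    assume "v \<in> vspan (map (vec_val m) Es)"
    then obtain a where a: "v = comb a" using M_iff by blast
    have "rc a - comb a \<in> vspan ?V"
      using in_V[of "rc a", OF rc_van] by (simp add: eval_rc)
    then have "- (rc a - comb a) \<in> vspan ?V"
      by (rule L.submod_neg[OF L.submod_lspan])
    moreover have "v = rc a + - (rc a - comb a)" by (simp add: a)
    ultimately have "v \<in> snd ` G"
      unfolding Y_iff by (intro exI[of _ a] exI[of _ "- (rc a - comb a)"] conjI)
    moreover have "v t = 0" if "t \<ge> m" for t
      using eval_van[of "rc a" t, OF rc_van that] by (simp add: a eval_rc)
    ultimately show "v \<in> {y \<in> snd ` G. \<forall>t\<ge>m. y t = 0}" by simp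
  next
    fix y
    assume "y \<in> {y \<in> snd ` G. \<forall>t\<ge>m. y t = 0}"
    then have y: "y \<in> snd ` G" and van: "\<And>t. t \<ge> m \<Longrightarrow> y t = 0" by auto
    obtain a s where s: "s \<in> vspan ?V" "y = rc a + s" using y Y_iff by blast
    have "eval_cols m us y = comb a" by (simp add: s(2) E.f_add eval_rc eval_V[OF s(1)])
    moreover have "eval_cols m us y = y"
    proof -
      have "eval_cols m us y = (\<Sum>t<m. lscale (y t) (col_val us t))"
        unfolding eval_cols_def by (rule sum.mono_neutral_right) (use van in \<open>auto simp: L.s_zero_left\<close>)
      also have "\<dots> = (\<Sum>t<m. lscale (y t) (unit_vec t))"
        by (rule sum.cong) (simp_all add: col_val_base[OF wf])
      also have "\<dots> = y" unfolding sum_unit_vec using van by (auto simp: fun_eq_iff)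
      finally show ?thesis .
    qed
    ultimately show "y \<in> vspan (map (vec_val m) Es)" unfolding M_iff by (intro exI) simp
  qed
  show "{y. \<forall>c\<ge>k. y c = 0} \<subseteq> snd ` G \<longleftrightarrow>
      {y. \<forall>c\<ge>m. y c = 0} \<subseteq> vspan (map (vec_val m) Es)"
  proof
    assume A: "{y. \<forall>c\<ge>k. y c = 0} \<subseteq> snd ` G"
    show "{y. \<forall>c\<ge>m. y c = 0} \<subseteq> vspan (map (vec_val m) Es)"
    proof
      fix y :: "nat \<Rightarrow> 'f \<Rightarrow>\<^sub>0 'k"
      assume y: "y \<in> {y. \<forall>c\<ge>m. y c = 0}"
      then have "y \<in> {y. \<forall>c\<ge>k. y c = 0}" by (simp add: k)
      then show "y \<in> vspan (map (vec_val m) Es)" using A y unfolding M_eq by blast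
    qed
  next
    assume B: "{y. \<forall>c\<ge>m. y c = 0} \<subseteq> vspan (map (vec_val m) Es)"
    show "{y. \<forall>c\<ge>k. y c = 0} \<subseteq> snd ` G"
    proof
      fix y :: "nat \<Rightarrow> 'f \<Rightarrow>\<^sub>0 'k"
      assume "y \<in> {y. \<forall>c\<ge>k. y c = 0}"
      then have y: "\<And>t. t \<ge> k \<Longrightarrow> y t = 0" by simp
      have "eval_cols m us y t = 0" if "t \<ge> m" for t
        by (rule eval_van[OF _ that]) (rule y)
      then have "eval_cols m us y \<in> {y. \<forall>c\<ge>m. y c = 0}" by simp
      then obtain a where a: "eval_cols m us y = comb a" using B M_iff by blast
      have "y - eval_cols m us y \<in> vspan ?V" by (rule in_V) (rule y)
      moreover have "rc a - comb a \<in> vspan ?V"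
        using in_V[of "rc a", OF rc_van] by (simp add: eval_rc)
      ultimately have "(y - eval_cols m us y) - (rc a - comb a) \<in> vspan ?V"
        by (rule L.submod_diff[OF L.submod_lspan])
      moreover have "y = rc a + ((y - eval_cols m us y) - (rc a - comb a))" by (simp add: a)
      ultimately show "y \<in> snd ` G"
        unfolding Y_iff by (intro exI[of _ a] exI[of _ "(y - eval_cols m us y) - (rc a - comb a)"] conjI)
    qed
  qed
qed

theorem kernel_correct:
  fixes Es :: "'k::field fvec list"
  assumes "\<forall>E\<in>set Es. good_vec E"
  shows "\<forall>p\<in>set (kernel m Es). \<forall>i\<ge>length Es. p i = []"
    and "vindep (map val_vec (kernel m Es))"
    and "vspan (map val_vec (kernel m Es)) =
      {p. (\<forall>i\<ge>length Es. p i = 0) \<and> (\<Sum>l<length Es. lscale (p l) (vec_val m (Es ! l))) = 0}"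
    and "\<exists>ys. vindep ys \<and>
      vspan ys = snd ` lspan pair_scale (map row_val (linear_rows m Es))"
    and "spanning m Es \<longleftrightarrow> {y. \<forall>c\<ge>m. y c = 0} \<subseteq> vspan (map (vec_val m) Es)"
proof -
  obtain i todo acc ker don where red: "reduced_state m Es = (i, todo, acc, ker, don)"
    by (cases "reduced_state m Es") auto
  have ker: "kernel m Es = ker" by (simp add: kernel_def red)
  note L = linear_rows_correct[OF assms, where m = m]
  note R = reduce_correct[OF L(1,2) red[unfolded reduced_state_def]]
  show "\<forall>p\<in>set (kernel m Es). \<forall>i\<ge>length Es. p i = []" using R(1) by (simp add: ker)
  show "vindep (map val_vec (kernel m Es))" using R(2) by (simp only: ker)
  show "vspan (map val_vec (kernel m Es)) =
      {p. (\<forall>i\<ge>length Es. p i = 0) \<and> (\<Sum>l<length Es. lscale (p l) (vec_val m (Es ! l))) = 0}"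
    using R(3) unfolding ker L(3) .
  show "\<exists>ys. vindep ys \<and>
      vspan ys = snd ` lspan pair_scale (map row_val (linear_rows m Es))"
    by (rule R(4))
  show "spanning m Es \<longleftrightarrow> {y. \<forall>c\<ge>m. y c = 0} \<subseteq> vspan (map (vec_val m) Es)"
    using R(5) unfolding L(6) spanning_def by (simp only: red snd_conv)
qed

section \<open>Bases of finitely generated submodules\<close>

lemma ex_formal:
  fixes a :: "'f \<Rightarrow>\<^sub>0 'k::field"
  shows "\<exists>ts. formal_val ts = a \<and> (\<forall>t\<in>set ts. snd t \<in> words r)"
proof (induction a rule: poly_mapping_single_induct)
  case (single k v)
  show ?case by (rule exI[of _ "[(v, red k)]"]) (simp add: red)
next
  case (add a b)
  then obtain ts us where "formal_val ts = a" "\<forall>t\<in>set ts. snd t \<in> words r"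
    "formal_val us = b" "\<forall>t\<in>set us. snd t \<in> words r" by blast
  then show ?case by (intro exI[of _ "ts @ us"]) auto
qed

text \<open>A finitely generated submodule of the free module of rank \<open>m\<close> is the intersection of the
  image of its linearization, which is free, with the first \<open>m\<close> coordinates, and thus the kernel
  of a matrix.\<close>

theorem exists_basis:
  fixes vs :: "(nat \<Rightarrow> 'f \<Rightarrow>\<^sub>0 'k::field) list"
  assumes vs: "\<forall>v\<in>set vs. \<forall>i\<ge>m. v i = 0"
  shows "\<exists>bs. vindep bs \<and> vspan bs = vspan vs"
proof -
  have formal: "\<exists>E. good_vec E \<and> vec_val m' E = (\<lambda>i. if i < m' then v i else 0)"
    for v :: "nat \<Rightarrow> 'f \<Rightarrow>\<^sub>0 'k" and m'
  proof -
    have "\<forall>i. \<exists>ts. formal_val ts = v i \<and> (\<forall>t\<in>set ts. snd t \<in> words r)" using ex_formal by blast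
    then have "\<exists>E. \<forall>i. formal_val (E i) = v i \<and> (\<forall>t\<in>set (E i). snd t \<in> words r)" by (rule choice)
    then obtain E where "\<forall>i. formal_val (E i) = v i \<and> (\<forall>t\<in>set (E i). snd t \<in> words r)" by (elim exE)
    then have "good_vec E \<and> vec_val m' E = (\<lambda>i. if i < m' then v i else 0)"
      by (auto simp: good_vec_def vec_val_def fun_eq_iff)
    then show ?thesis by (intro exI[of _ E])
  qed
  have "\<exists>Es. (\<forall>E\<in>set Es. good_vec E) \<and> map (vec_val m) Es = vs"
    using vs
  proof (induction vs)
    case (Cons v vs)
    obtain E where E: "good_vec E" "vec_val m E = (\<lambda>i. if i < m then v i else 0)"
      using formal[of m v] by (elim exE conjE)
    have "vec_val m E = v" unfolding E(2) using Cons.prems by auto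
    moreover obtain Es where "\<forall>E\<in>set Es. good_vec E" "map (vec_val m) Es = vs"
      using Cons.IH Cons.prems by auto
    ultimately have "(\<forall>E\<in>set (E # Es). good_vec E) \<and> map (vec_val m) (E # Es) = v # vs"
      using E(1) by (simp only: list.map list.set ball_simps)
    then show ?case by (intro exI[of _ "E # Es"])
  qed simp
  then obtain Es where Es: "\<forall>E\<in>set Es. good_vec E" "map (vec_val m) Es = vs" by blast
  define Y where "Y = snd ` lspan pair_scale (map row_val (linear_rows m Es))"
  define k where "k = num_cols m Es"
  obtain ys where ys: "vindep ys" "vspan ys = Y"
    using kernel_correct(4)[OF Es(1)] unfolding Y_def by blast
  define q where "q = length ys"
  define T where "T = k - m"
  have M: "vspan vs = {y \<in> Y. \<forall>t\<ge>m. y t = 0}"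
    using linear_rows_correct(4)[OF Es(1), where m = m] by (simp only: Es(2) Y_def)
  have Y_van: "y t = 0" if "y \<in> Y" "t \<ge> k" for y t
    using linear_rows_correct(5)[OF Es(1), where m = m and y = y and t = t] that by (simp only: Y_def k_def)
  \<comment> \<open>The coordinates from \<open>m\<close> up to \<open>k\<close>. As elements of
    \<open>Y\<close> vanish from \<open>k\<close> on, lying in the first \<open>m\<close>
    coordinates means \<open>tail y = 0\<close>. For the coefficients of \<open>y\<close> with
    respect to \<open>ys\<close> this is a linear system, and \<open>kernel\<close> yields a basis
    of its solutions.\<close>
  define tail where "tail = (\<lambda>y :: nat \<Rightarrow> 'f \<Rightarrow>\<^sub>0 'k. \<lambda>t. if t < T then y (m + t) else 0)"
  have "\<exists>Fs. length Fs = length ys \<and> (\<forall>E\<in>set Fs. good_vec E) \<and> map (vec_val T) Fs = map tail ys"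
  proof (induction ys)
    case (Cons y ys)
    obtain E where "good_vec E" "vec_val T E = tail y"
      using formal[of T "\<lambda>t. y (m + t)"] unfolding tail_def by (elim exE conjE)
    moreover obtain Fs where "length Fs = length ys" "\<forall>E\<in>set Fs. good_vec E" "map (vec_val T) Fs = map tail ys"
      using Cons by (elim exE conjE)
    ultimately have "length (E # Fs) = length (y # ys) \<and> (\<forall>E\<in>set (E # Fs). good_vec E) \<and>
        map (vec_val T) (E # Fs) = map tail (y # ys)"
      by (simp only: list.map list.set ball_simps list.size)
    then show ?case by (intro exI[of _ "E # Fs"])
  qed simp
  then obtain Fs where Fs: "length Fs = q" "\<forall>E\<in>set Fs. good_vec E" "map (vec_val T) Fs = map tail ys"
    unfolding q_def by blast
  define comb where "comb = (\<lambda>a :: nat \<Rightarrow> 'f \<Rightarrow>\<^sub>0 'k. \<Sum>i<q. lscale (a i) (ys ! i))"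
  interpret C: linear_map "lscale" "lscale" comb
    by unfold_locales (simp_all add: comb_def L.s_add_left sum.distrib L.s_sum_right L.s_assoc)
  define ks where "ks = map val_vec (kernel T Fs)"
  have ks: "vindep ks"
    "vspan ks = {p. (\<forall>i\<ge>q. p i = 0) \<and> (\<Sum>l<q. lscale (p l) (tail (ys ! l))) = 0}"
  proof -
    have "vec_val T (Fs ! l) = tail (ys ! l)" if "l < q" for l
      using that Fs(1,3) by (metis nth_map q_def)
    then have "(\<Sum>l<q. lscale (p l) (vec_val T (Fs ! l))) =
        (\<Sum>l<q. lscale (p l) (tail (ys ! l)))" for p
      by (intro sum.cong) simp_all
    then show "vspan ks =
        {p. (\<forall>i\<ge>q. p i = 0) \<and> (\<Sum>l<q. lscale (p l) (tail (ys ! l))) = 0}"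
      using kernel_correct(3)[OF Fs(2), of T] by (simp only: ks_def Fs(1))
    show "vindep ks" unfolding ks_def by (rule kernel_correct(2)[OF Fs(2)])
  qed
  have comb_tail: "(\<Sum>l<q. lscale (p l) (tail (ys ! l))) = tail (comb p)" for p
    by (auto simp: fun_eq_iff tail_def comb_def sum_fun_apply)
  have "vindep (map comb ks)"
  proof (rule C.lindep_mapI[OF ks(1)])
    fix p
    assume p: "p \<in> vspan ks" "comb p = 0"
    then have "\<forall>i<q. p i = 0" using ys(1) unfolding L.lindep_iff_sum comb_def q_def by blast
    moreover have "\<forall>i\<ge>q. p i = 0" using p(1) ks(2) by blast
    ultimately have "p i = 0" for i by (cases "i < q") auto
    then show "p = 0" by (simp add: fun_eq_iff)
  qed
  moreover have "vspan (map comb ks) = vspan vs"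
  proof (intro equalityI subsetI)
    fix y
    assume "y \<in> vspan (map comb ks)"
    then obtain p where p: "p \<in> vspan ks" "y = comb p"
      unfolding C.lspan_map by blast
    have y: "y \<in> Y" unfolding ys(2)[symmetric] L.lspan_iff_sum p(2) comb_def q_def by (intro exI[of _ p] refl)
    have tail: "tail y = 0" using p ks(2) comb_tail by simp
    have "y t = 0" if "t \<ge> m" for t
    proof (cases "t < k")
      case True
      then have "y t = tail y (t - m)" using that by (simp add: tail_def T_def diff_less_mono)
      then show ?thesis unfolding tail by simp
    qed (use Y_van[OF y, of t] in simp)
    then show "y \<in> vspan vs" using y M by blast
  next
    fix y
    assume "y \<in> vspan vs"
    then have y: "y \<in> Y" "\<And>t. t \<ge> m \<Longrightarrow> y t = 0" using M by auto
    obtain a where a: "y = comb a"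
      using y(1) unfolding ys(2)[symmetric] L.lspan_iff_sum comb_def q_def by (elim exE)
    define p where "p = (\<lambda>i. if i < q then a i else 0)"
    have "comb p = y" unfolding a comb_def by (rule sum.cong) (simp_all add: p_def)
    moreover have "tail y = 0" using y(2) by (auto simp: tail_def fun_eq_iff)
    ultimately have "p \<in> vspan ks" using ks(2) comb_tail by (simp add: p_def)
    then show "y \<in> vspan (map comb ks)"
      unfolding C.lspan_map using \<open>comb p = y\<close> by blast
  qed
  ultimately show ?thesis by blast
qed

end

section \<open>Computability of kernels\<close>

text \<open>Codes of words admit only letters below \<open>r\<close>. The bound is part of the
  representation, so computable functions preserve it automatically.\<close>

definition idx_rep :: "nat \<Rightarrow> nat rep" where
  "idx_rep r n i \<longleftrightarrow> n = i \<and> i < r"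

abbreviation letter_rep :: "nat \<Rightarrow> (nat \<times> bool) rep" where
  "letter_rep r \<equiv> prod_rep (idx_rep r) bool_rep"

abbreviation instr_rep :: "nat \<Rightarrow> instr rep" where
  "instr_rep r \<equiv> prod_rep nat_rep (prod_rep nat_rep (letter_rep r))"

lemma computable_idx:
  assumes "computable A (idx_rep r) f"
  shows "computable A nat_rep f"
  using assms unfolding computable_def idx_rep_def by metis

lemma computable_mod_idx:
  assumes "computable A nat_rep f" "r > 0"
  shows "computable A (idx_rep r) (\<lambda>e. f e mod r)"
  using computable_mod[OF assms] assms(2) unfolding computable_def idx_rep_def
  by (metis mod_less_divisor)

lemma computable_apply_fst:
  assumes "computable A (prod_rep (fun_rep z B) C) f" "computable A nat_rep i" "B k z"
  shows "computable A B (\<lambda>e. fst (f e) (i e))"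
  by (rule computable_apply[OF computable_fst[OF assms(1)] assms(2,3)])

lemma computable_apply_snd:
  assumes "computable A (prod_rep C (fun_rep z B)) f" "computable A nat_rep i" "B k z"
  shows "computable A B (\<lambda>e. snd (f e) (i e))"
  by (rule computable_apply[OF computable_snd[OF assms(1)] assms(2,3)])

lemmas computable_rules =
  computable_id computable_True computable_False computable_Nil computable_Pair
  computable_not computable_null computable_conj computable_eq_nat computable_less
  computable_If computable_Cons computable_append computable_map computable_filter computable_concat
  computable_length computable_upt computable_rev computable_fun
  computable_plus_nat computable_times_nat computable_minus_nat
  computable_mod[OF _ zero_less_Suc] computable_div[OF _ zero_less_Suc] computable_Suc

lemma prod_repI: "A i a \<Longrightarrow> B j b \<Longrightarrow> prod_rep A B (prod_encode (i, j)) (a, b)"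
  by (simp add: prod_rep_def)

lemma computableI2:
  assumes "partial_recursive p"
    and "\<And>i j a b. A i a \<Longrightarrow> B j b \<Longrightarrow> \<exists>k. p (prod_encode (i, j)) = Some k \<and> C k (f a b)"
  shows "computable (prod_rep A B) C (\<lambda>t. f (fst t) (snd t))"
proof (rule computableI[OF assms(1)])
  fix n and a :: "'a \<times> 'b"
  assume "prod_rep A B n a"
  then have "A (fst (prod_decode n)) (fst a)" "B (snd (prod_decode n)) (snd a)"
    by (simp_all add: prod_rep_def)
  from assms(2)[OF this] show "\<exists>k. p n = Some k \<and> C k (f (fst a) (snd a))" by simp
qed

text \<open>Inverts the words of a formal sum and keeps the coefficients. It realizes the
  anti-automorphism \<open>star\<close> of the group algebra without any simplification.\<close>

definition formal_star :: "'k formal \<Rightarrow> 'k formal" where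
  "formal_star ts = map (\<lambda>t. (fst t, rev (map (\<lambda>l. (fst l, \<not> snd l)) (snd t)))) ts"

text \<open>Conditions on column vectors are right-linear, while \<open>kernel\<close> solves
  left-linear systems. Applying the anti-automorphism to the transposed entries turns one into the
  other. The offset \<open>h\<close> skips the coefficients that belong to another block of
  generators.\<close>

definition transpose_star :: "nat \<Rightarrow> nat \<Rightarrow> 'k fvec list \<Rightarrow> 'k fvec list" where
  "transpose_star g h Us = map (\<lambda>l i. if i < length Us
     then formal_star (nth_default (\<lambda>_. []) Us i (h + l)) else []) [0..<g]"

definition formal_comb :: "nat \<Rightarrow> 'k::field fvec list \<Rightarrow> 'k fvec \<Rightarrow> 'k fvec" where
  "formal_comb m Gs u = (\<lambda>c. if c < m
     then concat (map (\<lambda>l. formal_mult (u l) (nth_default (\<lambda>_. []) Gs l c)) [0..<length Gs]) else [])"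

section \<open>The algorithms for closure and inclusion\<close>

context free_group
begin

text \<open>A functional on the span of \<open>Gs\<close> that vanishes on \<open>Hs\<close> is a
  family of values on \<open>Gs\<close> killed by the \<open>Gs\<close>-part of every relation of
  \<open>Hs @ Gs\<close>. Relations with zero \<open>Hs\<close>-part express that it is well
  defined, the others that it vanishes on \<open>Hs\<close>.\<close>

definition relations :: "nat \<Rightarrow> 'k::field fvec list \<Rightarrow> 'k fvec list \<Rightarrow> 'k fvec list" where
  "relations m Hs Gs = kernel m (Hs @ Gs)"

text \<open>The columns spanning the functionals on the span of \<open>Gs\<close> that vanish on \<open>Hs\<close>, starred.\<close>

definition functionals :: "nat \<Rightarrow> 'k::field fvec list \<Rightarrow> 'k fvec list \<Rightarrow> 'k fvec list" where
  "functionals m Hs Gs = kernel (length (relations m Hs Gs))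
     (transpose_star (length Gs) (length Hs) (relations m Hs Gs))"

text \<open>The second annihilator: coefficient vectors killed by all the functionals, turned into
  elements of the span of \<open>Gs\<close>. The functionals were computed starred, and the second
  \<open>transpose_star\<close> undoes that.\<close>

definition closure_gens :: "nat \<Rightarrow> 'k::field fvec list \<Rightarrow> 'k fvec list \<Rightarrow> 'k fvec list" where
  "closure_gens m Hs Gs = map (formal_comb m Gs) (kernel (length (functionals m Hs Gs))
     (transpose_star (length Gs) 0 (functionals m Hs Gs)))"

text \<open>A vector y of coefficients for \<open>As\<close> extends to a relation of
  \<open>As @ Bs\<close> iff its combination lies in the span of \<open>Bs\<close>. Inclusion thus
  means that the \<open>As\<close>-parts of the relations span the whole free module, which
  \<open>spanning\<close> decides.\<close>

definition span_subset :: "nat \<Rightarrow> 'k::field fvec list \<Rightarrow> 'k fvec list \<Rightarrow> bool" where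
  "span_subset m As Bs = spanning (length As)
     (map (\<lambda>u i. if i < length As then u i else []) (kernel m (As @ Bs)))"

end

section \<open>Computability of the algorithms over the field of coefficients\<close>

locale computable_free_group = free_group r x
  for r :: nat and x :: "nat \<Rightarrow> 'f::group_add" +
  fixes \<nu> :: "nat \<Rightarrow> 'k::field option"
  assumes field: "computable_field \<nu>"
begin

definition K_rep :: "'k rep" where
  "K_rep i a \<longleftrightarrow> \<nu> i = Some a"

abbreviation word_rep :: "(nat \<times> bool) list rep" where
  "word_rep \<equiv> list_rep (letter_rep r)"

abbreviation formal_rep :: "'k formal rep" where
  "formal_rep \<equiv> list_rep (prod_rep K_rep word_rep)"

abbreviation vec_rep :: "'k fvec rep" where
  "vec_rep \<equiv> fun_rep [] formal_rep"

abbreviation row_rep :: "'k row rep" where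
  "row_rep \<equiv> prod_rep vec_rep (fun_rep 0 K_rep)"

abbreviation state_rep :: "'k state rep" where
  "state_rep \<equiv> prod_rep nat_rep (prod_rep (list_rep row_rep) (prod_rep (list_rep row_rep)
     (prod_rep (list_rep vec_rep) (list_rep (prod_rep row_rep nat_rep)))))"

lemma ex_K_rep: "\<exists>i. K_rep i a"
  using field by (simp add: computable_field_def K_rep_def)

lemma computable_K: "computable A K_rep (\<lambda>e. a)"
proof -
  obtain i where "K_rep i a" using ex_K_rep[of a] by (elim exE) (rule that)
  then show ?thesis by (rule computable_const)
qed

lemma computable_plus:
  assumes "computable A K_rep f" "computable A K_rep g"
  shows "computable A K_rep (\<lambda>e. f e + g e)"
proof -
  obtain p where p: "partial_recursive p" "\<forall>i j a b. \<nu> i = Some a \<and> \<nu> j = Some b \<longrightarrow>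
      (\<exists>k. p (prod_encode (i, j)) = Some k \<and> \<nu> k = Some (a + b))"
    using field unfolding computable_field_def by (elim conjE exE) (rule that)
  have "computable (prod_rep K_rep K_rep) K_rep (\<lambda>t. fst t + snd t)"
    by (rule computableI2[OF p(1)]) (use p(2) in \<open>simp add: K_rep_def\<close>)
  from computable_compose[OF this computable_Pair[OF assms]] show ?thesis by simp
qed

lemma computable_times:
  assumes "computable A K_rep f" "computable A K_rep g"
  shows "computable A K_rep (\<lambda>e. f e * g e)"
proof -
  obtain p where p: "partial_recursive p" "\<forall>i j a b. \<nu> i = Some a \<and> \<nu> j = Some b \<longrightarrow>
      (\<exists>k. p (prod_encode (i, j)) = Some k \<and> \<nu> k = Some (a * b))"
    using field unfolding computable_field_def by (elim conjE exE) (rule that)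
  have "computable (prod_rep K_rep K_rep) K_rep (\<lambda>t. fst t * snd t)"
    by (rule computableI2[OF p(1)]) (use p(2) in \<open>simp add: K_rep_def\<close>)
  from computable_compose[OF this computable_Pair[OF assms]] show ?thesis by simp
qed

lemma computable_uminus:
  assumes "computable A K_rep f"
  shows "computable A K_rep (\<lambda>e. - f e)"
proof -
  obtain p where p: "partial_recursive p" "\<forall>i a. \<nu> i = Some a \<longrightarrow> (\<exists>k. p i = Some k \<and> \<nu> k = Some (- a))"
    using field unfolding computable_field_def by (elim conjE exE) (rule that)
  have "computable K_rep K_rep uminus"
    by (rule computableI[OF p(1)]) (use p(2) in \<open>simp add: K_rep_def\<close>)
  from computable_compose[OF this assms] show ?thesis .
qed

lemma computable_minus:
  assumes "computable A K_rep f" "computable A K_rep g"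
  shows "computable A K_rep (\<lambda>e. f e - g e)"
  using computable_plus[OF assms(1) computable_uminus[OF assms(2)]] by simp

lemma computable_eq_K:
  assumes "computable A K_rep f" "computable A K_rep g"
  shows "computable A bool_rep (\<lambda>e. f e = g e)"
proof -
  obtain p where p: "partial_recursive p" "\<forall>i j a b. \<nu> i = Some a \<and> \<nu> j = Some b \<longrightarrow>
      p (prod_encode (i, j)) = Some (if a = b then 1 else 0)"
    using field unfolding computable_field_def by (elim conjE exE) (rule that)
  have "computable (prod_rep K_rep K_rep) bool_rep (\<lambda>t. fst t = snd t)"
    by (rule computableI2[OF p(1)]) (use p(2) in \<open>simp add: K_rep_def bool_rep_def of_bool_def\<close>)
  from computable_compose[OF this computable_Pair[OF assms]] show ?thesis by simp
qed

text \<open>The given algorithm for inverses may diverge at 0, whereas both branches of a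
  conditional get evaluated. The argument 0 is therefore replaced by 1 before inverting, and the
  result is corrected to \<open>inverse 0 = 0\<close> afterwards.\<close>

lemma computable_inverse:
  assumes "computable A K_rep f"
  shows "computable A K_rep (\<lambda>e. inverse (f e))"
proof -
  obtain p where p: "partial_recursive p" "\<forall>i a. \<nu> i = Some a \<and> a \<noteq> 0 \<longrightarrow>
      (\<exists>k. p i = Some k \<and> \<nu> k = Some (inverse a))"
    using field unfolding computable_field_def by (elim conjE exE) (rule that)
  define nz where "nz i a \<longleftrightarrow> K_rep i a \<and> a \<noteq> 0" for i a
  have "computable nz K_rep inverse"
    by (rule computableI[OF p(1)]) (use p(2) in \<open>simp add: nz_def K_rep_def\<close>)
  moreover have "computable K_rep nz (\<lambda>a. if a = 0 then 1 else a)"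
  proof -
    have "computable K_rep K_rep (\<lambda>a. if a = 0 then 1 else a)"
      by (rule computable_If computable_eq_K computable_K computable_id)+
    then obtain q where q: "partial_recursive q"
      "\<forall>n a. K_rep n a \<longrightarrow> (\<exists>k. q n = Some k \<and> K_rep k (if a = 0 then 1 else a))"
      by (rule computableE)
    show ?thesis
    proof (rule computableI[OF q(1)])
      fix n a
      assume "K_rep n a"
      with q(2) obtain k where "q n = Some k" "K_rep k (if a = 0 then 1 else a)" by blast
      then show "\<exists>k. q n = Some k \<and> nz k (if a = 0 then 1 else a)"
        by (intro exI[of _ k]) (simp add: nz_def)
    qed
  qed
  ultimately have "computable K_rep K_rep (\<lambda>a. inverse (if a = 0 then 1 else a))"
    by (rule computable_compose)
  then have "computable K_rep K_rep (\<lambda>a. if a = 0 then 0 else inverse (if a = 0 then 1 else a))"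
    by - (rule computable_If computable_eq_K computable_K computable_id | assumption)+
  moreover have "(if a = 0 then 0 else inverse (if a = 0 then 1 else a)) = inverse a" for a :: 'k
    by simp
  ultimately have "computable K_rep K_rep inverse" by simp
  from computable_compose[OF this assms] show ?thesis .
qed

lemma formal_rep_Nil: "formal_rep 0 []"
  by (simp add: list_rep_def)

lemma vec_rep_Nil: "vec_rep 0 (\<lambda>_. [])"
  by (auto simp: fun_rep_def list_rep_def nth_default_def intro!: exI[of _ "[]"])

lemma computable_vec_app: 
  "computable A (prod_rep vec_rep C) f \<Longrightarrow> computable A nat_rep i \<Longrightarrow> computable A formal_rep (\<lambda>e. fst (f e) (i e))"
  "computable A (prod_rep C vec_rep) g \<Longrightarrow> computable A nat_rep i \<Longrightarrow> computable A formal_rep (\<lambda>e. snd (g e) (i e))"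
  "computable A (list_rep vec_rep) h \<Longrightarrow> computable A nat_rep j \<Longrightarrow> computable A nat_rep i \<Longrightarrow>
     computable A formal_rep (\<lambda>e. nth_default (\<lambda>_. []) (h e) (j e) (i e))"
proof -
  show "computable A (prod_rep vec_rep C) f \<Longrightarrow> computable A nat_rep i \<Longrightarrow> computable A formal_rep (\<lambda>e. fst (f e) (i e))"
    by (rule computable_apply_fst[where B = formal_rep, OF _ _ formal_rep_Nil])
  show "computable A (prod_rep C vec_rep) g \<Longrightarrow> computable A nat_rep i \<Longrightarrow> computable A formal_rep (\<lambda>e. snd (g e) (i e))"
    by (rule computable_apply_snd[where B = formal_rep, OF _ _ formal_rep_Nil])
  assume "computable A (list_rep vec_rep) h" "computable A nat_rep j" "computable A nat_rep i"
  then show "computable A formal_rep (\<lambda>e. nth_default (\<lambda>_. []) (h e) (j e) (i e))"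
    by (rule computable_apply[where B = formal_rep, OF computable_nth_default[where B = vec_rep, OF _ _ vec_rep_Nil] _ formal_rep_Nil])
qed

lemma ex_K_fun_rep: "\<exists>k. fun_rep 0 K_rep k (\<lambda>_. 0)"
  by (rule exI[of _ 0]) (auto simp: fun_rep_def list_rep_def nth_default_def intro!: exI[of _ "[]"])

lemma computable_K_app:
  assumes "computable A (prod_rep C (fun_rep 0 K_rep)) f" "computable A nat_rep i"
  shows "computable A K_rep (\<lambda>e. snd (f e) (i e))"
proof -
  obtain i where "K_rep i 0" using ex_K_rep[of 0] by (elim exE) (rule that)
  then show ?thesis by (rule computable_apply_snd[OF assms])
qed

lemma computable_nth_row:
  assumes "computable A (list_rep row_rep) f" "computable A nat_rep i"
  shows "computable A row_rep (\<lambda>e. nth_default zero_row (f e) (i e))"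
proof -
  obtain k where "fun_rep 0 K_rep k (\<lambda>_. 0)" using ex_K_fun_rep by (elim exE) (rule that)
  then have "row_rep (prod_encode (0, k)) zero_row"
    unfolding zero_row_def by (rule prod_repI[where A = vec_rep and B = "fun_rep 0 K_rep" and i = 0 and a = "\<lambda>_. []" and b = "\<lambda>_. 0",
          OF vec_rep_Nil])
  then show ?thesis by (rule computable_nth_default[OF assms])
qed

lemma computable_nth_nat:
  assumes "computable A (list_rep nat_rep) f" "computable A nat_rep i"
  shows "computable A nat_rep (\<lambda>e. nth_default 0 (f e) (i e))"
  by (rule computable_nth_default[OF assms refl])

lemmas K_rules = computable_rules computable_eq_K computable_plus computable_times computable_uminus computable_minus
  computable_inverse computable_vec_app computable_K_app computable_nth_row computable_nth_nat
  computable_fst computable_snd computable_K computable_nat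

lemma computable_formal_mult:
  assumes "computable A formal_rep f" "computable A formal_rep g"
  shows "computable A formal_rep (\<lambda>e. formal_mult (f e) (g e))"
proof -
  have "computable (prod_rep formal_rep formal_rep) formal_rep (\<lambda>t. formal_mult (fst t) (snd t))"
    unfolding formal_mult_def by (rule K_rules)+
  from computable_compose[OF this computable_Pair[OF assms]] show ?thesis by simp
qed

lemma computable_eliminate:
  assumes "computable A nat_rep n" "computable A nat_rep d" "computable A nat_rep q"
    "computable A row_rep f" "computable A row_rep g"
  shows "computable A row_rep (\<lambda>e. eliminate (n e) (d e) (q e) (f e) (g e))"
proof -
  have "computable (prod_rep nat_rep (prod_rep nat_rep (prod_rep nat_rep (prod_rep row_rep row_rep)))) row_rep
      (\<lambda>t. eliminate (fst t) (fst (snd t)) (fst (snd (snd t))) (fst (snd (snd (snd t)))) (snd (snd (snd (snd t)))))"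
    unfolding eliminate_def add_multiple_def by (rule K_rules computable_formal_mult)+
  from computable_compose[OF this computable_Pair[OF assms(1) computable_Pair[OF assms(2)
        computable_Pair[OF assms(3) computable_Pair[OF assms(4,5)]]]]] show ?thesis by simp
qed

lemma computable_pos: "computable A nat_rep f \<Longrightarrow> computable A (idx_rep r) (\<lambda>e. f e mod r)"
  using r by (intro computable_mod_idx) simp_all

lemma computable_gen_word:
  assumes "computable A nat_rep f" "computable A bool_rep b"
  shows "computable A word_rep (\<lambda>e. gen_word (b e) (f e))"
  unfolding gen_word_def by (rule K_rules computable_pos assms)+

lemma computable_clear:
  assumes "computable A nat_rep n" "computable A nat_rep d" "computable A nat_rep q"
    "computable A row_rep f" "computable A row_rep g"
  shows "computable A row_rep (\<lambda>e. clear (n e) (d e) (q e) (f e) (g e))"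
proof -
  have "computable (prod_rep nat_rep (prod_rep nat_rep (prod_rep nat_rep (prod_rep row_rep row_rep)))) row_rep
      (\<lambda>t. clear (fst t) (fst (snd t)) (fst (snd (snd t))) (fst (snd (snd (snd t)))) (snd (snd (snd (snd t)))))"
    unfolding clear_def add_multiple_def by (rule computable_gen_word K_rules computable_formal_mult)+
  from computable_compose[OF this computable_Pair[OF assms(1) computable_Pair[OF assms(2)
        computable_Pair[OF assms(3) computable_Pair[OF assms(4,5)]]]]] show ?thesis by simp
qed

lemma computable_outside:
  assumes "computable A nat_rep i" "computable A nat_rep d" "computable A row_rep f"
  shows "computable A (list_rep nat_rep) (\<lambda>e. outside (i e) (d e) (f e))"
proof -
  have "computable (prod_rep nat_rep (prod_rep nat_rep row_rep)) (list_rep nat_rep)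
      (\<lambda>t. outside (fst t) (fst (snd t)) (snd (snd t)))"
    unfolding outside_def by (rule K_rules)+
  from computable_compose[OF this computable_Pair[OF assms(1) computable_Pair[OF assms(2,3)]]]
  show ?thesis by simp
qed

lemma computable_support:
  assumes "computable A nat_rep d" "computable A row_rep f"
  shows "computable A (list_rep nat_rep) (\<lambda>e. support (d e) (f e))"
proof -
  have "computable (prod_rep nat_rep row_rep) (list_rep nat_rep) (\<lambda>t. support (fst t) (snd t))"
    unfolding support_def by (rule K_rules)+
  from computable_compose[OF this computable_Pair[OF assms]] show ?thesis by simp
qed

lemma computable_reduce_step:
  assumes "computable A nat_rep n" "computable A nat_rep d" "computable A state_rep f"
  shows "computable A state_rep (\<lambda>e. reduce_step (n e) (d e) (f e))"
proof -
  have "computable (prod_rep nat_rep (prod_rep nat_rep state_rep)) state_rep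
      (\<lambda>t. reduce_step (fst t) (fst (snd t)) (snd (snd t)))"
    unfolding reduce_step_def case_prod_beta
    by (rule K_rules computable_tl computable_outside computable_support computable_eliminate computable_clear)+
  from computable_compose[OF this computable_Pair[OF assms(1) computable_Pair[OF assms(2,3)]]]
  show ?thesis by simp
qed

lemma computable_reduce:
  assumes "computable A nat_rep n" "computable A nat_rep d" "computable A (list_rep row_rep) f"
  shows "computable A state_rep (\<lambda>e. reduce (n e) (d e) (f e))"
proof -
  have "computable (prod_rep nat_rep (prod_rep nat_rep (list_rep row_rep))) state_rep
      (\<lambda>t. reduce (fst t) (fst (snd t)) (snd (snd t)))"
    unfolding reduce_def by (rule K_rules computable_funpow computable_reduce_step)+
  from computable_compose[OF this computable_Pair[OF assms(1) computable_Pair[OF assms(2,3)]]]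
  show ?thesis by simp
qed

abbreviation linear_rep :: "(instr list \<times> (nat \<times> nat \<times> 'k) list) rep" where
  "linear_rep \<equiv> prod_rep (list_rep (instr_rep r)) (list_rep (prod_rep nat_rep (prod_rep nat_rep K_rep)))"

lemma computable_linearize:
  assumes "computable A nat_rep m" "computable A (list_rep vec_rep) f"
  shows "computable A linear_rep (\<lambda>e. linearize (m e) (f e))"
proof -
  have "computable (prod_rep nat_rep (list_rep vec_rep)) linear_rep (\<lambda>t. linearize (fst t) (snd t))"
    unfolding linearize_def matrix_terms_def add_term_def add_word_def add_letter_def
    by (rule computable_fold K_rules)+
  from computable_compose[OF this computable_Pair[OF assms]] show ?thesis by simp
qed

lemma computable_entry_row:
  assumes "computable A nat_rep n" "computable A nat_rep d"
    "computable A (list_rep (prod_rep nat_rep (prod_rep nat_rep K_rep))) f" "computable A nat_rep l"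
  shows "computable A row_rep (\<lambda>e. entry_row (n e) (d e) (f e) (l e))"
proof -
  have "computable (prod_rep nat_rep (prod_rep nat_rep (prod_rep
        (list_rep (prod_rep nat_rep (prod_rep nat_rep K_rep))) nat_rep))) row_rep
      (\<lambda>t. entry_row (fst t) (fst (snd t)) (fst (snd (snd t))) (snd (snd (snd t))))"
    unfolding entry_row_def by (rule computable_fold K_rules)+
  from computable_compose[OF this computable_Pair[OF assms(1) computable_Pair[OF assms(2)
        computable_Pair[OF assms(3,4)]]]] show ?thesis by simp
qed

lemma computable_Suc_idx: "computable A (idx_rep r) f \<Longrightarrow> computable A nat_rep (\<lambda>e. Suc (f e))"
  by (rule computable_Suc[OF computable_idx])

lemma computable_vec_Nil: "computable A vec_rep (\<lambda>e _. [])"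
  by (rule computable_const[where B = vec_rep, OF vec_rep_Nil])

lemma computable_instr_row:
  assumes "computable A nat_rep d" "computable A (instr_rep r) f"
  shows "computable A row_rep (\<lambda>e. instr_row (d e) (f e))"
proof -
  let ?E = "prod_rep (prod_rep nat_rep (instr_rep r)) nat_rep"
  have i: "computable ?E nat_rep (\<lambda>t. Suc (fst (snd (snd (snd (fst t))))))"
    by (rule computable_Suc_idx computable_fst computable_snd computable_id)+
  have "computable (prod_rep nat_rep (instr_rep r)) row_rep (\<lambda>t. instr_row (fst t) (snd t))"
    unfolding instr_row_def by (rule i computable_vec_Nil K_rules)+
  from computable_compose[OF this computable_Pair[OF assms]] show ?thesis by simp
qed

lemma computable_reduced_state:
  assumes "computable A nat_rep m" "computable A (list_rep vec_rep) f"
  shows "computable A state_rep (\<lambda>e. reduced_state (m e) (f e))"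
proof -
  have "computable (prod_rep nat_rep (list_rep vec_rep)) state_rep (\<lambda>t. reduced_state (fst t) (snd t))"
    unfolding reduced_state_def linear_rows_def num_cols_def
    by (rule computable_reduce computable_linearize computable_entry_row computable_instr_row K_rules)+
  from computable_compose[OF this computable_Pair[OF assms]] show ?thesis by simp
qed

lemma computable_kernel:
  assumes "computable A nat_rep m" "computable A (list_rep vec_rep) f"
  shows "computable A (list_rep vec_rep) (\<lambda>e. kernel (m e) (f e))"
  unfolding kernel_def by (rule computable_fst computable_snd computable_reduced_state assms)+

lemma computable_spanning:
  assumes "computable A nat_rep m" "computable A (list_rep vec_rep) f"
  shows "computable A bool_rep (\<lambda>e. spanning (m e) (f e))"
proof -
  \<comment> \<open>Bounded quantifiers become emptiness tests of filtered lists, for which rules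
    exist.\<close>
  have "spanning m Es \<longleftrightarrow> filter (\<lambda>c. filter (\<lambda>z. c = snd z div Suc r) (snd (snd (snd (snd (reduced_state m Es))))) = [])
      [0..<num_cols m Es] = []" for m and Es :: "'k fvec list"
    unfolding spanning_def pivot_cols_def filter_empty_conv image_iff by auto
  moreover have "computable (prod_rep nat_rep (list_rep vec_rep)) bool_rep
      (\<lambda>t. filter (\<lambda>c. filter (\<lambda>z. c = snd z div Suc r) (snd (snd (snd (snd (reduced_state (fst t) (snd t)))))) = [])
      [0..<num_cols (fst t) (snd t)] = [])"
    unfolding num_cols_def by (rule computable_reduced_state computable_linearize K_rules)+
  ultimately have "computable (prod_rep nat_rep (list_rep vec_rep)) bool_rep (\<lambda>t. spanning (fst t) (snd t))"
    by simp
  from computable_compose[OF this computable_Pair[OF assms]] show ?thesis by simp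
qed

lemma computable_formal_star:
  assumes "computable A formal_rep f"
  shows "computable A formal_rep (\<lambda>e. formal_star (f e))"
proof -
  have "computable formal_rep formal_rep formal_star"
    unfolding formal_star_def by (rule K_rules)+
  from computable_compose[OF this assms] show ?thesis .
qed

lemma computable_transpose_star:
  assumes "computable A nat_rep g" "computable A nat_rep h" "computable A (list_rep vec_rep) f"
  shows "computable A (list_rep vec_rep) (\<lambda>e. transpose_star (g e) (h e) (f e))"
proof -
  have "computable (prod_rep nat_rep (prod_rep nat_rep (list_rep vec_rep))) (list_rep vec_rep)
      (\<lambda>t. transpose_star (fst t) (fst (snd t)) (snd (snd t)))"
    unfolding transpose_star_def by (rule computable_formal_star K_rules)+
  from computable_compose[OF this computable_Pair[OF assms(1) computable_Pair[OF assms(2,3)]]]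
  show ?thesis by simp
qed

lemma computable_formal_comb:
  assumes "computable A nat_rep m" "computable A (list_rep vec_rep) f" "computable A vec_rep u"
  shows "computable A vec_rep (\<lambda>e. formal_comb (m e) (f e) (u e))"
proof -
  have "computable (prod_rep nat_rep (prod_rep (list_rep vec_rep) vec_rep)) vec_rep
      (\<lambda>t. formal_comb (fst t) (fst (snd t)) (snd (snd t)))"
    unfolding formal_comb_def by (rule computable_formal_mult K_rules)+
  from computable_compose[OF this computable_Pair[OF assms(1) computable_Pair[OF assms(2,3)]]]
  show ?thesis by simp
qed

lemma computable_functionals:
  assumes "computable A nat_rep m" "computable A (list_rep vec_rep) f" "computable A (list_rep vec_rep) g"
  shows "computable A (list_rep vec_rep) (\<lambda>e. functionals (m e) (f e) (g e))"
proof -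
  have "computable (prod_rep nat_rep (prod_rep (list_rep vec_rep) (list_rep vec_rep))) (list_rep vec_rep)
      (\<lambda>t. functionals (fst t) (fst (snd t)) (snd (snd t)))"
    unfolding functionals_def relations_def by (rule computable_kernel computable_transpose_star K_rules)+
  from computable_compose[OF this computable_Pair[OF assms(1) computable_Pair[OF assms(2,3)]]]
  show ?thesis by simp
qed

lemma computable_closure_gens:
  assumes "computable A nat_rep m" "computable A (list_rep vec_rep) f" "computable A (list_rep vec_rep) g"
  shows "computable A (list_rep vec_rep) (\<lambda>e. closure_gens (m e) (f e) (g e))"
proof -
  have "computable (prod_rep nat_rep (prod_rep (list_rep vec_rep) (list_rep vec_rep))) (list_rep vec_rep)
      (\<lambda>t. closure_gens (fst t) (fst (snd t)) (snd (snd t)))"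
    unfolding closure_gens_def
    by (rule computable_kernel computable_transpose_star computable_functionals computable_formal_comb K_rules)+
  from computable_compose[OF this computable_Pair[OF assms(1) computable_Pair[OF assms(2,3)]]]
  show ?thesis by simp
qed

lemma computable_span_subset:
  assumes "computable A nat_rep m" "computable A (list_rep vec_rep) f" "computable A (list_rep vec_rep) g"
  shows "computable A bool_rep (\<lambda>e. span_subset (m e) (f e) (g e))"
proof -
  have "computable (prod_rep nat_rep (prod_rep (list_rep vec_rep) (list_rep vec_rep))) bool_rep
      (\<lambda>t. span_subset (fst t) (fst (snd t)) (snd (snd t)))"
    unfolding span_subset_def by (rule computable_spanning computable_kernel K_rules)+
  from computable_compose[OF this computable_Pair[OF assms(1) computable_Pair[OF assms(2,3)]]]
  show ?thesis by simp
qed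

end

section \<open>Algebraic closures\<close>

context lmodule
begin

lemma lindep_appendI:
  assumes "lindep s ys"
    and "\<And>a. (\<Sum>i<length xs. s (a i) (xs ! i)) \<in> lspan s ys \<Longrightarrow> \<forall>i<length xs. a i = 0"
  shows "lindep s (xs @ ys)"
  using assms(2)
proof (induction xs)
  case Nil
  then show ?case using assms(1) by simp
next
  case (Cons x xs)
  have shift: "c = 0 \<and> (\<forall>i<length xs. a i = 0)"
    if "s c x + (\<Sum>i<length xs. s (a i) (xs ! i)) \<in> lspan s ys" for c a
  proof -
    have "(\<Sum>i<length (x # xs). s (case_nat c a i) ((x # xs) ! i)) \<in> lspan s ys"
      using that by (simp add: sum.lessThan_Suc_shift del: sum.lessThan_Suc)
    from Cons.prems[OF this] have *: "\<forall>i<length (x # xs). case_nat c a i = 0" .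
    show ?thesis using *[rule_format, of 0] *[rule_format, of "Suc _"] by auto
  qed
  have "lindep s (xs @ ys)"
  proof (rule Cons.IH)
    fix a
    assume "(\<Sum>i<length xs. s (a i) (xs ! i)) \<in> lspan s ys"
    then show "\<forall>i<length xs. a i = 0" using shift[of 0 a] by simp
  qed
  moreover have "c = 0" if "s c x \<in> lspan s (xs @ ys)" for c
  proof -
    obtain u w where uw: "s c x = u + w" "u \<in> lspan s xs" "w \<in> lspan s ys"
      using \<open>s c x \<in> _\<close> unfolding lspan_append by blast
    obtain a where a: "- u = (\<Sum>i<length xs. s (a i) (xs ! i))"
      using submod_neg[OF submod_lspan uw(2)] unfolding lspan_iff_sum by (elim exE)
    have "s c x + - u = w" using uw(1) by simp
    then show ?thesis using shift[of c a] uw(3) a by simp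
  qed
  ultimately show ?case by simp
qed

lemma lspan_disjoint:
  assumes "lindep s (xs @ ys)" "v \<in> lspan s xs" "v \<in> lspan s ys"
  shows "v = 0"
  using assms
proof (induction xs arbitrary: v)
  case (Cons x xs)
  obtain a u where v: "v = s a x + u" "u \<in> lspan s xs" using Cons.prems(2) by auto
  have "s a x = v - u" using v(1) by simp
  moreover have "v \<in> lspan s (xs @ ys)" "u \<in> lspan s (xs @ ys)"
    using subsetD[OF lspan_mono v(2), of "xs @ ys"] subsetD[OF lspan_mono Cons.prems(3), of "xs @ ys"] by simp_all
  ultimately have "s a x \<in> lspan s (xs @ ys)" using submod_diff[OF submod_lspan] by simp
  then have "a = 0" using Cons.prems(1) by simp
  then have "v = u" using v(1) by simp
  then show ?case using Cons v(2) by simp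
qed simp

lemma mod_span_mono: "A \<subseteq> B \<Longrightarrow> mod_span s A \<subseteq> mod_span s B"
  using mod_span_superset[of B] by (intro mod_span_least submod_mod_span) blast

text \<open>Free factors are defined through arbitrary, possibly infinite sets. The coordinate at a
  basis element \<open>b\<close> is therefore described by its kernel, the span of
  \<open>C - {b}\<close>; this lemma gives uniqueness of the coordinate,
  \<open>mod_span_remove\<close> its existence.\<close>

lemma mod_independent_remove:
  assumes ind: "mod_independent s C" and b: "b \<in> C" and a: "s a b \<in> mod_span s (C - {b})"
  shows "a = 0"
proof -
  obtain T c where T: "s a b = (\<Sum>v\<in>T. s (c v) v)" "finite T" "T \<subseteq> C - {b}"
    using a unfolding mod_span_def by blast
  let ?c = "\<lambda>v. if v = b then a else - c v"
  have "(\<Sum>v\<in>insert b T. s (?c v) v) = s a b + (\<Sum>v\<in>T. s (?c v) v)"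
    using T by (subst sum.insert) auto
  also have "(\<Sum>v\<in>T. s (?c v) v) = (\<Sum>v\<in>T. - s (c v) v)"
    using T(3) by (intro sum.cong) (auto simp: s_minus_left)
  also have "s a b + \<dots> = 0" using T(1) by (simp add: sum_negf)
  finally have "finite (insert b T) \<and> insert b T \<subseteq> C \<and> (\<Sum>v\<in>insert b T. s (?c v) v) = 0"
    using T(2,3) b by auto
  from ind[unfolded mod_independent_def, rule_format, OF this, of b] show ?thesis by simp
qed

lemma mod_span_remove:
  assumes "v \<in> mod_span s C"
  shows "\<exists>a. v - s a b \<in> mod_span s (C - {b})"
proof -
  let ?U = "{v. \<exists>a. v - s a b \<in> mod_span s (C - {b})}"
  note sm = submod_mod_span[of "C - {b}"]
  have "submod s ?U"
    unfolding submod_def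
  proof (intro conjI ballI allI)
    show "0 \<in> ?U" using submod_zero[OF sm] by (intro CollectI exI[of _ 0]) simp
  next
    fix v w
    assume "v \<in> ?U" "w \<in> ?U"
    then obtain a a' where "v - s a b \<in> mod_span s (C - {b})" "w - s a' b \<in> mod_span s (C - {b})" by blast
    from submod_add[OF sm this] show "v + w \<in> ?U"
      by (intro CollectI exI[of _ "a + a'"]) (simp add: s_add_left algebra_simps)
  next
    fix c v
    assume "v \<in> ?U"
    then obtain a where "v - s a b \<in> mod_span s (C - {b})" by blast
    from submod_scale[OF sm this, of c] show "s c v \<in> ?U"
      by (intro CollectI exI[of _ "c * a"]) (simp add: s_diff_right s_assoc)
  qed
  moreover have "C \<subseteq> ?U"
  proof
    fix v
    assume v: "v \<in> C"
    show "v \<in> ?U"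
    proof (cases "v = b")
      case True
      then show ?thesis using submod_zero[OF sm] by (intro CollectI exI[of _ 1]) simp
    next
      case False
      then have "v - s 0 b \<in> mod_span s (C - {b})" using v subsetD[OF mod_span_superset, of v "C - {b}"] by simp
      then show ?thesis by blast
    qed
  qed
  ultimately have "mod_span s C \<subseteq> ?U" by (rule mod_span_least)
  then show ?thesis using assms by blast
qed

text \<open>A basis element outside \<open>B\<close> cannot occur in \<open>v\<close>: the rest of
  the combination lies in the span without that element, and so does \<open>v\<close>, so its
  coefficient is zero.\<close>

lemma mod_span_Int_removals:
  assumes ind: "mod_independent s C" and v: "v \<in> mod_span s C"
    and rem: "\<And>b. b \<in> C - B \<Longrightarrow> v \<in> mod_span s (C - {b})"
  shows "v \<in> mod_span s B"
proof -
  obtain T c where T: "v = (\<Sum>u\<in>T. s (c u) u)" "finite T" "T \<subseteq> C"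
    using v unfolding mod_span_def by blast
  have "s (c u) u \<in> mod_span s B" if "u \<in> T" for u
  proof (cases "u \<in> B")
    case True
    then show ?thesis using submod_scale[OF submod_mod_span] mod_span_superset by blast
  next
    case False
    then have "u \<in> C - B" using T(3) that by blast
    then have 1: "v \<in> mod_span s (C - {u})" by (rule rem)
    have "(\<Sum>w\<in>T - {u}. s (c w) w) \<in> mod_span s (C - {u})"
      using T(3) mod_span_superset[of "C - {u}"]
      by (intro submod_sum[OF submod_mod_span] submod_scale[OF submod_mod_span]) blast
    moreover have "s (c u) u = v - (\<Sum>w\<in>T - {u}. s (c w) w)"
      unfolding T(1) using T(2) that by (simp add: sum.remove)
    ultimately have "s (c u) u \<in> mod_span s (C - {u})"
      using submod_diff[OF submod_mod_span 1] by simp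
    then have "c u = 0" using mod_independent_remove[OF ind] T(3) that by blast
    then show ?thesis using submod_zero[OF submod_mod_span] by simp
  qed
  then show ?thesis unfolding T(1) by (rule submod_sum[OF submod_mod_span])
qed

end

lemma sum_lessThan_add: "(\<Sum>l<h + g. f l) = (\<Sum>l<h. f l) + (\<Sum>l<g. f (h + l))"
  for f :: "nat \<Rightarrow> 'a::comm_monoid_add"
  by (induction g) (simp_all add: add.assoc)

section \<open>The involution of the group algebra\<close>

context free_group
begin

text \<open>The linear extension of inversion. It reverses products (\<open>star_mult\<close>), so
  it exchanges left and right modules.\<close>

definition star :: "('f \<Rightarrow>\<^sub>0 'k::field) \<Rightarrow> 'f \<Rightarrow>\<^sub>0 'k" where
  "star a = (\<Sum>g\<in>Poly_Mapping.keys a. Poly_Mapping.single (- g) (Poly_Mapping.lookup a g))"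

lemma lookup_star: "Poly_Mapping.lookup (star a) g = Poly_Mapping.lookup a (- g)"
proof -
  have "Poly_Mapping.lookup (star a) g = (\<Sum>h\<in>Poly_Mapping.keys a. if h = - g then Poly_Mapping.lookup a h else 0)"
    unfolding star_def lookup_sum by (rule sum.cong) (auto simp: lookup_single when_def)
  then show ?thesis by (simp add: in_keys_iff)
qed

lemma star_add [simp]: "star (a + b) = star a + star b"
  by (rule poly_mapping_eqI) (simp add: lookup_star lookup_add)

lemma star_zero [simp]: "star 0 = 0"
  by (rule poly_mapping_eqI) (simp add: lookup_star)

lemma star_sum: "star (sum f T) = (\<Sum>i\<in>T. star (f i))"
  by (induction T rule: infinite_finite_induct) simp_all

lemma star_star [simp]: "star (star a) = a"
  by (rule poly_mapping_eqI) (simp add: lookup_star)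

lemma star_single [simp]: "star (Poly_Mapping.single g c) = Poly_Mapping.single (- g) c"
  by (rule poly_mapping_eqI) (auto simp: lookup_star lookup_single when_def)

lemma star_mult [simp]: "star (a * b) = star b * star a"
proof (induction a rule: poly_mapping_single_induct)
  case (single g c)
  show ?case
    by (induction b rule: poly_mapping_single_induct)
      (simp_all add: mult_single minus_add distrib_left distrib_right mult.commute)
next
  case (add a a')
  then show ?case by (simp add: distrib_left distrib_right)
qed

lemma star_eq_0_iff [simp]: "star a = 0 \<longleftrightarrow> a = 0"
  by (metis star_star star_zero)

lemma word_val_inverse: "word_val x (rev (map (\<lambda>l. (fst l, \<not> snd l)) w)) = - word_val x w"
proof (induction w)
  case (Cons l w)
  then show ?case by (simp add: word_val_append) (simp add: word_val_def letter_val_def minus_add)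
qed (simp add: word_val_def)

lemma formal_val_star: "formal_val (formal_star ts) = star (formal_val ts)"
  by (induction ts) (simp_all add: formal_star_def word_val_inverse)

lemma formal_val_concat_map: "formal_val (concat (map f xs)) = (\<Sum>u\<leftarrow>xs. formal_val (f u))"
  by (induction xs) simp_all

end

section \<open>Lists of vectors that possess codes\<close>

context computable_free_group
begin

text \<open>A list with a code contains only legal words (\<open>represented_good\<close>), and the
  output of a computable function has a code. Hence the legality of all words produced by the
  algorithms follows from their computability and need not be tracked through the reduction.\<close>

definition represented :: "'k fvec list \<Rightarrow> bool" where
  "represented Es \<longleftrightarrow> (\<exists>i. list_rep vec_rep i Es)"

lemma represented_good:
  assumes "represented Es"
  shows "\<forall>E\<in>set Es. good_vec E"
proof
  fix E
  assume E: "E \<in> set Es"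
  obtain i where i: "list_all2 vec_rep (list_decode i) Es"
    using assms unfolding represented_def list_rep_def by (elim exE)
  obtain k where "k < length Es" "E = Es ! k" using E by (metis in_set_conv_nth)
  then have "vec_rep (list_decode i ! k) E" using list_all2_nthD2[OF i] by simp
  then obtain n ts where ts: "list_rep formal_rep n ts" "E = nth_default [] ts"
    unfolding fun_rep_def by (elim exE conjE)
  have letter: "l \<in> {..<r} \<times> UNIV" if "letter_rep r j l" for j l
    using that by (simp add: prod_rep_def idx_rep_def mem_Times_iff)
  have word: "w \<in> words r" if "word_rep j w" for j w
    using that letter unfolding list_rep_def words_def by (fastforce simp: list_all2_conv_all_nth in_set_conv_nth)
  have formal: "\<forall>t\<in>set u. snd t \<in> words r" if "formal_rep j u" for j u
  proof
    fix t
    assume "t \<in> set u"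
    then obtain l where "l < length u" "t = u ! l" by (metis in_set_conv_nth)
    then have "prod_rep K_rep word_rep (list_decode j ! l) t"
      using that list_all2_nthD2 unfolding list_rep_def[of _ j] by metis
    then show "snd t \<in> words r" using word unfolding prod_rep_def by blast
  qed
  have "\<forall>t\<in>set (E c). snd t \<in> words r" for c
  proof (cases "c < length ts")
    case True
    then have "formal_rep (list_decode n ! c) (ts ! c)"
      using ts(1) list_all2_nthD2 unfolding list_rep_def[of _ n] by metis
    then show ?thesis using formal ts(2) True by (simp add: nth_default_def)
  qed (simp add: ts(2) nth_default_def)
  then show "good_vec E" by (simp add: good_vec_def)
qed

lemma computable_represented:
  assumes "computable A (list_rep vec_rep) f" "A n a"
  shows "represented (f a)"
  using assms unfolding computable_def represented_def by blast

lemma represented_kernel: "represented Es \<Longrightarrow> represented (kernel m Es)"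
proof -
  assume "represented Es"
  then obtain i where "list_rep vec_rep i Es" unfolding represented_def by (elim exE)
  then show ?thesis
    by (rule computable_represented[OF computable_kernel[OF computable_nat computable_id]])
qed

lemma represented_transpose_star: "represented Us \<Longrightarrow> represented (transpose_star g h Us)"
proof -
  assume "represented Us"
  then obtain i where "list_rep vec_rep i Us" unfolding represented_def by (elim exE)
  then show ?thesis
    by (rule computable_represented[OF computable_transpose_star[OF computable_nat computable_nat computable_id]])
qed

lemma represented_append:
  assumes "represented Es" "represented Fs"
  shows "represented (Es @ Fs)"
proof -
  obtain i where i: "list_rep vec_rep i Es" using assms(1) unfolding represented_def by (elim exE)
  obtain j where j: "list_rep vec_rep j Fs" using assms(2) unfolding represented_def by (elim exE)
  have "list_rep vec_rep (list_encode (list_decode i @ list_decode j)) (Es @ Fs)"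
    using i j by (simp only: list_rep_def list_encode_inverse list_all2_appendI)
  then show ?thesis unfolding represented_def by (rule exI)
qed

lemma lspan_kernel_transpose:
  assumes "represented Us"
  shows "vspan (map val_vec (kernel (length Us) (transpose_star g h Us))) =
    {p. (\<forall>i\<ge>g. p i = 0) \<and> (\<forall>U\<in>set Us. (\<Sum>l<g. p l * star (formal_val (U (h + l)))) = 0)}"
proof -
  let ?E = "transpose_star g h Us"
  have len: "length ?E = g" by (simp add: transpose_star_def)
  have val: "vec_val (length Us) (?E ! l) = (\<lambda>i. if i < length Us then star (formal_val ((Us ! i) (h + l))) else 0)"
    if "l < g" for l
    using that by (auto simp: fun_eq_iff vec_val_def transpose_star_def formal_val_star nth_default_def)
  have "(\<Sum>l<g. lscale (p l) (vec_val (length Us) (?E ! l))) = 0 \<longleftrightarrow>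
      (\<forall>U\<in>set Us. (\<Sum>l<g. p l * star (formal_val (U (h + l)))) = 0)" for p
  proof -
    have "(\<Sum>l<g. lscale (p l) (vec_val (length Us) (?E ! l))) i =
        (if i < length Us then (\<Sum>l<g. p l * star (formal_val ((Us ! i) (h + l)))) else 0)" for i
      unfolding sum_fun_apply by (cases "i < length Us") (simp_all add: val)
    then show ?thesis by (auto simp: fun_eq_iff all_set_conv_all_nth)
  qed
  then show ?thesis
    using kernel_correct(3)[OF represented_good[OF represented_transpose_star[OF assms]], where m = "length Us"]
    by (simp only: len)
qed

end

section \<open>The closure as double annihilator of an extension\<close>

locale module_extension = computable_free_group r x \<nu>
  for r :: nat and x :: "nat \<Rightarrow> 'f::group_add" and \<nu> :: "nat \<Rightarrow> 'k::field option" +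
  fixes m :: nat and Hs Gs :: "'k fvec list"
  assumes Hs: "represented Hs" and Gs: "represented Gs"
    and sub: "vspan (map (vec_val m) Hs) \<subseteq> vspan (map (vec_val m) Gs)"
begin

abbreviation span :: "'k fvec list \<Rightarrow> (nat \<Rightarrow> 'f \<Rightarrow>\<^sub>0 'k) set" where
  "span Es \<equiv> vspan (map (vec_val m) Es)"

definition comb :: "(nat \<Rightarrow> 'f \<Rightarrow>\<^sub>0 'k) \<Rightarrow> nat \<Rightarrow> 'f \<Rightarrow>\<^sub>0 'k" where
  "comb w = (\<Sum>l<length Gs. lscale (w l) (vec_val m (Gs ! l)))"

definition hcomb :: "(nat \<Rightarrow> 'f \<Rightarrow>\<^sub>0 'k) \<Rightarrow> nat \<Rightarrow> 'f \<Rightarrow>\<^sub>0 'k" where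
  "hcomb w = (\<Sum>l<length Hs. lscale (w l) (vec_val m (Hs ! l)))"

abbreviation Cs :: "'k fvec list" where
  "Cs \<equiv> functionals m Hs Gs"

text \<open>The vector \<open>c\<close> stands for the functional with value
  \<open>star (c l)\<close> on generator \<open>l\<close>. Stored in this way the functionals form a
  left module, and \<open>kernel\<close> can return generators of it.\<close>

abbreviation dot :: "(nat \<Rightarrow> 'f \<Rightarrow>\<^sub>0 'k) \<Rightarrow> (nat \<Rightarrow> 'f \<Rightarrow>\<^sub>0 'k) \<Rightarrow> 'f \<Rightarrow>\<^sub>0 'k" where
  "dot w c \<equiv> (\<Sum>l<length Gs. w l * star (c l))"

definition cl_coeffs :: "(nat \<Rightarrow> 'f \<Rightarrow>\<^sub>0 'k) set" where
  "cl_coeffs = {u. (\<forall>i\<ge>length Gs. u i = 0) \<and> (\<forall>C\<in>set Cs. dot u (val_vec C) = 0)}"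

lemma linear_map_comb: "linear_map (lscale) (lscale) comb"
  by unfold_locales (simp_all add: comb_def L.s_add_left sum.distrib L.s_sum_right L.s_assoc)

lemma linear_map_hcomb: "linear_map (lscale) (lscale) hcomb"
  by unfold_locales (simp_all add: hcomb_def L.s_add_left sum.distrib L.s_sum_right L.s_assoc)

interpretation comb: linear_map "lscale" "lscale" comb
  by (rule linear_map_comb)

lemma comb_cong: "(\<And>l. l < length Gs \<Longrightarrow> w l = w' l) \<Longrightarrow> comb w = comb w'"
  unfolding comb_def by (rule sum.cong) simp_all

lemma span_Gs: "v \<in> span Gs \<longleftrightarrow> (\<exists>w. v = comb w)"
proof -
  have "(\<Sum>i<length (map (vec_val m) Gs). lscale (a i) (map (vec_val m) Gs ! i)) = comb a" for a
    unfolding comb_def by (rule sum.cong) simp_all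
  then show ?thesis unfolding L.lspan_iff_sum by simp
qed

lemma span_Hs: "v \<in> span Hs \<longleftrightarrow> (\<exists>w. v = hcomb w)"
proof -
  have "(\<Sum>i<length (map (vec_val m) Hs). lscale (a i) (map (vec_val m) Hs ! i)) = hcomb a" for a
    unfolding hcomb_def by (rule sum.cong) simp_all
  then show ?thesis unfolding L.lspan_iff_sum by simp
qed

lemma represented_relations: "represented (relations m Hs Gs)"
  unfolding relations_def by (intro represented_kernel represented_append Hs Gs)

lemma represented_Cs: "represented Cs"
  unfolding functionals_def by (intro represented_kernel represented_transpose_star represented_relations)

lemma lspan_relations:
  "vspan (map val_vec (relations m Hs Gs)) =
    {p. (\<forall>i\<ge>length Hs + length Gs. p i = 0) \<and> hcomb p + comb (\<lambda>l. p (length Hs + l)) = 0}"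
proof -
  have "(\<Sum>l<length (Hs @ Gs). lscale (p l) (vec_val m ((Hs @ Gs) ! l))) =
      hcomb p + comb (\<lambda>l. p (length Hs + l))" for p
    unfolding length_append sum_lessThan_add hcomb_def comb_def by (simp add: nth_append)
  then show ?thesis
    unfolding relations_def
    using kernel_correct(3)[OF represented_good[OF represented_append[OF Hs Gs]], where m = m] by simp
qed

text \<open>\<open>kernel\<close> solves the system in which the sum of
  \<open>c l * star (U (h + l))\<close> is zero, with h the length of \<open>Hs\<close> and
  \<open>U\<close> running through generators of the relations. Applying \<open>star\<close> turns
  the sum into that of \<open>U (h + l) * star (c l)\<close>. This is left-linear in
  \<open>U\<close>, so vanishing on generators gives vanishing on all relations.\<close>

lemma lspan_Cs:
  "vspan (map val_vec Cs) =
    {c. (\<forall>i\<ge>length Gs. c i = 0) \<and> (\<forall>p w. hcomb p + comb w = 0 \<longrightarrow> dot w c = 0)}"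
proof -
  let ?h = "length Hs" and ?g = "length Gs"
  let ?K = "vspan (map val_vec (relations m Hs Gs))"
  have "(\<forall>U\<in>set (relations m Hs Gs). (\<Sum>l<?g. c l * star (formal_val (U (?h + l)))) = 0) \<longleftrightarrow>
      (\<forall>p w. hcomb p + comb w = 0 \<longrightarrow> dot w c = 0)" for c
  proof
    assume U: "\<forall>U\<in>set (relations m Hs Gs). (\<Sum>l<?g. c l * star (formal_val (U (?h + l)))) = 0"
    have "?K \<subseteq> {p. (\<Sum>l<?g. p (?h + l) * star (c l)) = 0}"
    proof (rule L.lspan_least)
      show "submod (lscale) {p. (\<Sum>l<?g. p (?h + l) * star (c l)) = 0}"
        by (simp add: submod_def distrib_right sum.distrib mult.assoc flip: sum_distrib_left)
      show "set (map val_vec (relations m Hs Gs)) \<subseteq> {p. (\<Sum>l<?g. p (?h + l) * star (c l)) = 0}"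
      proof
        fix p
        assume "p \<in> set (map val_vec (relations m Hs Gs))"
        then obtain U' where U': "U' \<in> set (relations m Hs Gs)" "p = val_vec U'" unfolding set_map by blast
        have "star (\<Sum>l<?g. c l * star (formal_val (U' (?h + l)))) = 0" using U U'(1) by simp
        then show "p \<in> {p. (\<Sum>l<?g. p (?h + l) * star (c l)) = 0}"
          by (simp add: U'(2) star_sum del: star_eq_0_iff)
      qed
    qed
    then have K: "(\<Sum>l<?g. p (?h + l) * star (c l)) = 0" if "p \<in> ?K" for p using that by blast
    show "\<forall>p w. hcomb p + comb w = 0 \<longrightarrow> dot w c = 0"
    proof (intro allI impI)
      fix p w
      assume pw: "hcomb p + comb w = 0"
      \<comment> \<open>Both coefficient vectors joined into one relation, cut off after the last
        generator as membership in \<open>?K\<close> requires.\<close>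
      define q where "q = (\<lambda>i. if i < ?h then p i else if i < ?h + ?g then w (i - ?h) else 0)"
      have "hcomb q = hcomb p" unfolding hcomb_def by (rule sum.cong) (simp_all add: q_def)
      moreover have "comb (\<lambda>l. q (?h + l)) = comb w" by (rule comb_cong) (simp add: q_def)
      ultimately have "q \<in> ?K" unfolding lspan_relations using pw by (simp add: q_def)
      from K[OF this] show "dot w c = 0" by (simp add: q_def)
    qed
  next
    assume A: "\<forall>p w. hcomb p + comb w = 0 \<longrightarrow> dot w c = 0"
    show "\<forall>U\<in>set (relations m Hs Gs). (\<Sum>l<?g. c l * star (formal_val (U (?h + l)))) = 0"
    proof
      fix U
      assume "U \<in> set (relations m Hs Gs)"
      then have "val_vec U \<in> ?K" by (intro L.lspan_superset) auto
      then have "hcomb (val_vec U) + comb (\<lambda>l. formal_val (U (?h + l))) = 0" unfolding lspan_relations by blast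
      then have "star (\<Sum>l<?g. formal_val (U (?h + l)) * star (c l)) = 0" using A by simp
      then show "(\<Sum>l<?g. c l * star (formal_val (U (?h + l)))) = 0"
        by (simp add: star_sum del: star_eq_0_iff)
    qed
  qed
  then show ?thesis unfolding functionals_def lspan_kernel_transpose[OF represented_relations] by simp
qed

lemma dot_lspan_Cs:
  assumes "u \<in> cl_coeffs" "c \<in> vspan (map val_vec Cs)"
  shows "dot u c = 0"
proof -
  have "vspan (map val_vec Cs) \<subseteq> {c. dot u c = 0}"
  proof (rule L.lspan_least)
    show "submod (lscale) {c. dot u c = 0}"
      by (simp add: submod_def distrib_left sum.distrib flip: mult.assoc sum_distrib_right)
    show "set (map val_vec Cs) \<subseteq> {c. dot u c = 0}"
      using assms(1) unfolding cl_coeffs_def set_map by blast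
  qed
  then show ?thesis using assms(2) by blast
qed

lemma cl_coeffsI:
  assumes "\<And>c. c \<in> vspan (map val_vec Cs) \<Longrightarrow> dot u c = 0"
  shows "(\<lambda>i. if i < length Gs then u i else 0) \<in> cl_coeffs"
proof -
  have "dot u (val_vec C) = 0" if "C \<in> set Cs" for C
    by (intro assms L.lspan_superset) (use that in auto)
  then show ?thesis by (simp add: cl_coeffs_def)
qed

abbreviation Ls :: "'k fvec list" where
  "Ls \<equiv> closure_gens m Hs Gs"

lemma represented_Ls: "represented Ls"
proof -
  obtain i where i: "list_rep vec_rep i Hs" using Hs unfolding represented_def by (elim exE)
  obtain j where j: "list_rep vec_rep j Gs" using Gs unfolding represented_def by (elim exE)
  have "computable (prod_rep (list_rep vec_rep) (list_rep vec_rep)) (list_rep vec_rep)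
      (\<lambda>t. closure_gens m (fst t) (snd t))"
    by (rule computable_closure_gens computable_nat computable_fst computable_snd computable_id)+
  moreover have "prod_rep (list_rep vec_rep) (list_rep vec_rep) (prod_encode (i, j)) (Hs, Gs)"
    by (rule prod_repI) (rule i, rule j)
  ultimately have "represented (closure_gens m (fst (Hs, Gs)) (snd (Hs, Gs)))"
    by (rule computable_represented)
  then show ?thesis by simp
qed

lemma span_Ls: "v \<in> span Ls \<longleftrightarrow> (\<exists>u\<in>cl_coeffs. v = comb u)"
proof -
  let ?D = "kernel (length Cs) (transpose_star (length Gs) 0 Cs)"
  have D: "vspan (map val_vec ?D) = cl_coeffs"
    unfolding lspan_kernel_transpose[OF represented_Cs] cl_coeffs_def by simp
  have val: "vec_val m (formal_comb m Gs U) = comb (val_vec U)" for U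
  proof
    fix c
    have "formal_val (concat (map (\<lambda>l. formal_mult (U l) (nth_default (\<lambda>_. []) Gs l c)) [0..<length Gs])) =
        (\<Sum>l<length Gs. formal_val (U l) * formal_val ((Gs ! l) c))"
      unfolding formal_val_concat_map interv_sum_list_conv_sum_set_nat set_upt atLeast0LessThan
      by (rule sum.cong) (simp_all add: nth_default_def)
    then show "vec_val m (formal_comb m Gs U) c = comb (val_vec U) c"
      by (simp add: vec_val_def formal_comb_def comb_def sum_fun_apply nth_default_def)
  qed
  have "map (vec_val m) Ls = map comb (map val_vec ?D)"
    unfolding closure_gens_def map_map o_def val ..
  then have "span Ls = comb ` cl_coeffs" by (simp only: comb.lspan_map D)
  then show ?thesis by blast
qed

lemma span_Ls_subset: "span Ls \<subseteq> span Gs"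
  using span_Ls span_Gs by blast

text \<open>Written in both systems of generators, an element \<open>hcomb p = comb w\<close> gives
  the relation with parts \<open>- p\<close> and \<open>w\<close>, which every functional in the
  span of \<open>Cs\<close> kills.\<close>

lemma span_Hs_subset: "span Hs \<subseteq> span Ls"
proof
  fix v
  assume v: "v \<in> span Hs"
  then obtain p where p: "v = hcomb p" using span_Hs by blast
  obtain w where w: "v = comb w" using v sub span_Gs by blast
  interpret hcomb: linear_map "lscale" "lscale" hcomb by (rule linear_map_hcomb)
  have "hcomb (- p) + comb w = 0" using p w hcomb.f_diff[of 0 p] by simp
  then have "(\<lambda>i. if i < length Gs then w i else 0) \<in> cl_coeffs"
    by (intro cl_coeffsI) (auto simp: lspan_Cs)
  moreover have "v = comb (\<lambda>i. if i < length Gs then w i else 0)"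
    unfolding w by (rule comb_cong) simp
  ultimately show "v \<in> span Ls" unfolding span_Ls by blast
qed

text \<open>\<open>span Ls\<close> lies in the kernel of every functional on \<open>span Gs\<close> that vanishes on
  \<open>span Hs\<close>. Here the functional takes \<open>a b + w\<close> to \<open>a\<close>.\<close>

lemma span_Ls_subset_hyperplane:
  assumes W: "submod (lscale) W"
    and ex: "\<And>v. v \<in> span Gs \<Longrightarrow> \<exists>a. v - lscale a b \<in> W"
    and unique: "\<And>a. lscale a b \<in> W \<Longrightarrow> a = 0" and H: "span Hs \<subseteq> W"
  shows "span Ls \<subseteq> W"
proof
  fix v
  assume "v \<in> span Ls"
  then obtain u where u: "u \<in> cl_coeffs" "v = comb u" using span_Ls by blast
  have "\<exists>a. vec_val m (Gs ! l) - lscale a b \<in> W" if "l < length Gs" for l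
    by (intro ex L.lspan_superset) (use that in auto)
  then have "\<forall>l\<in>{..<length Gs}. \<exists>a. vec_val m (Gs ! l) - lscale a b \<in> W" by simp
  from bchoice[OF this] obtain c where "\<forall>l\<in>{..<length Gs}. vec_val m (Gs ! l) - lscale (c l) b \<in> W"
    by (elim exE)
  then have c: "vec_val m (Gs ! l) - lscale (c l) b \<in> W" if "l < length Gs" for l
    using that by simp
  have split: "comb w - lscale (\<Sum>l<length Gs. w l * c l) b \<in> W" for w
  proof -
    have "comb w - lscale (\<Sum>l<length Gs. w l * c l) b =
        (\<Sum>l<length Gs. lscale (w l) (vec_val m (Gs ! l) - lscale (c l) b))"
      by (auto simp: fun_eq_iff comb_def sum_fun_apply right_diff_distrib sum_subtractf sum_distrib_right mult.assoc)
    moreover have "\<dots> \<in> W" by (intro L.submod_sum[OF W] L.submod_scale[OF W] c) simp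
    ultimately show ?thesis by simp
  qed
  \<comment> \<open>The coordinate functional, given by its values \<open>c l\<close> on the
    generators, in starred form.\<close>
  define p where "p = (\<lambda>l. if l < length Gs then star (c l) else 0)"
  have dot: "dot w p = (\<Sum>l<length Gs. w l * c l)" for w by (simp add: p_def)
  \<comment> \<open>The values define a functional that vanishes on \<open>span Hs\<close>: a
    relation puts \<open>comb w\<close> into \<open>W\<close>, and then uniqueness makes its
    coordinate at \<open>b\<close> zero.\<close>
  have "dot w p = 0" if "hcomb q + comb w = 0" for q w
  proof -
    have "hcomb q \<in> W" using H span_Hs by blast
    moreover have "comb w = - hcomb q" using that by (simp add: eq_neg_iff_add_eq_0 add.commute)
    ultimately have "comb w \<in> W" using L.submod_neg[OF W] by simp
    then have "comb w - (comb w - lscale (\<Sum>l<length Gs. w l * c l) b) \<in> W"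
      by (rule L.submod_diff[OF W _ split])
    then have "lscale (\<Sum>l<length Gs. w l * c l) b \<in> W" by simp
    then show ?thesis unfolding dot by (rule unique)
  qed
  then have "p \<in> vspan (map val_vec Cs)"
    unfolding lspan_Cs by (simp add: p_def)
  then have "dot u p = 0" by (rule dot_lspan_Cs[OF u(1)])
  then have "(\<Sum>l<length Gs. u l * c l) = 0" unfolding dot .
  then show "v \<in> W" using split[of u] by (simp add: u(2) L.s_zero_left)
qed

lemma vec_val_ge: "\<forall>v\<in>set (map (vec_val m) Es). \<forall>i\<ge>m. v i = 0"
  by (auto simp: vec_val_def)

text \<open>The map \<open>\<phi>\<close> evaluates the generating functionals on a coefficient
  vector, and its kernel consists of the coefficients of elements of \<open>span Ls\<close>. Its
  image is finitely generated, hence has a basis by \<open>exists_basis\<close>. Preimages of that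
  basis, sent to \<open>span Gs\<close> by \<open>comb\<close>, complete a basis of
  \<open>span Ls\<close> to one of \<open>span Gs\<close>.\<close>

lemma ex_complement:
  obtains ls ns where "vindep (ns @ ls)" "vspan ls = span Ls"
    "vspan (ns @ ls) = span Gs"
proof -
  let ?g = "length Gs" and ?q = "length Cs"
  obtain ls where ls: "vindep ls" "vspan ls = span Ls"
    using exists_basis[OF vec_val_ge[of Ls]] by (elim exE conjE) (rule that)
  define \<phi> where "\<phi> = (\<lambda>w t. if t < ?q then dot w (val_vec (Cs ! t)) else 0)"
  interpret \<phi>: linear_map "lscale" "lscale" \<phi>
    by unfold_locales
      (auto simp: \<phi>_def fun_eq_iff distrib_right sum.distrib sum_distrib_left mult.assoc)
  have \<phi>_iff: "\<phi> w = 0 \<longleftrightarrow> comb w \<in> span Ls" for w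
  proof
    assume "\<phi> w = 0"
    have z: "dot w (val_vec C) = 0" if C: "C \<in> set Cs" for C
    proof -
      obtain t where "t < ?q" "C = Cs ! t" using C by (auto simp: in_set_conv_nth)
      then show ?thesis using fun_cong[OF \<open>\<phi> w = 0\<close>, of t] by (simp add: \<phi>_def)
    qed
    have "(\<lambda>i. if i < ?g then w i else 0) \<in> cl_coeffs" using z by (simp add: cl_coeffs_def)
    moreover have "comb w = comb (\<lambda>i. if i < ?g then w i else 0)" by (rule comb_cong) simp
    ultimately show "comb w \<in> span Ls" unfolding span_Ls by blast
  next
    assume "comb w \<in> span Ls"
    then obtain u where u: "u \<in> cl_coeffs" "comb w = comb u" using span_Ls by blast
    \<comment> \<open>Coefficient vectors of the same element need not agree, but their difference
      is a relation with zero \<open>Hs\<close>-part, which the functionals kill.\<close>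
    have rel: "hcomb 0 + comb (w - u) = 0" using u(2) by (simp add: comb.f_diff hcomb_def L.s_zero_left)
    have "dot w (val_vec C) = 0" if C: "C \<in> set Cs" for C
    proof -
      have "val_vec C \<in> vspan (map val_vec Cs)"
        by (rule L.lspan_superset) (use C in auto)
      then have "dot (w - u) (val_vec C) = 0" using rel unfolding lspan_Cs by blast
      moreover have "dot u (val_vec C) = 0" using u(1) C by (simp add: cl_coeffs_def)
      ultimately show ?thesis by (simp add: left_diff_distrib sum_subtractf)
    qed
    then show "\<phi> w = 0" by (simp add: \<phi>_def fun_eq_iff)
  qed
  have "\<forall>v\<in>set (map \<phi> (map unit_vec [0..<?g])). \<forall>i\<ge>?q. v i = 0" by (auto simp: \<phi>_def)
  from exists_basis[OF this] obtain ys where ys: "vindep ys"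
      "vspan ys = vspan (map \<phi> (map unit_vec [0..<?g]))"
    by (elim exE conjE) (rule that)
  have "\<exists>ws. map \<phi> ws = ys"
  proof -
    have "set ys \<subseteq> \<phi> ` vspan (map unit_vec [0..<?g])"
      unfolding \<phi>.lspan_map[symmetric] ys(2)[symmetric] using L.lspan_superset by blast
    then show ?thesis
    proof (induction ys)
      case (Cons y ys)
      then obtain w ws where "y = \<phi> w" "map \<phi> ws = ys" by auto
      then show ?case by (intro exI[of _ "w # ws"]) simp
    qed simp
  qed
  then obtain ws where ws: "map \<phi> ws = ys" by blast
  let ?s = "\<lambda>a. \<Sum>i<length ws. lscale (a i) (ws ! i)"
  have \<phi>_s: "\<phi> (?s a) = (\<Sum>i<length ys. lscale (a i) (ys ! i))" for a
    unfolding \<phi>.f_sum \<phi>.f_scale ws[symmetric] by simp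
  have comb_s: "comb (?s a) = (\<Sum>i<length (map comb ws). lscale (a i) (map comb ws ! i))" for a
    unfolding comb.f_sum comb.f_scale by simp
  have "vindep (map comb ws @ ls)"
  proof (rule L.lindep_appendI[OF ls(1)])
    fix a
    assume "(\<Sum>i<length (map comb ws). lscale (a i) (map comb ws ! i)) \<in> vspan ls"
    then have "\<phi> (?s a) = 0" unfolding \<phi>_iff comb_s ls(2) .
    then have "\<forall>i<length ys. a i = 0" using ys(1) unfolding \<phi>_s L.lindep_iff_sum by blast
    then show "\<forall>i<length (map comb ws). a i = 0" using ws by auto
  qed
  moreover have "vspan (map comb ws @ ls) = span Gs"
  proof (intro equalityI subsetI)
    fix v
    assume "v \<in> vspan (map comb ws @ ls)"
    then obtain u w where "v = u + w" "u \<in> comb ` vspan ws" "w \<in> span Ls"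
      unfolding L.lspan_append comb.lspan_map ls(2) by blast
    then show "v \<in> span Gs"
      using L.submod_add[OF L.submod_lspan] span_Ls_subset span_Gs by blast
  next
    fix v
    assume "v \<in> span Gs"
    then obtain w where w: "v = comb w" using span_Gs by blast
    define w' where "w' = (\<lambda>i. if i < ?g then w i else 0)"
    have v: "v = comb w'" unfolding w by (rule comb_cong) (simp add: w'_def)
    have "w' \<in> vspan (map unit_vec [0..<?g])"
      unfolding L.lspan_iff_sum
    proof (rule exI[of _ w'])
      show "w' = (\<Sum>i<length (map unit_vec [0..<?g]). lscale (w' i) (map unit_vec [0..<?g] ! i))"
        using sum_unit_vec[of w' ?g] by (simp add: w'_def fun_eq_iff)
    qed
    then have "\<phi> w' \<in> vspan ys" unfolding ys(2) \<phi>.lspan_map by blast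
    then obtain a where a: "\<phi> w' = \<phi> (?s a)" unfolding L.lspan_iff_sum \<phi>_s by (elim exE)
    then have "\<phi> (w' - ?s a) = 0" by (simp only: \<phi>.f_diff diff_self)
    then have 1: "comb (w' - ?s a) \<in> vspan ls" unfolding \<phi>_iff ls(2) .
    have 2: "comb (?s a) \<in> vspan (map comb ws)"
      unfolding L.lspan_iff_sum comb_s by (intro exI[of _ a] refl)
    have "v = comb (?s a) + comb (w' - ?s a)" by (simp add: v comb.f_diff)
    then show "v \<in> vspan (map comb ws @ ls)"
      unfolding L.lspan_append using 1 2 by blast
  qed
  ultimately show ?thesis using that[OF _ ls(2)] by simp
qed

lemma free_factor_Ls: "free_factor (lscale) (span Ls) (span Gs)"
proof -
  obtain ls ns where *: "vindep (ns @ ls)" "vspan ls = span Ls"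
    "vspan (ns @ ls) = span Gs" by (rule ex_complement)
  have "mod_basis (lscale) (set ls) (span Ls)"
    using L.lindep_mod_basis[OF L.lindep_appendD2[OF *(1)]] *(2) by simp
  moreover have "mod_basis (lscale) (set (ns @ ls)) (span Gs)"
    using L.lindep_mod_basis[OF *(1)] *(3) by simp
  ultimately show ?thesis unfolding free_factor_def by (intro exI[of _ "set ls"] exI[of _ "set (ns @ ls)"]) simp
qed

text \<open>A proper free factor of \<open>span Ls\<close> misses a basis element \<open>b\<close>.
  Since \<open>span Ls\<close> has a complement in \<open>span Gs\<close>, the coordinate at
  \<open>b\<close> extends to a functional on \<open>span Gs\<close>. If the factor contained
  \<open>span Hs\<close>, this functional would vanish on \<open>span Hs\<close> and hence on
  \<open>span Ls\<close>, which contains \<open>b\<close>.\<close>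

lemma algebraic_ext_Ls: "algebraic_ext (lscale) (span Hs) (span Ls)"
  unfolding algebraic_ext_def
proof (intro conjI notI)
  show "span Hs \<subseteq> span Ls" by (rule span_Hs_subset)
  assume "\<exists>L. free_factor (lscale) L (span Ls) \<and> span Hs \<subseteq> L \<and> L \<subset> span Ls"
  then obtain L B C where L: "span Hs \<subseteq> L" "L \<subset> span Ls" "mod_basis (lscale) B L"
      "B \<subseteq> C" "mod_basis (lscale) C (span Ls)"
    unfolding free_factor_def by (elim exE conjE)
  have C: "mod_vindep C" "mod_vspan C = span Ls"
    and B: "mod_vspan B = L"
    using L by (simp_all add: mod_basis_def)
  have "C \<noteq> B" using L(2) C(2) B by auto
  then obtain b where b: "b \<in> C" "b \<notin> B" using L(4) by blast
  obtain ls ns where *: "vindep (ns @ ls)" "vspan ls = span Ls"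
    "vspan (ns @ ls) = span Gs" by (rule ex_complement)
  let ?C = "mod_vspan (C - {b})" and ?N = "vspan ns"
  \<comment> \<open>The kernel of the extended coordinate at \<open>b\<close>: the complement of
    \<open>span Ls\<close> together with the span of the other basis elements.\<close>
  let ?W = "{q + w | q w. q \<in> ?N \<and> w \<in> ?C}"
  have subC: "?C \<subseteq> span Ls" unfolding C(2)[symmetric] by (rule L.mod_span_mono) blast
  have W: "q + w \<in> ?W" if "q \<in> ?N" "w \<in> ?C" for q w using that by blast
  have CW: "w \<in> ?W" if "w \<in> ?C" for w
    using W[OF L.submod_zero[OF L.submod_lspan] that] by simp
  have "span Ls \<subseteq> ?W"
  proof (rule span_Ls_subset_hyperplane[where b = b])
    show "submod (lscale) ?W"
      unfolding submod_def
    proof (intro conjI ballI allI)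
      show "0 \<in> ?W" by (rule CW[OF L.submod_zero[OF L.submod_mod_span]])
    next
      fix v v'
      assume "v \<in> ?W" "v' \<in> ?W"
      then obtain q w q' w' where *: "v = q + w" "v' = q' + w'" "q \<in> ?N" "q' \<in> ?N" "w \<in> ?C" "w' \<in> ?C" by blast
      have "v + v' = (q + q') + (w + w')" using *(1,2) by (simp add: algebra_simps)
      moreover have "(q + q') + (w + w') \<in> ?W"
        by (intro W L.submod_add[OF L.submod_lspan] L.submod_add[OF L.submod_mod_span] *)
      ultimately show "v + v' \<in> ?W" by simp
    next
      fix a v
      assume "v \<in> ?W"
      then obtain q w where *: "v = q + w" "q \<in> ?N" "w \<in> ?C" by blast
      have "lscale a q + lscale a w \<in> ?W"
        by (intro W L.submod_scale[OF L.submod_lspan] L.submod_scale[OF L.submod_mod_span] *)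
      then show "lscale a v \<in> ?W" unfolding *(1) L.s_add_right .
    qed
  next
    fix v
    assume "v \<in> span Gs"
    then obtain q l where v: "v = q + l" "q \<in> ?N" "l \<in> span Ls"
      unfolding *(3)[symmetric] L.lspan_append *(2) by blast
    then obtain a where a: "l - lscale a b \<in> ?C"
      using L.mod_span_remove[of l C b] C(2) by blast
    have eq: "v - lscale a b = q + (l - lscale a b)" using v(1) by simp
    have "v - lscale a b \<in> ?W" unfolding eq by (rule W[OF v(2) a])
    then show "\<exists>a. v - lscale a b \<in> ?W" by (intro exI[of _ a])
  next
    fix a
    assume "lscale a b \<in> ?W"
    then obtain q w where qw: "lscale a b = q + w" "q \<in> ?N" "w \<in> ?C" by blast
    have "b \<in> span Ls" using b(1) C(2) L.mod_span_superset by blast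
    then have "lscale a b - w \<in> span Ls"
      using L.submod_diff[OF L.submod_lspan L.submod_scale[OF L.submod_lspan]] subC qw(3) by blast
    then have "q \<in> vspan ls" using qw(1) *(2) by simp
    then have "q = 0" using L.lspan_disjoint[OF *(1) qw(2)] by blast
    then show "a = 0" using L.mod_independent_remove[OF C(1) b(1)] qw by simp
  next
    show "span Hs \<subseteq> ?W"
    proof
      fix v
      assume "v \<in> span Hs"
      then have "v \<in> mod_vspan B" using L(1) B by blast
      moreover have "B \<subseteq> C - {b}" using L(4) b(2) by blast
      ultimately have "v \<in> ?C" using L.mod_span_mono by blast
      then show "v \<in> ?W" by (rule CW)
    qed
  qed
  moreover have "b \<in> span Ls" using b(1) C(2) L.mod_span_superset by blast
  ultimately obtain q w where qw: "b = q + w" "q \<in> ?N" "w \<in> ?C" by blast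
  have "q = b - w" using qw(1) by simp
  then have "q \<in> vspan ls"
    using L.submod_diff[OF L.submod_lspan \<open>b \<in> span Ls\<close>] subC qw(3) *(2) by blast
  then have "q = 0" using L.lspan_disjoint[OF *(1) qw(2)] by blast
  then have "lscale 1 b \<in> ?C" using qw by simp
  then have "(1 :: 'f \<Rightarrow>\<^sub>0 'k) = 0" by (rule L.mod_independent_remove[OF C(1) b(1)])
  then show False by simp
qed

lemma is_algebraic_closure_Ls: "is_algebraic_closure (lscale) (span Hs) (span Gs) (span Ls)"
  by (simp add: is_algebraic_closure_def algebraic_ext_Ls free_factor_Ls)

lemma algebraic_ext_iff: "algebraic_ext (lscale) (span Hs) (span Gs) \<longleftrightarrow> span Gs \<subseteq> span Ls"
proof
  assume "algebraic_ext (lscale) (span Hs) (span Gs)"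
  then have "\<not> span Ls \<subset> span Gs"
    using free_factor_Ls span_Hs_subset unfolding algebraic_ext_def by blast
  then show "span Gs \<subseteq> span Ls" using span_Ls_subset by blast
next
  assume "span Gs \<subseteq> span Ls"
  then have "span Ls = span Gs" using span_Ls_subset by blast
  then show "algebraic_ext (lscale) (span Hs) (span Gs)" using algebraic_ext_Ls by simp
qed

text \<open>If a basis \<open>B\<close> of \<open>span Hs\<close> extends to a basis
  \<open>C\<close>, the coordinate at every \<open>b \<in> C - B\<close> vanishes on
  \<open>span Hs\<close> and thus on \<open>span Ls\<close>. The common kernel of these coordinates
  is the span of \<open>B\<close>. The converse holds because the closure is itself a free
  factor.\<close>

lemma free_factor_iff: "free_factor (lscale) (span Hs) (span Gs) \<longleftrightarrow> span Ls \<subseteq> span Hs"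
proof
  assume "free_factor (lscale) (span Hs) (span Gs)"
  then obtain B C where BC: "mod_basis (lscale) B (span Hs)" "B \<subseteq> C"
      "mod_basis (lscale) C (span Gs)"
    unfolding free_factor_def by (elim exE conjE)
  have C: "mod_vindep C" "mod_vspan C = span Gs"
    and B: "mod_vspan B = span Hs"
    using BC by (simp_all add: mod_basis_def)
  have W: "span Ls \<subseteq> mod_vspan (C - {b})" if b: "b \<in> C - B" for b
  proof (rule span_Ls_subset_hyperplane[where b = b])
    show "submod (lscale) (mod_vspan (C - {b}))" by (rule L.submod_mod_span)
    show "\<exists>a. v - lscale a b \<in> mod_vspan (C - {b})" if "v \<in> span Gs" for v
      using L.mod_span_remove[of v C b] C(2) that by blast
    show "a = 0" if "lscale a b \<in> mod_vspan (C - {b})" for a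
      by (rule L.mod_independent_remove[OF C(1) _ that]) (use b in blast)
    show "span Hs \<subseteq> mod_vspan (C - {b})"
      unfolding B[symmetric] by (rule L.mod_span_mono) (use b BC(2) in blast)
  qed
  show "span Ls \<subseteq> span Hs"
  proof
    fix v
    assume v: "v \<in> span Ls"
    have "v \<in> mod_vspan B"
      by (rule L.mod_span_Int_removals[OF C(1)]) (use v W C(2) span_Ls_subset in blast)+
    then show "v \<in> span Hs" using B by simp
  qed
next
  assume "span Ls \<subseteq> span Hs"
  then have "span Ls = span Hs" using span_Hs_subset by blast
  then show "free_factor (lscale) (span Hs) (span Gs)" using free_factor_Ls by simp
qed

end

section \<open>Correctness of the inclusion test\<close>

context computable_free_group
begin

lemma span_subset_correct:
  assumes As: "represented As" and Bs: "represented Bs"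
  shows "span_subset m As Bs \<longleftrightarrow>
    vspan (map (vec_val m) As) \<subseteq> vspan (map (vec_val m) Bs)"
proof -
  let ?a = "length As" and ?b = "length Bs"
  let ?as = "map (vec_val m) As" and ?bs = "map (vec_val m) Bs"
  let ?E = "\<lambda>u i. if i < ?a then u i else [] :: 'k formal"
  let ?T = "kernel m (As @ Bs)"
  define \<rho> where "\<rho> = (\<lambda>p :: nat \<Rightarrow> 'f \<Rightarrow>\<^sub>0 'k. \<lambda>i. if i < ?a then p i else 0)"
  interpret \<rho>: linear_map "lscale" "lscale" \<rho>
    by unfold_locales (auto simp: \<rho>_def fun_eq_iff)
  have good: "\<forall>U\<in>set ?T. good_vec U"
    by (rule represented_good[OF represented_kernel[OF represented_append[OF As Bs]]])
  have goodE: "\<forall>E\<in>set (map ?E ?T). good_vec E"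
  proof
    fix E
    assume "E \<in> set (map ?E ?T)"
    then obtain U where U: "U \<in> set ?T" "E = ?E U" unfolding set_map by blast
    then have "good_vec U" using good by blast
    have "\<forall>t\<in>set (?E U c). snd t \<in> words r" for c
    proof (cases "c < ?a")
      case True
      then have eq: "?E U c = U c" by (simp add: nth_default_def)
      show ?thesis using \<open>good_vec U\<close> unfolding good_vec_def eq by (rule spec)
    qed simp
    then show "good_vec E" unfolding U(2) good_vec_def by blast
  qed
  have val: "map (vec_val ?a) (map ?E ?T) = map \<rho> (map val_vec ?T)"
    by (simp add: \<rho>_def vec_val_def nth_default_def fun_eq_iff)
  define ca where "ca = (\<lambda>p :: nat \<Rightarrow> 'f \<Rightarrow>\<^sub>0 'k. \<Sum>l<?a. lscale (p l) (vec_val m (As ! l)))"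
  define cb where "cb = (\<lambda>p :: nat \<Rightarrow> 'f \<Rightarrow>\<^sub>0 'k. \<Sum>l<?b. lscale (p l) (vec_val m (Bs ! l)))"
  have K: "vspan (map val_vec ?T) =
      {p. (\<forall>i\<ge>?a + ?b. p i = 0) \<and> ca p + cb (\<lambda>l. p (?a + l)) = 0}"
  proof -
    have "(\<Sum>l<length (As @ Bs). lscale (p l) (vec_val m ((As @ Bs) ! l))) =
        ca p + cb (\<lambda>l. p (?a + l))" for p
      unfolding length_append sum_lessThan_add ca_def cb_def by (simp add: nth_append)
    then show ?thesis
      using kernel_correct(3)[OF represented_good[OF represented_append[OF As Bs]], where m = m] by simp
  qed
  have A: "v \<in> vspan ?as \<longleftrightarrow> (\<exists>p. v = ca p)" for v
  proof -
    have "(\<Sum>i<length ?as. lscale (p i) (?as ! i)) = ca p" for p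
      unfolding ca_def by (rule sum.cong) simp_all
    then show ?thesis unfolding L.lspan_iff_sum by simp
  qed
  have B: "v \<in> vspan ?bs \<longleftrightarrow> (\<exists>p. v = cb p)" for v
  proof -
    have "(\<Sum>i<length ?bs. lscale (p i) (?bs ! i)) = cb p" for p
      unfolding cb_def by (rule sum.cong) simp_all
    then show ?thesis unfolding L.lspan_iff_sum by simp
  qed
  have "span_subset m As Bs \<longleftrightarrow> {y. \<forall>c\<ge>?a. y c = 0} \<subseteq> \<rho> ` vspan (map val_vec ?T)"
    unfolding span_subset_def kernel_correct(5)[OF goodE] val \<rho>.lspan_map ..
  also have "\<dots> \<longleftrightarrow> vspan ?as \<subseteq> vspan ?bs"
  proof
    assume sub: "{y. \<forall>c\<ge>?a. y c = 0} \<subseteq> \<rho> ` vspan (map val_vec ?T)"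
    show "vspan ?as \<subseteq> vspan ?bs"
    proof
      fix v
      assume "v \<in> vspan ?as"
      then obtain y where y: "v = ca y" using A by blast
      have "\<rho> y \<in> {y. \<forall>c\<ge>?a. y c = 0}" by (simp add: \<rho>_def)
      then obtain p where p: "p \<in> vspan (map val_vec ?T)" "\<rho> y = \<rho> p" using sub by blast
      have "y l = p l" if "l < ?a" for l using fun_cong[OF p(2), of l] that by (simp add: \<rho>_def)
      then have "ca y = ca p" unfolding ca_def by (intro sum.cong) simp_all
      moreover have "ca p + cb (\<lambda>l. p (?a + l)) = 0" using p(1) unfolding K by blast
      ultimately have "v = - cb (\<lambda>l. p (?a + l))" using y by (simp add: eq_neg_iff_add_eq_0)
      then show "v \<in> vspan ?bs"
        using L.submod_neg[OF L.submod_lspan] B by metis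
    qed
  next
    assume sub: "vspan ?as \<subseteq> vspan ?bs"
    show "{y. \<forall>c\<ge>?a. y c = 0} \<subseteq> \<rho> ` vspan (map val_vec ?T)"
    proof
      fix y :: "nat \<Rightarrow> 'f \<Rightarrow>\<^sub>0 'k"
      assume "y \<in> {y. \<forall>c\<ge>?a. y c = 0}"
      then have y: "y c = 0" if "c \<ge> ?a" for c using that by simp
      have "ca y \<in> vspan ?bs" using A sub by blast
      then have "- ca y \<in> vspan ?bs" by (rule L.submod_neg[OF L.submod_lspan])
      then obtain w where w: "- ca y = cb w" using B by blast
      define p where "p = (\<lambda>i. if i < ?a then y i else if i < ?a + ?b then w (i - ?a) else 0)"
      have "ca p = ca y" unfolding ca_def by (rule sum.cong) (simp_all add: p_def)
      moreover have "cb (\<lambda>l. p (?a + l)) = cb w" unfolding cb_def by (rule sum.cong) (simp_all add: p_def)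
      ultimately have "p \<in> vspan (map val_vec ?T)"
        unfolding K by (simp add: p_def flip: w)
      moreover have "\<rho> p = y" using y by (auto simp: \<rho>_def p_def fun_eq_iff)
      ultimately show "y \<in> \<rho> ` vspan (map val_vec ?T)" by blast
    qed
  qed
  finally show ?thesis .
qed

end

section \<open>Right modules\<close>

context free_group
begin

text \<open>For right modules the involution is applied to every coordinate, which turns right
  multiplication by \<open>a\<close> into left multiplication by \<open>star a\<close>. The identity
  is included as the left case, so that both sides are reduced to left modules by the same
  lemmas.\<close>

definition twist :: "side \<Rightarrow> ('f \<Rightarrow>\<^sub>0 'k::field) \<Rightarrow> 'f \<Rightarrow>\<^sub>0 'k" where
  "twist S a = (case S of Left_Module \<Rightarrow> a | Right_Module \<Rightarrow> star a)"

definition formal_twist :: "side \<Rightarrow> 'k formal \<Rightarrow> 'k formal" where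
  "formal_twist S ts = (case S of Left_Module \<Rightarrow> ts | Right_Module \<Rightarrow> formal_star ts)"

definition twist_vec :: "side \<Rightarrow> (nat \<Rightarrow> 'f \<Rightarrow>\<^sub>0 'k::field) \<Rightarrow> nat \<Rightarrow> 'f \<Rightarrow>\<^sub>0 'k" where
  "twist_vec S v = (\<lambda>i. twist S (v i))"

lemma twist_simps [simp]:
  "twist S (twist S a) = a" "twist S (a + b) = twist S a + twist S b" "twist S 0 = 0"
  "twist S a = 0 \<longleftrightarrow> a = 0"
  by (cases S; simp add: twist_def)+

lemma formal_val_twist: "formal_val (formal_twist S ts) = twist S (formal_val ts)"
  by (cases S) (simp_all add: formal_twist_def twist_def formal_val_star)

lemma twist_vec_twist_vec [simp]: "twist_vec S (twist_vec S v) = v"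
  by (simp add: twist_vec_def)

lemma inj_twist_vec: "inj_on (twist_vec S) A"
  by (rule inj_on_inverseI[where g = "twist_vec S"]) simp

lemma image_twist_vec: "twist_vec S ` twist_vec S ` B = B"
  by (simp add: image_image)

lemma twist_vec_subset_iff: "twist_vec S ` A \<subseteq> twist_vec S ` B \<longleftrightarrow> A \<subseteq> B"
  by (metis image_mono image_twist_vec)

lemma twist_vec_eq_iff: "twist_vec S ` A = twist_vec S ` B \<longleftrightarrow> A = B"
  by (metis image_twist_vec)

lemma twist_vec_scale: "twist_vec S (lscale a v) = scale S (twist S a) (twist_vec S v)"
  by (cases S) (simp_all add: twist_vec_def twist_def scale.simps)

lemma twist_vec_sum: "twist_vec S (sum f T) = (\<Sum>i\<in>T. twist_vec S (f i))"
  by (induction T rule: infinite_finite_induct) (simp_all add: twist_vec_def fun_eq_iff)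

lemma sum_twist_vec:
  "(\<Sum>b\<in>twist_vec S ` T. scale S (c b) b) =
    twist_vec S (\<Sum>b\<in>T. lscale (twist S (c (twist_vec S b))) b)"
  unfolding twist_vec_sum twist_vec_scale by (simp add: sum.reindex[OF inj_twist_vec])

lemma mod_span_twist: "mod_span (scale S) (twist_vec S ` B) = twist_vec S ` mod_vspan B"
proof (intro equalityI subsetI)
  fix v
  assume "v \<in> mod_span (scale S) (twist_vec S ` B)"
  then obtain T c where T: "v = (\<Sum>b\<in>T. scale S (c b) b)" "finite T" "T \<subseteq> twist_vec S ` B"
    unfolding mod_span_def by blast
  let ?T = "twist_vec S ` T"
  have "v = twist_vec S (\<Sum>b\<in>?T. lscale (twist S (c (twist_vec S b))) b)"
    using sum_twist_vec[of S c ?T] by (simp only: T(1) image_twist_vec)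
  moreover have "(\<Sum>b\<in>?T. lscale (twist S (c (twist_vec S b))) b) \<in> mod_vspan B"
  proof (intro L.submod_sum[OF L.submod_mod_span] L.submod_scale[OF L.submod_mod_span])
    fix b
    assume "b \<in> ?T"
    moreover have "?T \<subseteq> B" using image_mono[OF T(3), of "twist_vec S"] by (simp only: image_twist_vec)
    ultimately show "b \<in> mod_vspan B" using L.mod_span_superset[of B] by blast
  qed
  ultimately show "v \<in> twist_vec S ` mod_vspan B" by (rule image_eqI)
next
  fix v
  assume "v \<in> twist_vec S ` mod_vspan B"
  then obtain T c where T: "v = twist_vec S (\<Sum>b\<in>T. lscale (c b) b)" "finite T" "T \<subseteq> B"
    unfolding mod_span_def by blast
  have "v = (\<Sum>b\<in>twist_vec S ` T. scale S (twist S (c (twist_vec S b))) b)"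
    unfolding sum_twist_vec T(1) by simp
  moreover have "finite (twist_vec S ` T)" "twist_vec S ` T \<subseteq> twist_vec S ` B" using T by auto
  ultimately show "v \<in> mod_span (scale S) (twist_vec S ` B)"
    unfolding mod_span_def by (intro CollectI exI[of _ "twist_vec S ` T"] exI conjI)
qed

lemma mod_independent_twist:
  "mod_independent (scale S) (twist_vec S ` B) \<longleftrightarrow> mod_vindep B"
proof
  assume ind: "mod_independent (scale S) (twist_vec S ` B)"
  show "mod_vindep B"
    unfolding mod_independent_def
  proof (intro allI impI)
    fix T c
    assume T: "finite T \<and> T \<subseteq> B \<and> (\<Sum>b\<in>T. lscale (c b) b) = 0"
    have "(\<Sum>b\<in>twist_vec S ` T. scale S (twist S (c (twist_vec S b))) b) = twist_vec S 0"
      unfolding sum_twist_vec using T by simp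
    then have *: "finite (twist_vec S ` T) \<and> twist_vec S ` T \<subseteq> twist_vec S ` B \<and>
        (\<Sum>b\<in>twist_vec S ` T. scale S (twist S (c (twist_vec S b))) b) = 0"
      using T by (auto simp: twist_vec_def fun_eq_iff)
    show "\<forall>b\<in>T. c b = 0"
    proof
      fix b
      assume "b \<in> T"
      then have "twist_vec S b \<in> twist_vec S ` T" by blast
      from ind[unfolded mod_independent_def, rule_format, OF * this] show "c b = 0" by simp
    qed
  qed
next
  assume ind: "mod_vindep B"
  show "mod_independent (scale S) (twist_vec S ` B)"
    unfolding mod_independent_def
  proof (intro allI impI)
    fix T c
    assume T: "finite T \<and> T \<subseteq> twist_vec S ` B \<and> (\<Sum>b\<in>T. scale S (c b) b) = 0"
    let ?T = "twist_vec S ` T"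
    have "twist_vec S (\<Sum>b\<in>?T. lscale (twist S (c (twist_vec S b))) b) = 0"
      unfolding sum_twist_vec[symmetric] image_twist_vec using T by simp
    then have "(\<Sum>b\<in>?T. lscale (twist S (c (twist_vec S b))) b) = 0"
      by (auto simp: twist_vec_def fun_eq_iff)
    moreover have "?T \<subseteq> B"
      using T image_mono[of T "twist_vec S ` B" "twist_vec S"] by (simp only: image_twist_vec)
    ultimately have *: "finite ?T \<and> ?T \<subseteq> B \<and> (\<Sum>b\<in>?T. lscale (twist S (c (twist_vec S b))) b) = 0"
      using T by simp
    show "\<forall>b\<in>T. c b = 0"
    proof
      fix b
      assume "b \<in> T"
      then have "twist_vec S b \<in> ?T" by blast
      from ind[unfolded mod_independent_def, rule_format, OF * this] show "c b = 0" by simp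
    qed
  qed
qed

lemma mod_basis_twist:
  "mod_basis (scale S) (twist_vec S ` B) (twist_vec S ` M) \<longleftrightarrow> mod_basis (lscale) B M"
  by (simp add: mod_basis_def mod_independent_twist mod_span_twist twist_vec_eq_iff)

lemma free_factor_twist:
  "free_factor (scale S) (twist_vec S ` M) (twist_vec S ` N) \<longleftrightarrow> free_factor (lscale) M N"
proof
  assume "free_factor (scale S) (twist_vec S ` M) (twist_vec S ` N)"
  then obtain B C where BC: "mod_basis (scale S) B (twist_vec S ` M)" "B \<subseteq> C" "mod_basis (scale S) C (twist_vec S ` N)"
    unfolding free_factor_def by (elim exE conjE)
  have "mod_basis (lscale) (twist_vec S ` B) M" "mod_basis (lscale) (twist_vec S ` C) N"
    using BC(1,3) mod_basis_twist[of S "twist_vec S ` B" M] mod_basis_twist[of S "twist_vec S ` C" N]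
    by (simp_all only: image_twist_vec)
  then show "free_factor (lscale) M N"
    unfolding free_factor_def using image_mono[OF BC(2)] by (intro exI conjI)
next
  assume "free_factor (lscale) M N"
  then obtain B C where BC: "mod_basis (lscale) B M" "B \<subseteq> C" "mod_basis (lscale) C N"
    unfolding free_factor_def by (elim exE conjE)
  show "free_factor (scale S) (twist_vec S ` M) (twist_vec S ` N)"
    unfolding free_factor_def
    by (intro exI[of _ "twist_vec S ` B"] exI[of _ "twist_vec S ` C"] conjI)
      (simp_all only: mod_basis_twist twist_vec_subset_iff BC)
qed

text \<open>The intermediate \<open>L\<close> ranges over arbitrary sets; each of them is the twist
  of a set because \<open>twist_vec\<close> is an involution, so the two ranges correspond.\<close>

lemma algebraic_ext_twist:
  "algebraic_ext (scale S) (twist_vec S ` M) (twist_vec S ` N) \<longleftrightarrow> algebraic_ext (lscale) M N"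
proof -
  have iff: "free_factor (scale S) (twist_vec S ` L) (twist_vec S ` N) \<and> twist_vec S ` M \<subseteq> twist_vec S ` L \<and>
      twist_vec S ` L \<subset> twist_vec S ` N \<longleftrightarrow> free_factor (lscale) L N \<and> M \<subseteq> L \<and> L \<subset> N" for L
    by (simp only: free_factor_twist twist_vec_subset_iff psubset_eq twist_vec_eq_iff)
  have "(\<exists>L. free_factor (scale S) L (twist_vec S ` N) \<and> twist_vec S ` M \<subseteq> L \<and> L \<subset> twist_vec S ` N) \<longleftrightarrow>
      (\<exists>L. free_factor (lscale) L N \<and> M \<subseteq> L \<and> L \<subset> N)"
  proof
    assume "\<exists>L. free_factor (scale S) L (twist_vec S ` N) \<and> twist_vec S ` M \<subseteq> L \<and> L \<subset> twist_vec S ` N"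
    then obtain L where "free_factor (scale S) L (twist_vec S ` N) \<and> twist_vec S ` M \<subseteq> L \<and> L \<subset> twist_vec S ` N"
      by (elim exE)
    then have "free_factor (lscale) (twist_vec S ` L) N \<and> M \<subseteq> twist_vec S ` L \<and> twist_vec S ` L \<subset> N"
      by (rule iffD1[OF iff[of "twist_vec S ` L", unfolded image_twist_vec]])
    then show "\<exists>L. free_factor (lscale) L N \<and> M \<subseteq> L \<and> L \<subset> N" by (intro exI)
  next
    assume "\<exists>L. free_factor (lscale) L N \<and> M \<subseteq> L \<and> L \<subset> N"
    then obtain L where "free_factor (lscale) L N \<and> M \<subseteq> L \<and> L \<subset> N" by (elim exE)
    then show "\<exists>L. free_factor (scale S) L (twist_vec S ` N) \<and> twist_vec S ` M \<subseteq> L \<and> L \<subset> twist_vec S ` N"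
      unfolding iff[symmetric] by (intro exI)
  qed
  then show ?thesis unfolding algebraic_ext_def by (simp only: twist_vec_subset_iff)
qed

lemma is_algebraic_closure_twist:
  "is_algebraic_closure (scale S) (twist_vec S ` M) (twist_vec S ` N) (twist_vec S ` L) \<longleftrightarrow>
    is_algebraic_closure (lscale) M N L"
  by (simp only: is_algebraic_closure_def algebraic_ext_twist free_factor_twist)

end

section \<open>Codes\<close>

context computable_free_group
begin

lemma eq_prod_encode_iff: "n = prod_encode z \<longleftrightarrow> prod_decode n = z"
  using prod_decode_inverse[of n] prod_encode_inverse[of z] by auto

lemma eq_list_encode_iff: "n = list_encode ns \<longleftrightarrow> list_decode n = ns"
  using list_decode_inverse[of n] list_encode_inverse[of ns] by auto

lemma word_rep_iff: "word_rep n w \<longleftrightarrow> n = word_encode w \<and> w \<in> words r"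
proof -
  have letter: "letter_rep r n l \<longleftrightarrow> n = letter_encode l \<and> l \<in> {..<r} \<times> UNIV" for n l
    by (auto simp: prod_rep_def idx_rep_def bool_rep_def letter_encode_def mem_Times_iff prod_eq_iff
        of_bool_def eq_prod_encode_iff)
  have "list_all2 (letter_rep r) ns w \<longleftrightarrow> ns = map letter_encode w \<and> w \<in> lists ({..<r} \<times> UNIV)" for ns
    by (induction w arbitrary: ns) (auto simp: list_all2_Cons2 letter)
  then show ?thesis
    unfolding list_rep_def word_encode_def words_def eq_list_encode_iff .
qed

text \<open>The prescribed codes are exactly the codes of formal sums, so an algorithm on formal
  sums is one on codes of algebra elements. The field codes inside are arbitrary and are carried
  along unchanged.\<close>

lemma alg_code_iff: "alg_code \<nu> r x n a \<longleftrightarrow> (\<exists>ts. formal_rep n ts \<and> a = formal_val ts)"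
proof
  assume "alg_code \<nu> r x n a"
  then obtain us where us: "n = list_encode (map (\<lambda>(i, w). prod_encode (i, word_encode w)) us)"
      "\<forall>(i, w)\<in>set us. \<nu> i \<noteq> None \<and> w \<in> words r"
      "a = (\<Sum>(i, w)\<leftarrow>us. Poly_Mapping.single (word_val x w) (the (\<nu> i)))"
    unfolding alg_code_def by blast
  let ?ts = "map (\<lambda>(i, w). (the (\<nu> i), w)) us"
  have "list_all2 (prod_rep K_rep word_rep) (map (\<lambda>(i, w). prod_encode (i, word_encode w)) us) ?ts"
    using us(2) by (induction us) (auto simp: prod_rep_def K_rep_def word_rep_iff)
  then have "formal_rep n ?ts" by (simp add: us(1) list_rep_encode)
  moreover have "a = formal_val ?ts" unfolding us(3) formal_val_def by (simp add: case_prod_unfold o_def)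
  ultimately show "\<exists>ts. formal_rep n ts \<and> a = formal_val ts" by blast
next
  assume "\<exists>ts. formal_rep n ts \<and> a = formal_val ts"
  then obtain ts where ts: "list_all2 (prod_rep K_rep word_rep) (list_decode n) ts" "a = formal_val ts"
    unfolding list_rep_def by blast
  have "\<exists>us. ns = map (\<lambda>(i, w). prod_encode (i, word_encode w)) us \<and>
      (\<forall>(i, w)\<in>set us. \<nu> i \<noteq> None \<and> w \<in> words r) \<and>
      formal_val ts = (\<Sum>(i, w)\<leftarrow>us. Poly_Mapping.single (word_val x w) (the (\<nu> i)))"
    if "list_all2 (prod_rep K_rep word_rep) ns ts" for ns
    using that
  proof (induction ts arbitrary: ns rule: list.induct)
    case (Cons t ts)
    then obtain k ks where k: "ns = k # ks" "prod_rep K_rep word_rep k t" "list_all2 (prod_rep K_rep word_rep) ks ts"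
      by (auto simp: list_all2_Cons2)
    obtain us where us: "ks = map (\<lambda>(i, w). prod_encode (i, word_encode w)) us"
      "\<forall>(i, w)\<in>set us. \<nu> i \<noteq> None \<and> w \<in> words r"
      "formal_val ts = (\<Sum>(i, w)\<leftarrow>us. Poly_Mapping.single (word_val x w) (the (\<nu> i)))"
      using Cons.IH[OF k(3)] by blast
    have t: "\<nu> (fst (prod_decode k)) = Some (fst t)" "snd (prod_decode k) = word_encode (snd t)" "snd t \<in> words r"
      using k(2) by (simp_all add: prod_rep_def K_rep_def word_rep_iff)
    have "k = prod_encode (fst (prod_decode k), word_encode (snd t))"
      by (simp add: eq_prod_encode_iff prod_eq_iff t(2))
    then show ?case
      using us t by (intro exI[of _ "(fst (prod_decode k), snd t) # us"]) (auto simp: k(1))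
  qed simp
  from this[OF ts(1)] show "alg_code \<nu> r x n a"
    unfolding alg_code_def ts(2) eq_list_encode_iff .
qed

lemma vec_codeD:
  assumes "vec_code \<nu> r x m n v"
  shows "\<exists>E. vec_rep n E \<and> v = vec_val m E"
proof -
  obtain cs where cs: "n = list_encode cs" "length cs = m" "\<forall>i<m. alg_code \<nu> r x (cs ! i) (v i)" "\<forall>i\<ge>m. v i = 0"
    using assms unfolding vec_code_def by blast
  then have "\<forall>i. \<exists>ts. i < m \<longrightarrow> formal_rep (cs ! i) ts \<and> v i = formal_val ts"
    unfolding alg_code_iff by blast
  then obtain f where f: "\<And>i. i < m \<Longrightarrow> formal_rep (cs ! i) (f i) \<and> v i = formal_val (f i)" by metis
  let ?E = "nth_default [] (map f [0..<m])"
  have "list_rep formal_rep n (map f [0..<m])"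
    unfolding cs(1) list_rep_encode using f cs(2) by (simp add: list_all2_conv_all_nth)
  then have "vec_rep n ?E" unfolding fun_rep_def by blast
  moreover have "v = vec_val m ?E"
    using f cs(4) by (auto simp: vec_val_def nth_default_def fun_eq_iff)
  ultimately show ?thesis by blast
qed

lemma submodule_codeD:
  assumes "submodule_code S \<nu> r x m n M"
  shows "\<exists>Es. list_rep vec_rep n Es \<and> M = mod_span (scale S) (set (map (vec_val m) Es))"
proof -
  obtain cs vs where *: "n = list_encode cs" "list_all2 (vec_code \<nu> r x m) cs vs" "M = mod_span (scale S) (set vs)"
    using assms unfolding submodule_code_def by blast
  have "\<exists>Es. list_all2 vec_rep cs Es \<and> vs = map (vec_val m) Es"
    using *(2)
  proof (induction rule: list_all2_induct)
    case (Cons c cs v vs)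
    then obtain E Es where "vec_rep c E" "v = vec_val m E" "list_all2 vec_rep cs Es" "vs = map (vec_val m) Es"
      using vec_codeD by blast
    then show ?case by (intro exI[of _ "E # Es"]) simp
  qed simp
  then show ?thesis unfolding *(1,3) list_rep_encode by blast
qed

lemma extension_codeD:
  assumes "extension_code S \<nu> r x m n M N"
  shows "\<exists>Hs Gs. prod_rep nat_rep (prod_rep (list_rep vec_rep) (list_rep vec_rep)) n (m, (Hs, Gs)) \<and>
    M = mod_span (scale S) (set (map (vec_val m) Hs)) \<and> N = mod_span (scale S) (set (map (vec_val m) Gs)) \<and> M \<subseteq> N"
proof -
  obtain i j where ij: "n = prod_encode (m, prod_encode (i, j))" "submodule_code S \<nu> r x m i M"
      "submodule_code S \<nu> r x m j N" "M \<subseteq> N"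
    using assms unfolding extension_code_def by blast
  obtain Hs where "list_rep vec_rep i Hs" "M = mod_span (scale S) (set (map (vec_val m) Hs))"
    using submodule_codeD[OF ij(2)] by blast
  moreover obtain Gs where "list_rep vec_rep j Gs" "N = mod_span (scale S) (set (map (vec_val m) Gs))"
    using submodule_codeD[OF ij(3)] by blast
  ultimately show ?thesis
    using ij(4) by (intro exI[of _ Hs] exI[of _ Gs]) (simp add: prod_rep_def ij(1))
qed

section \<open>Adapting inputs and outputs to the side of the module\<close>

definition prepare :: "side \<Rightarrow> nat \<Rightarrow> 'k fvec list \<Rightarrow> 'k fvec list" where
  "prepare S m Es = map (\<lambda>E i. if i < m then formal_twist S (E i) else []) Es"

text \<open>Returns lists of exact length \<open>m\<close>, as \<open>vec_code\<close> demands; the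
  code of a vector as a function may have any length.\<close>

definition finish :: "side \<Rightarrow> nat \<Rightarrow> 'k fvec list \<Rightarrow> 'k formal list list" where
  "finish S m Es = map (\<lambda>E. map (\<lambda>i. formal_twist S (E i)) [0..<m]) Es"

lemma computable_formal_twist:
  assumes "computable A formal_rep f"
  shows "computable A formal_rep (\<lambda>e. formal_twist S (f e))"
  using assms computable_formal_star[OF assms] by (cases S) (simp_all add: formal_twist_def)

lemma computable_prepare:
  assumes "computable A nat_rep m" "computable A (list_rep vec_rep) f"
  shows "computable A (list_rep vec_rep) (\<lambda>e. prepare S (m e) (f e))"
proof -
  have "computable (prod_rep nat_rep (list_rep vec_rep)) (list_rep vec_rep) (\<lambda>t. prepare S (fst t) (snd t))"
    unfolding prepare_def by (rule computable_formal_twist K_rules)+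
  from computable_compose[OF this computable_Pair[OF assms]] show ?thesis by simp
qed

lemma computable_finish:
  assumes "computable A nat_rep m" "computable A (list_rep vec_rep) f"
  shows "computable A (list_rep (list_rep formal_rep)) (\<lambda>e. finish S (m e) (f e))"
proof -
  have "computable (prod_rep nat_rep (list_rep vec_rep)) (list_rep (list_rep formal_rep)) (\<lambda>t. finish S (fst t) (snd t))"
    unfolding finish_def by (rule computable_formal_twist K_rules)+
  from computable_compose[OF this computable_Pair[OF assms]] show ?thesis by simp
qed

lemma vec_val_prepare: "map (vec_val m) (prepare S m Es) = map (twist_vec S) (map (vec_val m) Es)"
  by (simp add: prepare_def vec_val_def twist_vec_def formal_val_twist nth_default_def fun_eq_iff)

lemma mod_span_prepare:
  "mod_span (scale S) (set (map (vec_val m) Es)) =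
    twist_vec S ` vspan (map (vec_val m) (prepare S m Es))"
  unfolding L.mod_span_set[symmetric] mod_span_twist[symmetric] vec_val_prepare
  by (simp only: set_map[of "twist_vec S"] image_twist_vec)

lemma submodule_code_finish:
  assumes "list_rep (list_rep formal_rep) l (finish S m Es)"
  shows "submodule_code S \<nu> r x m l (twist_vec S ` vspan (map (vec_val m) Es))"
proof -
  let ?vs = "map (twist_vec S) (map (vec_val m) Es)"
  have code: "vec_code \<nu> r x m c (twist_vec S (vec_val m E))"
    if c: "list_rep formal_rep c (map (\<lambda>i. formal_twist S (E i)) [0..<m])" for c E
  proof -
    let ?fs = "map (\<lambda>i. formal_twist S (E i)) [0..<m]"
    have "list_all2 formal_rep (list_decode c) ?fs"
      using c by (simp add: list_rep_def nth_default_def)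
    then have "length (list_decode c) = m" "\<forall>i<m. formal_rep (list_decode c ! i) (formal_twist S (E i))"
      by (auto simp: list_all2_conv_all_nth)
    then show ?thesis
      unfolding vec_code_def alg_code_iff
      by (intro exI[of _ "list_decode c"]) (auto simp: twist_vec_def vec_val_def formal_val_twist[symmetric])
  qed
  have A: "list_all2 (list_rep formal_rep) (list_decode l) (finish S m Es)"
    using assms unfolding list_rep_def[of _ l] .
  have len: "length (list_decode l) = length Es"
    using list_all2_lengthD[OF A] by (simp add: finish_def)
  have "list_all2 (vec_code \<nu> r x m) (list_decode l) ?vs"
  proof (rule list_all2_all_nthI)
    show "length (list_decode l) = length ?vs" by (simp add: len)
    fix i
    assume i: "i < length (list_decode l)"
    have "finish S m Es ! i = map (\<lambda>j. formal_twist S ((Es ! i) j)) [0..<m]"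
      using i by (simp add: finish_def len)
    with list_all2_nthD[OF A i] have "vec_code \<nu> r x m (list_decode l ! i) (twist_vec S (vec_val m (Es ! i)))"
      by (intro code) simp
    then show "vec_code \<nu> r x m (list_decode l ! i) (?vs ! i)" using i by (simp add: len)
  qed
  moreover have "twist_vec S ` vspan (map (vec_val m) Es) = mod_span (scale S) (set ?vs)"
    unfolding L.mod_span_set[symmetric] mod_span_twist[symmetric] by (simp only: set_map)
  ultimately show ?thesis
    unfolding submodule_code_def by (intro exI[of _ "list_decode l"] exI[of _ ?vs]) simp
qed

abbreviation input_rep :: "(nat \<times> 'k fvec list \<times> 'k fvec list) rep" where
  "input_rep \<equiv> prod_rep nat_rep (prod_rep (list_rep vec_rep) (list_rep vec_rep))"

lemma extension_code_cases:
  assumes "extension_code S \<nu> r x m n M N"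
  obtains Hs Gs where "input_rep n (m, (Hs, Gs))"
    "module_extension r x \<nu> m (prepare S m Hs) (prepare S m Gs)"
    "M = twist_vec S ` vspan (map (vec_val m) (prepare S m Hs))"
    "N = twist_vec S ` vspan (map (vec_val m) (prepare S m Gs))"
proof -
  obtain Hs Gs where *: "input_rep n (m, (Hs, Gs))"
      "M = mod_span (scale S) (set (map (vec_val m) Hs))" "N = mod_span (scale S) (set (map (vec_val m) Gs))" "M \<subseteq> N"
    using extension_codeD[OF assms] by (elim exE conjE)
  have "module_extension r x \<nu> m (prepare S m Hs) (prepare S m Gs)"
  proof unfold_locales
    \<comment> \<open>Computability supplies codes for the prepared generators, which is what
      \<open>represented\<close> asks for.\<close>
    have "computable input_rep (list_rep vec_rep) (\<lambda>e. prepare S (fst e) (fst (snd e)))"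
      "computable input_rep (list_rep vec_rep) (\<lambda>e. prepare S (fst e) (snd (snd e)))"
      by (rule computable_prepare computable_fst computable_snd computable_id)+
    from this[THEN computable_represented, OF *(1)]
    show "represented (prepare S m Hs)" "represented (prepare S m Gs)" by simp_all
    show "vspan (map (vec_val m) (prepare S m Hs)) \<subseteq>
        vspan (map (vec_val m) (prepare S m Gs))"
      using *(4) unfolding *(2,3) mod_span_prepare twist_vec_subset_iff .
  qed
  with * that show ?thesis unfolding mod_span_prepare by blast
qed

end

theorem theorem1p2:
  fixes \<nu> :: "nat \<Rightarrow> 'k::field option"
    and r :: nat
    and x :: "nat \<Rightarrow> 'f::group_add"
    and S :: side
  assumes "computable_field \<nu>"
    and "r \<ge> 1"
    and "free_group_basis r x"
  shows
    "(\<exists>A. partial_recursive A \<and>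
        (\<forall>m n. \<forall>M N :: (nat \<Rightarrow> 'f \<Rightarrow>\<^sub>0 'k) set. m \<ge> 1 \<and> extension_code S \<nu> r x m n M N \<longrightarrow>
           (\<exists>l L. A n = Some l \<and> submodule_code S \<nu> r x m l L \<and>
                  is_algebraic_closure (scale S) M N L))) \<and>
     (\<exists>A. partial_recursive A \<and>
        (\<forall>m n. \<forall>M N :: (nat \<Rightarrow> 'f \<Rightarrow>\<^sub>0 'k) set. m \<ge> 1 \<and> extension_code S \<nu> r x m n M N \<longrightarrow>
           A n = Some (if algebraic_ext (scale S) M N then 1 else 0))) \<and>
     (\<exists>A. partial_recursive A \<and>
        (\<forall>m n. \<forall>M N :: (nat \<Rightarrow> 'f \<Rightarrow>\<^sub>0 'k) set. m \<ge> 1 \<and> extension_code S \<nu> r x m n M N \<longrightarrow>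
           A n = Some (if free_factor (scale S) M N then 1 else 0)))"
proof -
  interpret computable_free_group r x \<nu>
    by unfold_locales (use assms in simp_all)
  let ?H = "\<lambda>e. prepare S (fst e) (fst (snd e))" and ?G = "\<lambda>e. prepare S (fst e) (snd (snd e))"
  let ?L = "\<lambda>e. closure_gens (fst e) (?H e) (?G e)"
  let ?sp = "\<lambda>m Es. vspan (map (vec_val m) Es) :: (nat \<Rightarrow> 'f \<Rightarrow>\<^sub>0 'k) set"
  note rules = computable_finish computable_span_subset computable_closure_gens computable_prepare
    computable_fst computable_snd computable_id
  have c1: "computable input_rep (list_rep (list_rep formal_rep)) (\<lambda>e. finish S (fst e) (?L e))"
    by (rule rules)+
  \<comment> \<open>By \<open>algebraic_ext_iff\<close> and \<open>free_factor_iff\<close> the two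
    decisions test whether the closure contains all of \<open>N\<close> and whether it lies in
    \<open>M\<close>.\<close>
  have c2: "computable input_rep bool_rep (\<lambda>e. span_subset (fst e) (?G e) (?L e))"
    by (rule rules)+
  have c3: "computable input_rep bool_rep (\<lambda>e. span_subset (fst e) (?L e) (?H e))"
    by (rule rules)+
  show ?thesis
  proof (intro conjI)
    obtain A where A: "partial_recursive A" "\<forall>n e. input_rep n e \<longrightarrow>
        (\<exists>l. A n = Some l \<and> list_rep (list_rep formal_rep) l (finish S (fst e) (?L e)))"
      using c1 by (rule computableE)
    have "\<exists>l L. A n = Some l \<and> submodule_code S \<nu> r x m l L \<and> is_algebraic_closure (scale S) M N L"
      if "extension_code S \<nu> r x m n M N" for m n and M N :: "(nat \<Rightarrow> 'f \<Rightarrow>\<^sub>0 'k) set"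
      using that
    proof (rule extension_code_cases)
      fix Hs Gs
      assume *: "input_rep n (m, Hs, Gs)" "module_extension r x \<nu> m (prepare S m Hs) (prepare S m Gs)"
        "M = twist_vec S ` ?sp m (prepare S m Hs)" "N = twist_vec S ` ?sp m (prepare S m Gs)"
      interpret module_extension r x \<nu> m "prepare S m Hs" "prepare S m Gs" by (rule *(2))
      obtain l where l: "A n = Some l" "list_rep (list_rep formal_rep) l (finish S m Ls)"
        using A(2) *(1) by fastforce
      show ?thesis
        using l(1) submodule_code_finish[OF l(2)] is_algebraic_closure_Ls
        unfolding *(3,4) is_algebraic_closure_twist[symmetric, of _ _ _ S] by blast
    qed
    then show "\<exists>A. partial_recursive A \<and>
        (\<forall>m n. \<forall>M N :: (nat \<Rightarrow> 'f \<Rightarrow>\<^sub>0 'k) set. m \<ge> 1 \<and> extension_code S \<nu> r x m n M N \<longrightarrow>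
           (\<exists>l L. A n = Some l \<and> submodule_code S \<nu> r x m l L \<and>
                  is_algebraic_closure (scale S) M N L))"
      using A(1) by blast
  next
    obtain A where A: "partial_recursive A" "\<forall>n e. input_rep n e \<longrightarrow>
        (\<exists>k. A n = Some k \<and> bool_rep k (span_subset (fst e) (?G e) (?L e)))"
      using c2 by (rule computableE)
    have "A n = Some (if algebraic_ext (scale S) M N then 1 else 0)"
      if "extension_code S \<nu> r x m n M N" for m n and M N :: "(nat \<Rightarrow> 'f \<Rightarrow>\<^sub>0 'k) set"
      using that
    proof (rule extension_code_cases)
      fix Hs Gs
      assume *: "input_rep n (m, Hs, Gs)" "module_extension r x \<nu> m (prepare S m Hs) (prepare S m Gs)"
        "M = twist_vec S ` ?sp m (prepare S m Hs)" "N = twist_vec S ` ?sp m (prepare S m Gs)"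
      interpret module_extension r x \<nu> m "prepare S m Hs" "prepare S m Gs" by (rule *(2))
      obtain k where k: "A n = Some k" "bool_rep k (span_subset m (prepare S m Gs) Ls)"
        using A(2) *(1) by fastforce
      show ?thesis
        using k unfolding *(3,4) algebraic_ext_twist algebraic_ext_iff span_subset_correct[OF Gs represented_Ls]
        by (simp add: bool_rep_def)
    qed
    then show "\<exists>A. partial_recursive A \<and>
        (\<forall>m n. \<forall>M N :: (nat \<Rightarrow> 'f \<Rightarrow>\<^sub>0 'k) set. m \<ge> 1 \<and> extension_code S \<nu> r x m n M N \<longrightarrow>
           A n = Some (if algebraic_ext (scale S) M N then 1 else 0))"
      using A(1) by blast
  next
    obtain A where A: "partial_recursive A" "\<forall>n e. input_rep n e \<longrightarrow>
        (\<exists>k. A n = Some k \<and> bool_rep k (span_subset (fst e) (?L e) (?H e)))"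
      using c3 by (rule computableE)
    have "A n = Some (if free_factor (scale S) M N then 1 else 0)"
      if "extension_code S \<nu> r x m n M N" for m n and M N :: "(nat \<Rightarrow> 'f \<Rightarrow>\<^sub>0 'k) set"
      using that
    proof (rule extension_code_cases)
      fix Hs Gs
      assume *: "input_rep n (m, Hs, Gs)" "module_extension r x \<nu> m (prepare S m Hs) (prepare S m Gs)"
        "M = twist_vec S ` ?sp m (prepare S m Hs)" "N = twist_vec S ` ?sp m (prepare S m Gs)"
      interpret module_extension r x \<nu> m "prepare S m Hs" "prepare S m Gs" by (rule *(2))
      obtain k where k: "A n = Some k" "bool_rep k (span_subset m Ls (prepare S m Hs))"
        using A(2) *(1) by fastforce
      show ?thesis
        using k unfolding *(3,4) free_factor_twist free_factor_iff span_subset_correct[OF represented_Ls Hs]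
        by (simp add: bool_rep_def)
    qed
    then show "\<exists>A. partial_recursive A \<and>
        (\<forall>m n. \<forall>M N :: (nat \<Rightarrow> 'f \<Rightarrow>\<^sub>0 'k) set. m \<ge> 1 \<and> extension_code S \<nu> r x m n M N \<longrightarrow>
           A n = Some (if free_factor (scale S) M N then 1 else 0))"
      using A(1) by blast
  qed
qed

end
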